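(* Let $G$ be a finite graph embedded (not necessarily cellularly) in a compact surface $\Sigma$, possibly nonorientable, and let $\Delta = 2c(\Sigma) - \chi(\Sigma)$. Then \[ T_{G}(X,Y) = Y^{\Delta/2}\, P_{G,\Sigma}(X,Y,Y,Y^{-1}). \]
   Context: For a space $Z$, $c(Z)$ is its number of connected components and $\chi$ denotes Euler characteristic. A spanning subgraph $F$ of $G$ contains all vertices of $G$ and a subset of its edges; $F$ is identified with its image in $\Sigma$. For a graph $F$, $v(F)$, $e(F)$, $c(F)$ are its numbers of vertices, edges, components, and $n(F) = e(F) - v(F) + c(F)$ is its nullity. The Tutte polynomial is normalized as $T_G(X,Y) = \sum_{F \subseteq G} X^{c(F)-c(G)} Y^{n(F)}$, the sum over spanning subgraphs. For a spanning subgraph $F$, let $\mathcal{F}$ be a regular neighborhood of $F$ in $\Sigma$; $\mathcal{S}(F)$ is the closed surface obtained by gluing a disc to each boundary component of $\mathcal{F}$, and $\mathcal{S}^{\perp}(F)$ is the closed surface obtained by gluing a disc to each boundary component of the closure of $\Sigma \setminus \mathcal{F}$. Define $s(F) = 2c(F) - \chi(\mathcal{S}(F))$ and $s^{\perp}(F) = 2c(\Sigma \setminus F) - \chi(\mathcal{S}^{\perp}(F))$. The generalized Krushkal polynomial is \[ P_{G,\Sigma}(X,Y,A,B) = \sum_{F \subseteq G} X^{c(F)-c(G)}\, Y^{c(\Sigma \setminus F) - c(\Sigma)}\, A^{s(F)/2}\, B^{s^{\perp}(F)/2}, \] a polynomial in $X, Y, A^{1/2}, B^{1/2}$.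
   Formalization: "Compact surface" is taken to mean closed surface (no boundary): for a surface with boundary the identity fails, e.g. a disc with one vertex has T = 1 and P = 1 but Δ = 1. *)

theory Defs
  imports "HOL-Homology.Homology" "HOL-Library.Poly_Mapping"
begin

section \<open>Number of components and Euler characteristic of a space\<close>

definition num_components :: "'a topology \<Rightarrow> nat" where
  "num_components Z = card (connected_components_of Z)"

definition int_independent :: "('a, 'm) monoid_scheme \<Rightarrow> 'a set \<Rightarrow> bool" where
  "int_independent H B \<longleftrightarrow>
     finite B \<and> B \<subseteq> carrier H \<and>
     (\<forall>k :: 'a \<Rightarrow> int. finprod H (\<lambda>b. b [^]\<^bsub>H\<^esub> k b) B = \<one>\<^bsub>H\<^esub> \<longrightarrow> (\<forall>b\<in>B. k b = 0))"

text \<open>The (torsion-free) rank of a commutative group; only meaningful when it is finite.\<close>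

definition abelian_rank :: "('a, 'm) monoid_scheme \<Rightarrow> nat" where
  "abelian_rank H = Sup (card ` {B. int_independent H B})"

definition betti :: "nat \<Rightarrow> 'a topology \<Rightarrow> nat" where
  "betti p Z = abelian_rank (homology_group (int p) Z)"

definition euler_char :: "'a topology \<Rightarrow> int" where
  "euler_char Z = (\<Sum>p | betti p Z \<noteq> 0. (- 1) ^ p * int (betti p Z))"


section \<open>Surfaces, subsurfaces, and gluing of discs\<close>

text \<open>Compact surface without boundary; it may be disconnected, nonorientable or empty.\<close>

definition closed_surface :: "'a topology \<Rightarrow> bool" where
  "closed_surface \<Sigma> \<longleftrightarrow>
     compact_space \<Sigma> \<and> Hausdorff_space \<Sigma> \<and>
     (\<forall>x\<in>topspace \<Sigma>. \<exists>U. openin \<Sigma> U \<and> x \<in> U \<and>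
        subtopology \<Sigma> U homeomorphic_space (euclidean :: complex topology))"

text \<open>A closed subset that is a locally flat codimension-0 submanifold with boundary. As the
  ambient surface has no boundary, the manifold boundary of \<open>N\<close> is its frontier.\<close>

definition subsurface :: "'a topology \<Rightarrow> 'a set \<Rightarrow> bool" where
  "subsurface \<Sigma> N \<longleftrightarrow>
     closedin \<Sigma> N \<and>
     (\<forall>x\<in>\<Sigma> frontier_of N. \<exists>U \<phi>. openin \<Sigma> U \<and> x \<in> U \<and>
        homeomorphic_map (subtopology \<Sigma> U) (euclidean :: complex topology) \<phi> \<and>
        \<phi> ` (U \<inter> N) = {z. 0 \<le> Im z})"

definition boundary_components :: "'a topology \<Rightarrow> 'a set \<Rightarrow> 'a set set" where
  "boundary_components \<Sigma> N = connected_components_of (subtopology \<Sigma> (\<Sigma> frontier_of N))"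

text \<open>A regular neighborhood of a compact set \<open>K\<close>: a subsurface \<open>N\<close> containing \<open>K\<close> in its
  interior that is the mapping cylinder of a map from its boundary onto \<open>K\<close>. The map \<open>h\<close> sends
  \<open>(x, 0)\<close> to \<open>x\<close>, is a homeomorphism from \<open>\<partial>N \<times> [0,1)\<close> onto \<open>N - K\<close>, and at time 1 collapses
  the boundary onto \<open>K\<close>.\<close>

definition regular_neighborhood :: "'a topology \<Rightarrow> 'a set \<Rightarrow> 'a set \<Rightarrow> bool" where
  "regular_neighborhood \<Sigma> K N \<longleftrightarrow>
     subsurface \<Sigma> N \<and> K \<subseteq> \<Sigma> interior_of N \<and>
     (\<exists>h :: 'a \<times> real \<Rightarrow> 'a.
        continuous_map (prod_topology (subtopology \<Sigma> (\<Sigma> frontier_of N)) (top_of_set {0..1}))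
          (subtopology \<Sigma> N) h \<and>
        (\<forall>x\<in>\<Sigma> frontier_of N. h (x, 0) = x) \<and>
        homeomorphic_map
          (prod_topology (subtopology \<Sigma> (\<Sigma> frontier_of N)) (top_of_set {0..<1}))
          (subtopology \<Sigma> (N - K)) h \<and>
        h ` ((\<Sigma> frontier_of N) \<times> {1}) = K)"

definition attaching_maps :: "'a topology \<Rightarrow> 'a set \<Rightarrow> ('a set \<Rightarrow> complex \<Rightarrow> 'a) \<Rightarrow> bool" where
  "attaching_maps \<Sigma> N f \<longleftrightarrow>
     (\<forall>C\<in>boundary_components \<Sigma> N.
        homeomorphic_map (top_of_set (sphere 0 1)) (subtopology \<Sigma> C) (f C))"

text \<open>The adjunction space obtained from \<open>N\<close> by attaching, for every boundary component \<open>C\<close>, a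
  closed unit disc along \<open>f C\<close>. Points of \<open>N\<close> are tagged \<open>Inl\<close>, interior points of the disc
  attached to \<open>C\<close> are \<open>Inr (C, z)\<close>; \<open>disc_map f C\<close> is the characteristic map of that disc. The
  topology is the quotient topology, i.e. the final one for \<open>Inl\<close> and all the \<open>disc_map f C\<close>.\<close>

definition disc_map :: "('a set \<Rightarrow> complex \<Rightarrow> 'a) \<Rightarrow> 'a set \<Rightarrow> complex \<Rightarrow> 'a + 'a set \<times> complex" where
  "disc_map f C z = (if norm z < 1 then Inr (C, z) else Inl (f C z))"

definition glue_discs ::
  "'a topology \<Rightarrow> 'a set \<Rightarrow> ('a set \<Rightarrow> complex \<Rightarrow> 'a) \<Rightarrow> ('a + 'a set \<times> complex) topology" where
  "glue_discs \<Sigma> N f = topology (\<lambda>U.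
     U \<subseteq> Inl ` (topspace \<Sigma> \<inter> N) \<union> Inr ` (boundary_components \<Sigma> N \<times> ball 0 1) \<and>
     openin (subtopology \<Sigma> N) {x \<in> topspace \<Sigma> \<inter> N. Inl x \<in> U} \<and>
     (\<forall>C\<in>boundary_components \<Sigma> N.
        openin (top_of_set (cball 0 1)) {z \<in> cball 0 1. disc_map f C z \<in> U}))"

lemma openin_glue_discs:
  "openin (glue_discs \<Sigma> N f) U \<longleftrightarrow>
     U \<subseteq> Inl ` (topspace \<Sigma> \<inter> N) \<union> Inr ` (boundary_components \<Sigma> N \<times> ball 0 1) \<and>
     openin (subtopology \<Sigma> N) {x \<in> topspace \<Sigma> \<inter> N. Inl x \<in> U} \<and>
     (\<forall>C\<in>boundary_components \<Sigma> N.
        openin (top_of_set (cball 0 1)) {z \<in> cball 0 1. disc_map f C z \<in> U})"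
proof -
  have int: "{x \<in> A. g x \<in> S \<inter> T} = {x \<in> A. g x \<in> S} \<inter> {x \<in> A. g x \<in> T}"
    for A :: "'c set" and g :: "'c \<Rightarrow> 'd" and S T by blast
  have Un: "{x \<in> A. g x \<in> \<Union>\<K>} = (\<Union>S\<in>\<K>. {x \<in> A. g x \<in> S})"
    for A :: "'c set" and g :: "'c \<Rightarrow> 'd" and \<K> by blast
  have "istopology (\<lambda>U.
     U \<subseteq> Inl ` (topspace \<Sigma> \<inter> N) \<union> Inr ` (boundary_components \<Sigma> N \<times> ball 0 1) \<and>
     openin (subtopology \<Sigma> N) {x \<in> topspace \<Sigma> \<inter> N. Inl x \<in> U} \<and>
     (\<forall>C\<in>boundary_components \<Sigma> N.
        openin (top_of_set (cball 0 1)) {z \<in> cball 0 1. disc_map f C z \<in> U}))"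
    unfolding istopology_def int Un
    by (intro conjI allI impI ballI openin_Int openin_Union) (blast | force)+
  then show ?thesis
    by (simp add: glue_discs_def)
qed


section \<open>Finite graphs and their embeddings\<close>

text \<open>Undirected graphs; loops (a single end) and multiple edges are allowed.\<close>

record ('v, 'e) graph =
  verts :: "'v set"
  edges :: "'e set"
  ends :: "'e \<Rightarrow> 'v set"

definition finite_graph :: "('v, 'e) graph \<Rightarrow> bool" where
  "finite_graph G \<longleftrightarrow>
     finite (verts G) \<and> finite (edges G) \<and>
     (\<forall>e\<in>edges G. ends G e \<subseteq> verts G \<and> card (ends G e) \<in> {1, 2})"

definition spanning_subgraphs :: "('v, 'e) graph \<Rightarrow> ('v, 'e) graph set" where
  "spanning_subgraphs G = {F. verts F = verts G \<and> edges F \<subseteq> edges G \<and> ends F = ends G}"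

definition adjacency :: "('v, 'e) graph \<Rightarrow> ('v \<times> 'v) set" where
  "adjacency F = {(u, v). \<exists>e\<in>edges F. ends F e = {u, v}}"

definition graph_components :: "('v, 'e) graph \<Rightarrow> nat" where
  "graph_components F = card (verts F // (adjacency F)\<^sup>*)"

definition nullity :: "('v, 'e) graph \<Rightarrow> int" where
  "nullity F = int (card (edges F)) - int (card (verts F)) + int (graph_components F)"

definition graph_embedding ::
  "('v, 'e) graph \<Rightarrow> 'a topology \<Rightarrow> ('v \<Rightarrow> 'a) \<Rightarrow> ('e \<Rightarrow> real \<Rightarrow> 'a) \<Rightarrow> bool" where
  "graph_embedding G \<Sigma> p \<gamma> \<longleftrightarrow>
     inj_on p (verts G) \<and> p ` verts G \<subseteq> topspace \<Sigma> \<and>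
     (\<forall>e\<in>edges G.
        pathin \<Sigma> (\<gamma> e) \<and> {\<gamma> e 0, \<gamma> e 1} = p ` ends G e \<and>
        inj_on (\<gamma> e) {0<..<1} \<and> \<gamma> e ` {0<..<1} \<inter> p ` verts G = {}) \<and>
     (\<forall>e\<in>edges G. \<forall>e'\<in>edges G. e \<noteq> e' \<longrightarrow> \<gamma> e ` {0<..<1} \<inter> \<gamma> e' ` {0<..<1} = {})"

definition graph_image ::
  "('v \<Rightarrow> 'a) \<Rightarrow> ('e \<Rightarrow> real \<Rightarrow> 'a) \<Rightarrow> ('v, 'e) graph \<Rightarrow> 'a set" where
  "graph_image p \<gamma> F = p ` verts F \<union> (\<Union>e\<in>edges F. \<gamma> e ` {0..1})"


section \<open>Polynomials with rational exponents\<close>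

datatype var = VX | VY | VA | VB

text \<open>The monoid ring of rational exponent vectors over the integers: finite integer combinations
  of monomials \<open>X\<^sup>a Y\<^sup>b A\<^sup>c B\<^sup>d\<close> with rational (here always half-integral) exponents.\<close>

type_synonym monomial = "var \<Rightarrow>\<^sub>0 rat"
type_synonym gpoly = "monomial \<Rightarrow>\<^sub>0 int"

definition var_power :: "var \<Rightarrow> rat \<Rightarrow> gpoly" where
  "var_power v q = Poly_Mapping.single (Poly_Mapping.single v q) 1"

text \<open>Simultaneous substitution of the monomial with exponent vector \<open>\<sigma> v\<close> for each variable
  \<open>v\<close>; thus \<open>v\<^sup>q\<close> becomes the monomial with exponent vector \<open>q \<cdot> \<sigma> v\<close>.\<close>

definition subst_monomials :: "(var \<Rightarrow> monomial) \<Rightarrow> gpoly \<Rightarrow> gpoly" where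
  "subst_monomials \<sigma> P =
     (\<Sum>m\<in>Poly_Mapping.keys P.
        Poly_Mapping.single
          (\<Sum>v\<in>Poly_Mapping.keys m. Poly_Mapping.map ((*) (Poly_Mapping.lookup m v)) (\<sigma> v))
          (Poly_Mapping.lookup P m))"

text \<open>The substitution \<open>(X, Y, A, B) := (X, Y, Y, Y\<^sup>-\<^sup>1)\<close>.\<close>

primrec tutte_substitution :: "var \<Rightarrow> monomial" where
  "tutte_substitution VX = Poly_Mapping.single VX 1"
| "tutte_substitution VY = Poly_Mapping.single VY 1"
| "tutte_substitution VA = Poly_Mapping.single VY 1"
| "tutte_substitution VB = Poly_Mapping.single VY (- 1)"


section \<open>The Tutte polynomial and the generalized Krushkal polynomial\<close>

definition tutte_poly :: "('v, 'e) graph \<Rightarrow> gpoly" where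
  "tutte_poly G =
     (\<Sum>F\<in>spanning_subgraphs G.
        var_power VX (of_nat (graph_components F) - of_nat (graph_components G)) *
        var_power VY (of_int (nullity F)))"

text \<open>In the following, \<open>N\<close> is the chosen regular neighborhood of the spanning subgraph \<open>F\<close>, and
  \<open>f\<close>, \<open>g\<close> are the chosen attaching maps of the discs.\<close>

definition s_number ::
  "'a topology \<Rightarrow> ('v, 'e) graph \<Rightarrow> 'a set \<Rightarrow> ('a set \<Rightarrow> complex \<Rightarrow> 'a) \<Rightarrow> int" where
  "s_number \<Sigma> F N f = 2 * int (graph_components F) - euler_char (glue_discs \<Sigma> N f)"

definition closed_complement :: "'a topology \<Rightarrow> 'a set \<Rightarrow> 'a set" where
  "closed_complement \<Sigma> N = \<Sigma> closure_of (topspace \<Sigma> - N)"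

definition complement_components ::
  "'a topology \<Rightarrow> ('v \<Rightarrow> 'a) \<Rightarrow> ('e \<Rightarrow> real \<Rightarrow> 'a) \<Rightarrow> ('v, 'e) graph \<Rightarrow> nat" where
  "complement_components \<Sigma> p \<gamma> F =
     num_components (subtopology \<Sigma> (topspace \<Sigma> - graph_image p \<gamma> F))"

definition s_perp_number ::
  "'a topology \<Rightarrow> ('v \<Rightarrow> 'a) \<Rightarrow> ('e \<Rightarrow> real \<Rightarrow> 'a) \<Rightarrow> ('v, 'e) graph \<Rightarrow> 'a set \<Rightarrow>
    ('a set \<Rightarrow> complex \<Rightarrow> 'a) \<Rightarrow> int" where
  "s_perp_number \<Sigma> p \<gamma> F N g =
     2 * int (complement_components \<Sigma> p \<gamma> F) - euler_char (glue_discs \<Sigma> (closed_complement \<Sigma> N) g)"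

definition krushkal_poly ::
  "('v, 'e) graph \<Rightarrow> 'a topology \<Rightarrow> ('v \<Rightarrow> 'a) \<Rightarrow> ('e \<Rightarrow> real \<Rightarrow> 'a) \<Rightarrow>
    (('v, 'e) graph \<Rightarrow> 'a set) \<Rightarrow>
    (('v, 'e) graph \<Rightarrow> 'a set \<Rightarrow> complex \<Rightarrow> 'a) \<Rightarrow>
    (('v, 'e) graph \<Rightarrow> 'a set \<Rightarrow> complex \<Rightarrow> 'a) \<Rightarrow> gpoly" where
  "krushkal_poly G \<Sigma> p \<gamma> N f g =
     (\<Sum>F\<in>spanning_subgraphs G.
        var_power VX (of_nat (graph_components F) - of_nat (graph_components G)) *
        var_power VY (of_nat (complement_components \<Sigma> p \<gamma> F) - of_nat (num_components \<Sigma>)) *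
        var_power VA (of_int (s_number \<Sigma> F (N F) (f F)) / 2) *
        var_power VB (of_int (s_perp_number \<Sigma> p \<gamma> F (N F) (g F)) / 2))"

definition surface_delta :: "'a topology \<Rightarrow> int" where
  "surface_delta \<Sigma> = 2 * int (num_components \<Sigma>) - euler_char \<Sigma>"

end

theory Submission
  imports Defs "HOL-Analysis.Analysis"
begin

text \<open>Write \<open>K\<close> for the image of a spanning subgraph \<open>F\<close>, \<open>N\<close> for its regular neighborhood and \<open>M\<close> for
  the closed complement of \<open>N\<close>. All component counts cancel, and the exponents of \<open>Y\<close> agree as soon as
  \<open>\<chi>(S\<^sup>\<bottom>(F)) - \<chi>(S(F)) - \<chi>(\<Sigma>) = 2 (e(F) - v(F))\<close>. The mapping cylinder structure gives \<open>N \<simeq> K\<close>,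
  \<open>\<Sigma> - K \<simeq> M\<close> and \<open>N - K \<simeq> \<partial>N\<close>, a finite union of circles, so excision yields
  \<open>\<chi>(\<Sigma>) = \<chi>(M) + \<chi>(K)\<close>; attaching \<open>b\<close> discs adds \<open>b\<close> both to \<open>\<chi>(N) = \<chi>(K)\<close> and to \<open>\<chi>(M)\<close>; and
  \<open>\<chi>(K) = v(F) - e(F)\<close> by attaching the edges as 1-cells. The Euler characteristic being defined by
  ranks of singular homology, all this needs the homology of \<open>\<Sigma>\<close> to have finite total rank. Without
  a triangulation, this is obtained by showing that every compact \<open>A \<subseteq> \<Sigma>\<close> has arbitrarily small
  neighborhoods \<open>U \<subseteq> V\<close> for which \<open>H\<^sub>*(U) \<rightarrow> H\<^sub>*(V)\<close> has finite rank.\<close>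

section \<open>Rank of commutative groups\<close>

text \<open>The obstacle is finiteness. \<open>abelian_rank\<close> is a supremum of natural numbers
  and \<open>euler_char\<close> a sum over the nonzero Betti numbers, so neither is additive unless
  all ranks are finite and almost all vanish. Euler characteristics are therefore carried by the
  predicate \<open>has_euler\<close>, and for the complement of \<open>N\<close> finiteness is
  derived from that for \<Sigma>, \<open>K\<close> and the boundary. For \<Sigma> itself, induction
  over a cover by charts fails on the homology groups alone: compact subsets of charts may meet in
  sets whose homology has infinite rank. The image of the homology of \<open>U\<close> in that of a
  larger \<open>V\<close> behaves better: between a compact subset of a chart and \<open>V\<close>
  there is room for a finite union of balls, and Mayer-Vietoris bounds such images if some room is
  given up at each step. For the whole space \<open>U\<close> and \<open>V\<close> must both be
  \<Sigma>, and the image is the whole group. The factor 2 arises because \<open>k = v - e\<close>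
  enters the two sides with opposite signs: with \<open>b\<close> boundary circles the glued
  surfaces have Euler characteristics \<open>\<chi>(\<Sigma>) - k + b\<close> and
  \<open>k + b\<close>.\<close>

definition indep_family :: "('a, 'm) monoid_scheme \<Rightarrow> 'i set \<Rightarrow> ('i \<Rightarrow> 'a) \<Rightarrow> bool" where
  "indep_family H I x \<longleftrightarrow> finite I \<and> x \<in> I \<rightarrow> carrier H \<and>
     (\<forall>k :: 'i \<Rightarrow> int. finprod H (\<lambda>i. x i [^]\<^bsub>H\<^esub> k i) I = \<one>\<^bsub>H\<^esub> \<longrightarrow> (\<forall>i\<in>I. k i = 0))"

text \<open>\<open>X\<close> is a mere subset and independence is tested in the ambient
  \<open>H\<close>, so images and kernels can be measured without being made into groups of their
  own.\<close>

definition rank_le :: "('a, 'm) monoid_scheme \<Rightarrow> 'a set \<Rightarrow> nat \<Rightarrow> bool" where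
  "rank_le H X n \<longleftrightarrow> (\<forall>B. int_independent H B \<and> B \<subseteq> X \<longrightarrow> card B \<le> n)"

definition has_rank :: "('a, 'm) monoid_scheme \<Rightarrow> 'a set \<Rightarrow> nat \<Rightarrow> bool" where
  "has_rank H X n \<longleftrightarrow> rank_le H X n \<and> (\<exists>B. int_independent H B \<and> B \<subseteq> X \<and> card B = n)"

lemma hom_finprod:
  assumes "comm_group A" "comm_group B" "f \<in> hom A B" "x \<in> I \<rightarrow> carrier A"
  shows "f (finprod A x I) = finprod B (\<lambda>i. f (x i)) I"
proof -
  interpret A: comm_group A by fact
  interpret B: comm_group B by fact
  interpret f: group_hom A B f
    by (simp add: A.is_group B.is_group assms(3) group_hom.intro group_hom_axioms.intro)
  show ?thesis
    using assms(4)
    by (induction I rule: infinite_finite_induct) (auto simp: Pi_iff)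
qed

lemma hom_finprod_int_pow:
  fixes k :: "'i \<Rightarrow> int"
  assumes "comm_group A" "comm_group B" "f \<in> hom A B" "x \<in> I \<rightarrow> carrier A"
  shows "f (finprod A (\<lambda>i. x i [^]\<^bsub>A\<^esub> k i) I) = finprod B (\<lambda>i. f (x i) [^]\<^bsub>B\<^esub> k i) I"
proof -
  interpret A: comm_group A by fact
  interpret B: comm_group B by fact
  have "f (finprod A (\<lambda>i. x i [^]\<^bsub>A\<^esub> k i) I) = finprod B (\<lambda>i. f (x i [^]\<^bsub>A\<^esub> k i)) I"
    using assms by (intro hom_finprod) (auto simp: Pi_iff)
  also have "\<dots> = finprod B (\<lambda>i. f (x i) [^]\<^bsub>B\<^esub> k i) I"
    using assms(3,4)
    by (intro B.finprod_cong')
       (auto simp: Pi_iff hom_int_pow A.is_group B.is_group dest: hom_in_carrier)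
  finally show ?thesis .
qed

context comm_group
begin

lemma finprod_int_pow_add:
  fixes k l :: "'i \<Rightarrow> int"
  assumes "x \<in> I \<rightarrow> carrier G"
  shows "finprod G (\<lambda>i. x i [^] (k i + l i)) I =
         finprod G (\<lambda>i. x i [^] k i) I \<otimes> finprod G (\<lambda>i. x i [^] l i) I"
proof -
  have "finprod G (\<lambda>i. x i [^] (k i + l i)) I = finprod G (\<lambda>i. x i [^] k i \<otimes> x i [^] l i) I"
    using assms by (intro finprod_cong') (auto simp: Pi_iff int_pow_mult)
  also have "\<dots> = finprod G (\<lambda>i. x i [^] k i) I \<otimes> finprod G (\<lambda>i. x i [^] l i) I"
    using assms by (intro finprod_multf) (auto simp: Pi_iff)
  finally show ?thesis .
qed

lemma finprod_int_pow_mult: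
  fixes k :: "'i \<Rightarrow> int"
  assumes "x \<in> I \<rightarrow> carrier G"
  shows "finprod G (\<lambda>i. x i [^] (c * k i)) I = finprod G (\<lambda>i. x i [^] k i) I [^] c"
  using assms
proof (induction I rule: infinite_finite_induct)
  case (insert i I)
  then have "finprod G (\<lambda>i. x i [^] k i) I \<in> carrier G"
    by (intro finprod_closed) auto
  with insert show ?case
    by (simp add: Pi_iff int_pow_distrib int_pow_pow mult.commute)
qed auto

lemma finprod_int_pow_sum:
  fixes k :: "'j \<Rightarrow> 'i \<Rightarrow> int" and c :: "'j \<Rightarrow> int"
  assumes "x \<in> I \<rightarrow> carrier G" "finite J"
  shows "finprod G (\<lambda>j. finprod G (\<lambda>i. x i [^] k j i) I [^] c j) J =
         finprod G (\<lambda>i. x i [^] (\<Sum>j\<in>J. c j * k j i)) I"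
  using assms(2)
proof (induction J rule: finite_induct)
  case (insert j J)
  have cl: "finprod G (\<lambda>i. x i [^] k j i) I \<in> carrier G" for j
    using assms(1) by (intro finprod_closed) (auto simp: Pi_iff)
  show ?case
    using insert cl assms(1)
    by (simp add: Pi_iff finprod_int_pow_add finprod_int_pow_mult)
qed auto

lemma finprod_int_pow_delta:
  fixes c :: int
  assumes "x \<in> I \<rightarrow> carrier G" "finite I" "j \<in> I"
  shows "finprod G (\<lambda>i. x i [^] (if i = j then c else 0)) I = x j [^] c"
proof -
  have "finprod G (\<lambda>i. x i [^] (if i = j then c else 0)) I =
        finprod G (\<lambda>i. if i = j then x i [^] c else \<one>) I"
    using assms by (intro finprod_cong') (auto simp: Pi_iff)
  also have "\<dots> = x j [^] c"
    using assms by (intro finprod_singleton_swap) (auto simp: Pi_iff)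
  finally show ?thesis .
qed

text \<open>A family, unlike a set, could repeat a member; a repetition would give the nontrivial
  relation with coefficients 1 and -1.\<close>

lemma indep_family_imp_inj:
  assumes "indep_family G I x"
  shows "inj_on x I"
proof (rule inj_onI, rule ccontr)
  fix i j assume ij: "i \<in> I" "j \<in> I" "x i = x j" "i \<noteq> j"
  have x: "x \<in> I \<rightarrow> carrier G" "finite I"
    using assms by (auto simp: indep_family_def)
  let ?k = "\<lambda>l. (if l = i then 1 else 0) + (if l = j then -1 else 0) :: int"
  have "finprod G (\<lambda>l. x l [^] ?k l) I = x i [^] (1::int) \<otimes> x j [^] (-1::int)"
    by (subst finprod_int_pow_add[OF x(1)]) (simp add: finprod_int_pow_delta x ij)
  also have "\<dots> = \<one>"
    using ij x by (simp add: Pi_iff int_pow_neg)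
  finally have "?k i = 0"
    using assms ij(1) unfolding indep_family_def by (elim conjE allE[of _ ?k] impE) blast+
  with ij show False by simp
qed

lemma indep_family_image:
  assumes "indep_family G I x"
  shows "int_independent G (x ` I)"
  unfolding int_independent_def
proof (intro conjI allI impI ballI)
  have inj: "inj_on x I" and x: "x \<in> I \<rightarrow> carrier G" "finite I"
    using assms indep_family_imp_inj by (auto simp: indep_family_def)
  show "finite (x ` I)" "x ` I \<subseteq> carrier G"
    using x by auto
  fix k :: "'a \<Rightarrow> int" and b
  assume 1: "finprod G (\<lambda>b. b [^] k b) (x ` I) = \<one>" and "b \<in> x ` I"
  then obtain i where i: "i \<in> I" "b = x i" by auto
  have "finprod G (\<lambda>b. b [^] k b) (x ` I) = finprod G (\<lambda>i. x i [^] k (x i)) I"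
    using x by (intro finprod_reindex inj) (auto simp: Pi_iff)
  with 1 assms have "\<forall>i\<in>I. k (x i) = 0"
    by (auto simp: indep_family_def)
  with i show "k b = 0" by auto
qed

lemma rank_le_indep_family:
  assumes "rank_le G X n" "indep_family G I x" "x \<in> I \<rightarrow> X"
  shows "card I \<le> n"
  using assms indep_family_image[OF assms(2)] indep_family_imp_inj[OF assms(2)]
  by (auto simp: rank_le_def Pi_iff image_subset_iff card_image dest!: spec[of _ "x ` I"])

lemma finprod_subgroup_closed:
  assumes "subgroup X G" "x \<in> I \<rightarrow> X"
  shows "finprod G x I \<in> X"
proof -
  interpret X: subgroup X G by fact
  show ?thesis
    using assms(2)
  proof (induction I rule: infinite_finite_induct)
    case (insert i I)
    then have "x \<in> I \<rightarrow> carrier G" using X.subset by auto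
    with insert show ?case using X.subset by auto
  qed auto
qed

lemma indep_family_hom_lift:
  assumes "comm_group H" "g \<in> hom G H" "x \<in> I \<rightarrow> carrier G" "indep_family H I (\<lambda>i. g (x i))"
  shows "indep_family G I x"
  unfolding indep_family_def
proof (intro conjI allI impI)
  show "finite I" "x \<in> I \<rightarrow> carrier G"
    using assms by (auto simp: indep_family_def)
  fix k
  assume 1: "finprod G (\<lambda>i. x i [^] (k i :: int)) I = \<one>"
  have "finprod H (\<lambda>i. g (x i) [^]\<^bsub>H\<^esub> k i) I = g \<one>"
    using hom_finprod_int_pow[OF _ assms(1,2,3), of k] 1 by (simp add: comm_group_axioms)
  also have "\<dots> = \<one>\<^bsub>H\<^esub>"
    using assms by (meson comm_group_def hom_one is_group)
  finally show "\<forall>i\<in>I. k i = 0"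
    using assms by (auto simp: indep_family_def)
qed

end

text \<open>Lift an independent set \<open>T\<close> from the image to \<open>X\<close> and keep a
  maximal part \<open>J\<close> of \<open>T\<close> whose lifts are independent under
  \<open>g\<close>, so that \<open>card J\<close> is at most \<open>b\<close>. A nonzero multiple of
  each further lift can be corrected by lifts from \<open>J\<close> to an element of the kernel of
  \<open>g\<close>, and the corrected elements stay independent under \<open>f\<close>. This serves
  as rank-nullity where no exact sequence is at hand.\<close>

lemma rank_le_hom:
  fixes A :: "('a, 'm) monoid_scheme" and B :: "('b, 'n) monoid_scheme" and C :: "('c, 'k) monoid_scheme"
  assumes A: "comm_group A" and B: "comm_group B" and C: "comm_group C"
    and f: "f \<in> hom A B" and g: "g \<in> hom A C" and X: "subgroup X A"
    and a: "rank_le B (f ` (X \<inter> kernel A C g)) a" and b: "rank_le C (g ` X) b"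
  shows "rank_le B (f ` X) (a + b)"
  unfolding rank_le_def
proof (intro allI impI, elim conjE)
  fix T assume T: "int_independent B T" "T \<subseteq> f ` X"
  interpret A: comm_group A by fact
  interpret B: comm_group B by fact
  interpret C: comm_group C by fact
  interpret X: subgroup X A by fact
  have finT: "finite T" and Tc: "T \<subseteq> carrier B"
    using T by (auto simp: int_independent_def)
  define x where "x = inv_into X f"
  have x: "\<And>t. t \<in> T \<Longrightarrow> x t \<in> X \<and> f (x t) = t"
    unfolding x_def using T(2) by (meson f_inv_into_f inv_into_into subsetD)
  have xc: "x \<in> T \<rightarrow> carrier A"
    using x X.subset by auto
  have gc: "g (x t) \<in> carrier C" if "t \<in> T" for t
    by (rule hom_in_carrier[OF g]) (use that xc in auto)
  define ind where "ind = (\<lambda>J. J \<subseteq> T \<and> indep_family C J (\<lambda>t. g (x t)))"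
  have "ind {}" by (simp add: ind_def indep_family_def)
  moreover have "\<forall>J. ind J \<longrightarrow> card J \<le> card T"
    using finT by (auto simp: ind_def card_mono)
  ultimately obtain J where J: "ind J" and max: "\<And>J'. ind J' \<Longrightarrow> card J' \<le> card J"
    using ex_has_greatest_nat[of ind "{}" card "Suc (card T)"] by (auto simp: less_Suc_eq_le)
  have JT: "J \<subseteq> T" and Jind: "indep_family C J (\<lambda>t. g (x t))"
    using J by (auto simp: ind_def)
  have finJ: "finite J" using JT finT finite_subset by blast
  have cardJ: "card J \<le> b"
    using C.rank_le_indep_family[OF b Jind] x JT by auto
  \<comment> \<open>Maximality of \<open>J\<close>: adding \<open>t\<close> produces a relation
    under \<open>g\<close>, and its coefficient at \<open>t\<close> is nonzero because
    \<open>J\<close> alone is independent.\<close>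
  have "\<exists>k :: 'b \<Rightarrow> int. k t \<noteq> 0 \<and> (\<forall>s. s \<notin> insert t J \<longrightarrow> k s = 0) \<and>
          finprod C (\<lambda>s. g (x s) [^]\<^bsub>C\<^esub> k s) (insert t J) = \<one>\<^bsub>C\<^esub>"
    if t: "t \<in> T - J" for t
  proof -
    have "\<not> ind (insert t J)"
    proof
      assume "ind (insert t J)"
      from max[OF this] show False using t finJ by simp
    qed
    then have "\<not> indep_family C (insert t J) (\<lambda>t. g (x t))"
      using t JT by (auto simp: ind_def)
    then obtain k :: "'b \<Rightarrow> int" and s0 where
      k: "finprod C (\<lambda>s. g (x s) [^]\<^bsub>C\<^esub> k s) (insert t J) = \<one>\<^bsub>C\<^esub>" and s0: "s0 \<in> insert t J" "k s0 \<noteq> 0"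
      using t JT finJ gc unfolding indep_family_def by auto
    have ne: "k t \<noteq> 0"
    proof
      assume 0: "k t = 0"
      have "finprod C (\<lambda>s. g (x s) [^]\<^bsub>C\<^esub> k s) J = \<one>\<^bsub>C\<^esub>"
        using k 0 t finJ gc JT by (subst (asm) C.finprod_insert) (auto simp: subset_iff)
      then have "\<forall>s\<in>J. k s = 0" using Jind by (auto simp: indep_family_def)
      with s0 0 show False by auto
    qed
    \<comment> \<open>Cut off outside \<open>insert t J\<close>, so that the relation can later be
      taken over all of \<open>T\<close>.\<close>
    define k' where "k' = (\<lambda>s. if s \<in> insert t J then k s else 0)"
    have "finprod C (\<lambda>s. g (x s) [^]\<^bsub>C\<^esub> k' s) (insert t J) = finprod C (\<lambda>s. g (x s) [^]\<^bsub>C\<^esub> k s) (insert t J)"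
      using gc t JT by (intro C.finprod_cong') (auto simp: k'_def)
    with k ne show ?thesis
      by (intro exI[of _ k']) (auto simp: k'_def)
  qed
  then obtain k :: "'b \<Rightarrow> 'b \<Rightarrow> int" where
    k: "\<And>t. t \<in> T - J \<Longrightarrow> k t t \<noteq> 0"
       "\<And>t s. t \<in> T - J \<Longrightarrow> s \<notin> insert t J \<Longrightarrow> k t s = 0"
       "\<And>t. t \<in> T - J \<Longrightarrow> finprod C (\<lambda>s. g (x s) [^]\<^bsub>C\<^esub> k t s) (insert t J) = \<one>\<^bsub>C\<^esub>"
    by metis
  define u where "u = (\<lambda>t. finprod A (\<lambda>s. x s [^]\<^bsub>A\<^esub> k t s) T)"
  have uX: "u t \<in> X" for t
    unfolding u_def using x by (intro A.finprod_subgroup_closed X) (auto intro: A.subgroup_int_pow_closed[OF X])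
  have ug: "u t \<in> kernel A C g" if "t \<in> T - J" for t
  proof -
    have "g (u t) = finprod C (\<lambda>s. g (x s) [^]\<^bsub>C\<^esub> k t s) T"
      unfolding u_def by (rule hom_finprod_int_pow[OF A C g xc])
    also have "\<dots> = finprod C (\<lambda>s. g (x s) [^]\<^bsub>C\<^esub> k t s) (insert t J)"
      using that JT gc by (intro C.finprod_mono_neutral_cong_right finT) (auto simp: k(2))
    finally show ?thesis
      using uX[of t] X.subset that by (auto simp: kernel_def k(3))
  qed
  have fu: "f (u t) = finprod B (\<lambda>s. s [^]\<^bsub>B\<^esub> k t s) T" for t
  proof -
    have "f (u t) = finprod B (\<lambda>s. f (x s) [^]\<^bsub>B\<^esub> k t s) T"
      unfolding u_def by (rule hom_finprod_int_pow[OF A B f xc])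
    also have "\<dots> = finprod B (\<lambda>s. s [^]\<^bsub>B\<^esub> k t s) T"
      using x Tc by (intro B.finprod_cong') auto
    finally show ?thesis .
  qed
  \<comment> \<open>On the columns in \<open>T - J\<close> the coefficient matrix \<open>k\<close>
    is diagonal with nonzero entries, so the coefficient at \<open>s\<close> of a relation is just
    \<open>c s * k s s\<close>.\<close>
  have "indep_family B (T - J) (\<lambda>t. f (u t))"
    unfolding indep_family_def
  proof (intro conjI allI impI ballI)
    show "finite (T - J)" using finT by simp
    show "(\<lambda>t. f (u t)) \<in> T - J \<rightarrow> carrier B"
      using f uX X.subset by (auto dest: hom_in_carrier)
    fix c :: "'b \<Rightarrow> int" and s
    assume 1: "finprod B (\<lambda>t. f (u t) [^]\<^bsub>B\<^esub> c t) (T - J) = \<one>\<^bsub>B\<^esub>" and s: "s \<in> T - J"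
    have "finprod B (\<lambda>t. f (u t) [^]\<^bsub>B\<^esub> c t) (T - J) =
          finprod B (\<lambda>s. s [^]\<^bsub>B\<^esub> (\<Sum>t\<in>T - J. c t * k t s)) T"
      unfolding fu using Tc finT by (intro B.finprod_int_pow_sum) auto
    with 1 T(1) s have 0: "(\<Sum>t\<in>T - J. c t * k t s) = 0"
      unfolding int_independent_def by auto
    have "(\<Sum>t\<in>T - J. c t * k t s) = (\<Sum>t\<in>T - J. if t = s then c s * k s s else 0)"
      using s by (intro sum.cong) (auto simp: k(2))
    also have "\<dots> = c s * k s s" using s finT by simp
    finally show "c s = 0" using 0 k(1)[OF s] by simp
  qed
  from B.rank_le_indep_family[OF a this] have "card (T - J) \<le> a"
    using uX ug by auto
  moreover have "card T = card (T - J) + card J"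
    using JT finT by (simp add: card_Diff_subset finJ card_mono)
  ultimately show "card T \<le> a + b" using cardJ by simp
qed

lemma has_rank_unique: "has_rank H X n \<Longrightarrow> has_rank H X m \<Longrightarrow> n = m"
  by (auto simp: has_rank_def rank_le_def intro: antisym)

lemma rank_le_imp_has_rank:
  assumes "rank_le H X n"
  obtains m where "m \<le> n" "has_rank H X m"
proof -
  let ?P = "\<lambda>B. int_independent H B \<and> B \<subseteq> X"
  have "\<exists>B. ?P B \<and> (\<forall>B'. ?P B' \<longrightarrow> card B' \<le> card B)"
    if "\<exists>B. ?P B"
    using that assms ex_has_greatest_nat[of ?P _ card "Suc n"] by (auto simp: rank_le_def less_Suc_eq_le)
  moreover have "?P {}" if "\<one>\<^bsub>H\<^esub> = \<one>\<^bsub>H\<^esub>"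
    by (auto simp: int_independent_def)
  ultimately obtain B where "?P B" "\<And>B'. ?P B' \<Longrightarrow> card B' \<le> card B" by blast
  then show ?thesis using assms that[of "card B"] by (auto simp: has_rank_def rank_le_def)
qed

lemma rank_le_subset: "rank_le H X n \<Longrightarrow> Y \<subseteq> X \<Longrightarrow> rank_le H Y n"
  by (auto simp: rank_le_def)

lemma has_rank_imp_rank_le: "has_rank H X n \<Longrightarrow> rank_le H X n"
  by (simp add: has_rank_def)

lemma has_rank_abelian_rank:
  assumes "has_rank H (carrier H) n"
  shows "abelian_rank H = n"
proof -
  let ?S = "card ` {B. int_independent H B}"
  have le: "m \<le> n" if "m \<in> ?S" for m
    using that assms by (auto simp: has_rank_def rank_le_def int_independent_def)
  moreover have "n \<in> ?S"
    using assms by (auto simp: has_rank_def)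
  ultimately show ?thesis
    unfolding abelian_rank_def by (rule cSup_eq_maximum[rotated])
qed

text \<open>Chosen preimages of an independent set are independent, since a homomorphism carries
  every relation among them to one among their images.\<close>

lemma rank_le_hom_image:
  fixes A :: "('a, 'm) monoid_scheme" and C :: "('c, 'k) monoid_scheme"
  assumes "comm_group A" "comm_group C" "g \<in> hom A C" "X \<subseteq> carrier A" "rank_le A X n"
  shows "rank_le C (g ` X) n"
  unfolding rank_le_def
proof (intro allI impI, elim conjE)
  fix T assume T: "int_independent C T" "T \<subseteq> g ` X"
  interpret A: comm_group A by fact
  define x where "x = inv_into X g"
  have x: "\<And>t. t \<in> T \<Longrightarrow> x t \<in> X \<and> g (x t) = t"
    unfolding x_def using T(2) by (meson f_inv_into_f inv_into_into subsetD)
  interpret C: comm_group C by fact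
  have "indep_family C T (\<lambda>t. g (x t))"
    unfolding indep_family_def
  proof (intro conjI allI impI)
    show "finite T" "(\<lambda>t. g (x t)) \<in> T \<rightarrow> carrier C"
      using T(1) x by (auto simp: int_independent_def)
    fix k :: "'c \<Rightarrow> int" assume "(\<Otimes>\<^bsub>C\<^esub>i\<in>T. g (x i) [^]\<^bsub>C\<^esub> k i) = \<one>\<^bsub>C\<^esub>"
    also have "(\<Otimes>\<^bsub>C\<^esub>i\<in>T. g (x i) [^]\<^bsub>C\<^esub> k i) = (\<Otimes>\<^bsub>C\<^esub>i\<in>T. i [^]\<^bsub>C\<^esub> k i)"
      using T(1) x by (intro C.finprod_cong') (auto simp: int_independent_def)
    finally show "\<forall>i\<in>T. k i = 0" using T(1) by (auto simp: int_independent_def)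
  qed
  then have "indep_family A T x"
    using x assms by (intro A.indep_family_hom_lift[OF assms(2,3)]) auto
  then show "card T \<le> n"
    using A.rank_le_indep_family[OF assms(5)] x by auto
qed

text \<open>Rank-nullity over the integers. The upper bound is \<open>rank_le_hom\<close> with the
  identity as first map; for the lower bound, an independent set in the kernel and lifts of one in
  the image are independent together.\<close>

lemma has_rank_exact:
  assumes A: "comm_group A" and C: "comm_group C" and g: "g \<in> hom A C"
    and a: "has_rank A (kernel A C g) a" and b: "has_rank C (g ` carrier A) b"
  shows "has_rank A (carrier A) (a + b)"
proof -
  interpret A: comm_group A by fact
  interpret C: comm_group C by fact
  have ker: "kernel A C g \<subseteq> carrier A" by (auto simp: kernel_def)
  have "rank_le A (id ` carrier A) (a + b)"
    using a b ker by (intro rank_le_hom[OF A A C _ g A.subgroup_self])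
      (auto simp: has_rank_def id_def hom_def Int_absorb1)
  moreover obtain I where I: "int_independent A I" "I \<subseteq> kernel A C g" "card I = a"
    using a by (auto simp: has_rank_def)
  obtain J where J: "int_independent C J" "J \<subseteq> g ` carrier A" "card J = b"
    using b by (auto simp: has_rank_def)
  define y where "y = inv_into (carrier A) g"
  have y: "\<And>t. t \<in> J \<Longrightarrow> y t \<in> carrier A \<and> g (y t) = t"
    unfolding y_def using J(2) by (meson f_inv_into_f inv_into_into subsetD)
  \<comment> \<open>Indexing by the disjoint sum leaves it to independence to show that
    \<open>I\<close> and the lifts do not overlap.\<close>
  define z where "z = case_sum (\<lambda>i. i) y"
  have fin: "finite I" "finite J"
    using I J by (auto simp: int_independent_def)
  have zc: "z \<in> I <+> J \<rightarrow> carrier A"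
    using y I(2) ker by (auto simp: z_def)
  have ind: "indep_family A (I <+> J) z"
    unfolding indep_family_def
  proof (intro conjI allI impI)
    show "finite (I <+> J)" using fin by simp
    show "z \<in> I <+> J \<rightarrow> carrier A" by fact
    fix k :: "_ \<Rightarrow> int"
    assume 1: "finprod A (\<lambda>i. z i [^]\<^bsub>A\<^esub> k i) (I <+> J) = \<one>\<^bsub>A\<^esub>"
    let ?I = "finprod A (\<lambda>i. i [^]\<^bsub>A\<^esub> k (Inl i)) I" and ?J = "finprod A (\<lambda>j. y j [^]\<^bsub>A\<^esub> k (Inr j)) J"
    have "finprod A (\<lambda>i. z i [^]\<^bsub>A\<^esub> k i) (I <+> J) =
          finprod A (\<lambda>i. z i [^]\<^bsub>A\<^esub> k i) (Inl ` I) \<otimes>\<^bsub>A\<^esub> finprod A (\<lambda>i. z i [^]\<^bsub>A\<^esub> k i) (Inr ` J)"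
      unfolding Plus_def using fin zc by (intro A.finprod_Un_disjoint) (auto simp: Pi_iff)
    also have "\<dots> = ?I \<otimes>\<^bsub>A\<^esub> ?J"
      using y I(2) ker by (subst (1 2) A.finprod_reindex) (auto simp: Pi_iff inj_on_def z_def)
    finally have IJ: "?I \<otimes>\<^bsub>A\<^esub> ?J = \<one>\<^bsub>A\<^esub>" using 1 by simp
    have Ic: "?I \<in> carrier A" using I(2) ker by (intro A.finprod_closed) auto
    have Jc: "?J \<in> carrier A" using y by (intro A.finprod_closed) auto
    \<comment> \<open>The factor \<open>?I\<close> dies under \<open>g\<close>, so the coefficients
      on \<open>J\<close> vanish first; only then is \<open>?I\<close> left as a relation by
      itself.\<close>
    have "?I \<in> kernel A C g"
      using I(2) g A.is_group C.is_group
      by (intro A.finprod_subgroup_closed group_hom.subgroup_kernel group_hom.intro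
            group_hom_axioms.intro Pi_I A.subgroup_int_pow_closed) auto
    then have "g ?I = \<one>\<^bsub>C\<^esub>" by (simp add: kernel_def)
    then have "g ?J = \<one>\<^bsub>C\<^esub>"
      using hom_mult[OF g Ic Jc] hom_in_carrier[OF g Jc] hom_one[OF g A.is_group C.is_group] IJ
      by simp
    moreover have "g ?J = finprod C (\<lambda>j. g (y j) [^]\<^bsub>C\<^esub> k (Inr j)) J"
      using y by (intro hom_finprod_int_pow A C g) auto
    moreover have "\<dots> = finprod C (\<lambda>j. j [^]\<^bsub>C\<^esub> k (Inr j)) J"
      using J y by (intro C.finprod_cong') (auto simp: int_independent_def)
    ultimately have Jz: "\<forall>j\<in>J. k (Inr j) = 0"
      using J by (auto simp: int_independent_def dest!: spec[of _ "\<lambda>j. k (Inr j)"])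
    then have "?J = \<one>\<^bsub>A\<^esub>" by (intro A.finprod_one_eqI) auto
    then have "?I = \<one>\<^bsub>A\<^esub>" using IJ Ic by simp
    then have "\<forall>i\<in>I. k (Inl i) = 0"
      using I by (auto simp: int_independent_def dest!: spec[of _ "\<lambda>j. k (Inl j)"])
    with Jz show "\<forall>i\<in>I <+> J. k i = 0" by auto
  qed
  have "int_independent A (z ` (I <+> J))" "z ` (I <+> J) \<subseteq> carrier A" "card (z ` (I <+> J)) = a + b"
    using A.indep_family_image[OF ind] A.indep_family_imp_inj[OF ind] zc fin I J
    by (auto simp: card_image card_Plus Pi_iff)
  ultimately show ?thesis
    by (auto simp: has_rank_def)
qed

text \<open>Multiplication maps the direct product to \<open>C\<close>. Measured against the first
  coordinate \<open>f x\<close>, its kernel part contains values of \<open>g\<close> only, so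
  \<open>rank_le_hom\<close> adds the two bounds. In Mayer-Vietoris this counts the sums of classes
  from two sets of a cover.\<close>

lemma rank_le_group_prod:
  assumes A: "comm_group A" and B: "comm_group B" and C: "comm_group C"
    and f: "f \<in> hom A C" and g: "g \<in> hom B C"
    and a: "rank_le C (f ` carrier A) a" and b: "rank_le C (g ` carrier B) b"
  shows "rank_le C {f x \<otimes>\<^bsub>C\<^esub> g y |x y. x \<in> carrier A \<and> y \<in> carrier B} (b + a)"
proof -
  interpret A: comm_group A by fact
  interpret B: comm_group B by fact
  interpret C: comm_group C by fact
  let ?h = "\<lambda>(x, y). f x \<otimes>\<^bsub>C\<^esub> g y"
  have AB: "comm_group (A \<times>\<times> B)"
    by (intro group.group_comm_groupI DirProd_group)
       (auto simp: A.is_group B.is_group A.m_comm B.m_comm)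
  interpret AB: comm_group "A \<times>\<times> B" by fact
  note fc = hom_in_carrier[OF f] and gc = hom_in_carrier[OF g]
  have h: "?h \<in> hom (A \<times>\<times> B) C"
    using fc gc by (auto simp: hom_def hom_mult[OF f] hom_mult[OF g] C.m_ac)
  have f': "(\<lambda>(x, y). f x) \<in> hom (A \<times>\<times> B) C"
    using fc by (auto simp: hom_def hom_mult[OF f])
  have "rank_le C (?h ` carrier (A \<times>\<times> B)) (b + a)"
  proof (rule rank_le_hom[OF AB C C h f' AB.subgroup_self])
    show "rank_le C (?h ` (carrier (A \<times>\<times> B) \<inter> kernel (A \<times>\<times> B) C (\<lambda>(x, y). f x))) b"
      using gc by (intro rank_le_subset[OF b]) (auto simp: kernel_def)
    show "rank_le C ((\<lambda>(x, y). f x) ` carrier (A \<times>\<times> B)) a"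
      by (intro rank_le_subset[OF a]) auto
  qed
  moreover have "?h ` carrier (A \<times>\<times> B) = {f x \<otimes>\<^bsub>C\<^esub> g y |x y. x \<in> carrier A \<and> y \<in> carrier B}"
    by force
  ultimately show ?thesis by simp
qed


section \<open>Euler characteristics of pairs of spaces\<close>

lemma (in comm_group) rank_le_one: "rank_le G {\<one>} 0"
  unfolding rank_le_def
proof (intro allI impI, elim conjE)
  fix B assume B: "int_independent G B" "B \<subseteq> {\<one>}"
  have "finprod G (\<lambda>b. b [^] (1::int)) B = \<one>"
    using B(2) by (intro finprod_one_eqI) auto
  then have "\<forall>b\<in>B. (1::int) = 0"
    using B(1) unfolding int_independent_def by (elim conjE allE[of _ "\<lambda>_. 1"]) blast
  then have "B = {}" by auto
  then show "card B \<le> 0" by simp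
qed

lemma rank_le_trivial_group:
  assumes "comm_group H" "trivial_group H"
  shows "rank_le H (carrier H) 0"
  using assms comm_group.rank_le_one[OF assms(1)] by (simp add: trivial_group_def)

lemma has_rank_integer_group: "has_rank integer_group (carrier integer_group) 1"
proof -
  interpret Z: comm_group integer_group by (rule abelian_integer_group)
  have "card B \<le> 1" if B: "int_independent integer_group B" for B
  proof (rule ccontr)
    assume "\<not> card B \<le> 1"
    then obtain a b where ab: "a \<in> B" "b \<in> B" "a \<noteq> b"
      by (metis One_nat_def card_le_Suc0_iff_eq card.infinite zero_le_one)
    have fin: "finite B" using B by (auto simp: int_independent_def)
    \<comment> \<open>The relation \<open>b * a - a * b = 0\<close>, nontrivial because
      \<open>a\<close> and \<open>b\<close> are distinct and so not both 0.\<close>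
    let ?k = "\<lambda>x. (if x = a then b else 0) + (if x = b then - a else 0)"
    have "finprod integer_group (\<lambda>x. x [^]\<^bsub>integer_group\<^esub> ?k x) B =
          a [^]\<^bsub>integer_group\<^esub> b \<otimes>\<^bsub>integer_group\<^esub> b [^]\<^bsub>integer_group\<^esub> (- a)"
      using fin ab Z.finprod_int_pow_delta[of "\<lambda>x. x" B a b] Z.finprod_int_pow_delta[of "\<lambda>x. x" B b "- a"]
      by (subst Z.finprod_int_pow_add) auto
    also have "\<dots> = \<one>\<^bsub>integer_group\<^esub>" by simp
    finally have "\<forall>x\<in>B. ?k x = 0"
      using B unfolding int_independent_def by (elim conjE allE[of _ ?k]) blast
    then have "?k a = 0" "?k b = 0" using ab by blast+
    then show False using ab by auto
  qed
  moreover have "int_independent integer_group {1}"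
    unfolding int_independent_def by simp
  ultimately show ?thesis
    by (auto simp: has_rank_def rank_le_def intro!: exI[of _ "{1}"])
qed

lemma rank_le_iso:
  assumes "comm_group A" "comm_group B" "A \<cong> B" "rank_le A (carrier A) n"
  shows "rank_le B (carrier B) n"
proof -
  obtain f where f: "f \<in> hom A B" "f ` carrier A = carrier B"
    using assms(3) by (auto simp: is_iso_def iso_def bij_betw_def)
  with rank_le_hom_image[OF assms(1,2) f(1) subset_refl assms(4)] show ?thesis by simp
qed

lemma has_rank_iso:
  assumes "comm_group A" "comm_group B" "A \<cong> B" "has_rank A (carrier A) n"
  shows "has_rank B (carrier B) n"
proof -
  have B: "rank_le B (carrier B) n"
    using assms rank_le_iso has_rank_imp_rank_le by blast
  then obtain m where m: "m \<le> n" "has_rank B (carrier B) m"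
    by (rule rank_le_imp_has_rank)
  have "B \<cong> A" using assms by (meson comm_group_def group.iso_sym)
  then have "rank_le A (carrier A) m"
    using rank_le_iso[OF assms(2,1)] m has_rank_imp_rank_le by blast
  then have "n \<le> m" using assms(4) by (auto simp: has_rank_def rank_le_def)
  with m show ?thesis by simp
qed


text \<open>Finite total rank of a graded group, formulated for subsets of the groups so that it
  also speaks of images of homomorphisms.\<close>

definition ev_bounded_rank :: "(nat \<Rightarrow> ('a, 'm) monoid_scheme) \<Rightarrow> (nat \<Rightarrow> 'a set) \<Rightarrow> bool" where
  "ev_bounded_rank H Y \<longleftrightarrow>
     (\<forall>p. \<exists>n. rank_le (H p) (Y p) n) \<and> (\<exists>d. \<forall>p\<ge>d. rank_le (H p) (Y p) 0)"

lemma ev_bounded_rank_image: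
  assumes "ev_bounded_rank A (\<lambda>p. carrier (A p))" "\<And>p. comm_group (A p)" "\<And>p. comm_group (B p)"
    "\<And>p. f p \<in> hom (A p) (B p)"
  shows "ev_bounded_rank B (\<lambda>p. f p ` carrier (A p))"
  using assms unfolding ev_bounded_rank_def by (meson order_refl rank_le_hom_image)

lemma ev_bounded_rank_subset:
  assumes "ev_bounded_rank A X" "\<And>p. Y p \<subseteq> X p"
  shows "ev_bounded_rank A Y"
  using assms unfolding ev_bounded_rank_def by (meson rank_le_subset)

lemma ev_bounded_rank_Suc:
  assumes "ev_bounded_rank H Y"
  shows "ev_bounded_rank (\<lambda>p. H (Suc p)) (\<lambda>p. Y (Suc p))"
  using assms unfolding ev_bounded_rank_def by (meson le_SucI)

lemma ev_bounded_rankE: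
  assumes "ev_bounded_rank H Y"
  obtains r d where "\<And>p. has_rank (H p) (Y p) (r p)" "\<And>p. p \<ge> d \<Longrightarrow> r p = 0"
proof -
  have "\<exists>r. has_rank (H p) (Y p) r" for p
    using assms rank_le_imp_has_rank unfolding ev_bounded_rank_def by metis
  then obtain r where r: "\<And>p. has_rank (H p) (Y p) (r p)" by metis
  obtain d where d: "\<And>p. p \<ge> d \<Longrightarrow> rank_le (H p) (Y p) 0"
    using assms unfolding ev_bounded_rank_def by blast
  have "r p = 0" if "p \<ge> d" for p
    using r[of p] d[OF that] by (auto simp: has_rank_def rank_le_def)
  with r that show ?thesis by blast
qed

text \<open>A relation that certifies finiteness together with the value. Any degree beyond which
  the ranks vanish may serve as \<open>d\<close>; the value is the same
  (\<open>has_euler_unique\<close>).\<close>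

definition has_euler :: "'a topology \<Rightarrow> 'a set \<Rightarrow> int \<Rightarrow> bool" where
  "has_euler X S c \<longleftrightarrow>
     (\<exists>r d. (\<forall>p. has_rank (relative_homology_group (int p) X S)
                     (carrier (relative_homology_group (int p) X S)) (r p)) \<and>
            (\<forall>p\<ge>d. r p = 0) \<and> c = (\<Sum>p<d. (- 1) ^ p * int (r p)))"

lemma has_euler_euler_char:
  assumes "has_euler X {} c"
  shows "euler_char X = c"
proof -
  obtain r d where r: "\<And>p. has_rank (homology_group (int p) X) (carrier (homology_group (int p) X)) (r p)"
    and d: "\<And>p. p \<ge> d \<Longrightarrow> r p = 0" and c: "c = (\<Sum>p<d. (- 1) ^ p * int (r p))"
    using assms unfolding has_euler_def by blast
  have b: "betti p X = r p" for p
    unfolding betti_def by (rule has_rank_abelian_rank[OF r])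
  have "{p. r p \<noteq> 0} \<subseteq> {..<d}"
    using d by (force simp: not_less[symmetric])
  then have "(\<Sum>p | r p \<noteq> 0. (- 1) ^ p * int (r p)) = c"
    unfolding c by (intro sum.mono_neutral_left) auto
  moreover have "euler_char X = (\<Sum>p | r p \<noteq> 0. (- 1) ^ p * int (r p))"
    by (simp add: euler_char_def b)
  ultimately show ?thesis by simp
qed

abbreviation ev_bounded_homology :: "'a topology \<Rightarrow> 'a set \<Rightarrow> bool" where
  "ev_bounded_homology X S \<equiv> ev_bounded_rank (\<lambda>p. relative_homology_group (int p) X S)
     (\<lambda>p. carrier (relative_homology_group (int p) X S))"

lemma has_euler_imp_ev_bounded:
  assumes "has_euler X S c"
  shows "ev_bounded_homology X S"
proof -
  obtain r d where r: "\<And>p. has_rank (relative_homology_group (int p) X S)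
      (carrier (relative_homology_group (int p) X S)) (r p)" and d: "\<And>p. p \<ge> d \<Longrightarrow> r p = 0"
    using assms unfolding has_euler_def by blast
  have "rank_le (relative_homology_group (int p) X S) (carrier (relative_homology_group (int p) X S)) (r p)" for p
    using r by (rule has_rank_imp_rank_le)
  with d show ?thesis
    unfolding ev_bounded_rank_def by metis
qed

lemma ev_bounded_imp_has_euler:
  assumes "ev_bounded_homology X S"
  obtains c where "has_euler X S c"
proof -
  obtain r d where "\<And>p. has_rank (relative_homology_group (int p) X S)
      (carrier (relative_homology_group (int p) X S)) (r p)" "\<And>p. p \<ge> d \<Longrightarrow> r p = 0"
    using assms by (rule ev_bounded_rankE) blast
  then have "has_euler X S (\<Sum>p<d. (- 1) ^ p * int (r p))"
    unfolding has_euler_def by blast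
  then show ?thesis by (rule that)
qed

lemma has_euler_unique:
  assumes "has_euler X S c" "has_euler X S c'"
  shows "c = c'"
proof -
  obtain r d where r: "\<And>p. has_rank (relative_homology_group (int p) X S)
      (carrier (relative_homology_group (int p) X S)) (r p)"
    and d: "\<And>p. p \<ge> d \<Longrightarrow> r p = 0" and c: "c = (\<Sum>p<d. (- 1) ^ p * int (r p))"
    using assms(1) unfolding has_euler_def by blast
  obtain r' d' where r': "\<And>p. has_rank (relative_homology_group (int p) X S)
      (carrier (relative_homology_group (int p) X S)) (r' p)"
    and d': "\<And>p. p \<ge> d' \<Longrightarrow> r' p = 0" and c': "c' = (\<Sum>p<d'. (- 1) ^ p * int (r' p))"
    using assms(2) unfolding has_euler_def by blast
  have "r = r'" using r r' has_rank_unique by blast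
  have "c = (\<Sum>p<max d d'. (- 1) ^ p * int (r p))"
    unfolding c using d by (intro sum.mono_neutral_left) auto
  also have "\<dots> = c'"
    unfolding c' \<open>r = r'\<close> using d' by (intro sum.mono_neutral_right) auto
  finally show ?thesis .
qed

lemma has_euler_iso:
  assumes "has_euler X S c" "\<And>p. relative_homology_group p X S \<cong> relative_homology_group p Y T"
  shows "has_euler Y T c"
proof -
  have "has_rank (relative_homology_group (int p) Y T) (carrier (relative_homology_group (int p) Y T)) n"
    if "has_rank (relative_homology_group (int p) X S) (carrier (relative_homology_group (int p) X S)) n" for p n
    using has_rank_iso[OF _ _ assms(2) that] by simp
  then show ?thesis
    using assms(1) unfolding has_euler_def by blast
qed

text \<open>The rank of each connecting map enters once in the homology of the pair and once, one
  degree lower, in that of the subspace; with signs only the two ends survive.\<close>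

lemma alternating_sum_telescope:
  fixes \<delta> :: "nat \<Rightarrow> nat"
  shows "(\<Sum>p<d. (- 1) ^ p * (int (\<delta> (Suc p)) + int (\<delta> p))) = int (\<delta> 0) - (- 1) ^ d * int (\<delta> d)"
  by (induction d) (auto simp: algebra_simps)

text \<open>Each of the three kinds of maps in the sequence touches two of the three kinds of
  groups, so finiteness of any two of them bounds the ranks \<alpha>, \<beta>, \<delta> of all the
  maps. Rank-nullity then expresses every group by these ranks.\<close>

lemma euler_long_exact_sequence:
  fixes X :: "'a topology" and S :: "'a set"
  assumes "(ev_bounded_homology X {} \<and> ev_bounded_homology (subtopology X S) {}) \<or>
           (ev_bounded_homology X {} \<and> ev_bounded_homology X S) \<or>
           (ev_bounded_homology (subtopology X S) {} \<and> ev_bounded_homology X S)"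
  obtains a b where "has_euler (subtopology X S) {} a" "has_euler X S b" "has_euler X {} (a + b)"
proof -
  let ?S = "\<lambda>p. homology_group (int p) (subtopology X S)"
  let ?X = "\<lambda>p. homology_group (int p) X"
  let ?R = "\<lambda>p. relative_homology_group (int p) X S"
  define i where "i = (\<lambda>p. hom_induced (int p) (subtopology X S) {} X {} id)"
  define j where "j = (\<lambda>p. hom_induced (int p) X {} X S id)"
  define d where "d = (\<lambda>p. hom_boundary (int (Suc p)) X S)"
  have hi: "i p \<in> hom (?S p) (?X p)" for p by (simp add: i_def hom_induced_hom)
  have hj: "j p \<in> hom (?X p) (?R p)" for p by (simp add: j_def hom_induced_hom)
  have hd: "d p \<in> hom (?R (Suc p)) (?S p)" for p
    using hom_boundary_hom[of "int (Suc p)" X S] by (simp add: d_def)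
  have ki: "kernel (?S p) (?X p) (i p) = d p ` carrier (?R (Suc p))" for p
    using homology_exactness_axiom_2[of "int (Suc p)" X S] by (simp add: i_def d_def)
  have kj: "kernel (?X p) (?R p) (j p) = i p ` carrier (?S p)" for p
    using homology_exactness_axiom_3[of "int p" X S] by (simp add: i_def j_def)
  have kd: "kernel (?R (Suc p)) (?S p) (d p) = j (Suc p) ` carrier (?X (Suc p))" for p
    using homology_exactness_axiom_1[of "int (Suc p)" X S] by (simp add: j_def d_def)
  \<comment> \<open>The sequence ends in degree 0: the boundary map goes to homology in degree -1,
    which is trivial, so \<open>j 0\<close> is onto.\<close>
  have triv: "trivial_group (homology_group (- 1) (subtopology X S))"
    by (simp add: trivial_homology_group)
  have "hom_boundary 0 X S x = \<one>\<^bsub>homology_group (- 1) (subtopology X S)\<^esub>" if "x \<in> carrier (?R 0)" for x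
    using hom_boundary_hom[of 0 X S] triv that by (auto simp: trivial_group_def hom_def Pi_iff)
  then have "kernel (?R 0) (homology_group (- 1) (subtopology X S)) (hom_boundary 0 X S) = carrier (?R 0)"
    by (auto simp: kernel_def)
  then have kd0: "j 0 ` carrier (?X 0) = carrier (?R 0)"
    using homology_exactness_axiom_1[of 0 X S] by (simp add: j_def)
  note cg = abelian_relative_homology_group
  \<comment> \<open>The image of \<open>i\<close> is a homomorphic image of the homology of the
    subspace and a subset of that of \<open>X\<close>, so finiteness of either one suffices. The
    same alternative is used for \<open>j\<close> and \<open>d\<close>.\<close>
  have "ev_bounded_rank ?X (\<lambda>p. i p ` carrier (?S p))"
    using assms ev_bounded_rank_image[of ?S ?X i, OF _ cg cg hi]
      ev_bounded_rank_subset[of ?X "\<lambda>p. carrier (?X p)" "\<lambda>p. i p ` carrier (?S p)"] hi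
    by (auto simp: hom_def Pi_iff image_subset_iff)
  then obtain \<alpha> d1 where \<alpha>: "\<And>p. has_rank (?X p) (i p ` carrier (?S p)) (\<alpha> p)" "\<And>p. p \<ge> d1 \<Longrightarrow> \<alpha> p = 0"
    by (rule ev_bounded_rankE) blast
  have "ev_bounded_rank ?R (\<lambda>p. j p ` carrier (?X p))"
    using assms ev_bounded_rank_image[of ?X ?R j, OF _ cg cg hj]
      ev_bounded_rank_subset[of ?R "\<lambda>p. carrier (?R p)" "\<lambda>p. j p ` carrier (?X p)"] hj
    by (auto simp: hom_def Pi_iff image_subset_iff)
  then obtain \<beta> d2 where \<beta>: "\<And>p. has_rank (?R p) (j p ` carrier (?X p)) (\<beta> p)" "\<And>p. p \<ge> d2 \<Longrightarrow> \<beta> p = 0"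
    by (rule ev_bounded_rankE) blast
  have "ev_bounded_rank ?S (\<lambda>p. d p ` carrier (?R (Suc p)))"
    using assms ev_bounded_rank_image[of "\<lambda>p. ?R (Suc p)" ?S d, OF _ cg cg hd]
      ev_bounded_rank_subset[of ?S "\<lambda>p. carrier (?S p)" "\<lambda>p. d p ` carrier (?R (Suc p))"] hd
      ev_bounded_rank_Suc[of ?R "\<lambda>p. carrier (?R p)"]
    by (auto simp: hom_def Pi_iff image_subset_iff)
  then obtain \<delta> d3 where \<delta>: "\<And>p. has_rank (?S p) (d p ` carrier (?R (Suc p))) (\<delta> p)" "\<And>p. p \<ge> d3 \<Longrightarrow> \<delta> p = 0"
    by (rule ev_bounded_rankE) blast
  \<comment> \<open>\<open>\<delta>' p\<close> is the rank of the boundary map that leaves degree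
    \<open>p\<close>; for \<open>p = 0\<close> it is 0.\<close>
  define \<delta>' where "\<delta>' = (\<lambda>p. case p of 0 \<Rightarrow> 0 | Suc q \<Rightarrow> \<delta> q)"
  have rS: "has_rank (?S p) (carrier (?S p)) (\<delta>' (Suc p) + \<alpha> p)" for p
    by (rule has_rank_exact[OF cg cg hi]) (simp_all add: ki \<delta>[simplified] \<alpha> \<delta>'_def)
  have rX: "has_rank (?X p) (carrier (?X p)) (\<alpha> p + \<beta> p)" for p
    by (rule has_rank_exact[OF cg cg hj]) (simp_all add: kj \<beta> \<alpha>)
  have rR: "has_rank (?R p) (carrier (?R p)) (\<beta> p + \<delta>' p)" for p
  proof (cases p)
    case 0
    then show ?thesis using \<beta>(1)[of 0] kd0 by (simp add: \<delta>'_def)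
  next
    case (Suc q)
    have "has_rank (?R (Suc q)) (carrier (?R (Suc q))) (\<beta> (Suc q) + \<delta> q)"
      by (rule has_rank_exact[OF cg cg hd]) (simp_all only: kd \<beta> \<delta>)
    then show ?thesis using Suc by (simp add: \<delta>'_def)
  qed
  \<comment> \<open>\<open>Suc d3\<close>, because \<open>\<delta>'\<close> is \<delta> shifted by
    one degree.\<close>
  define D where "D = max (max d1 d2) (Suc d3)"
  have D: "\<alpha> p = 0" "\<beta> p = 0" "\<delta>' p = 0" "\<delta>' (Suc p) = 0" if "p \<ge> D" for p
    using that \<alpha>(2) \<beta>(2) \<delta>(2) by (auto simp: D_def \<delta>'_def split: nat.splits)
  let ?a = "\<Sum>p<D. (- 1) ^ p * int (\<delta>' (Suc p) + \<alpha> p)"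
  let ?b = "\<Sum>p<D. (- 1) ^ p * int (\<beta> p + \<delta>' p)"
  let ?c = "\<Sum>p<D. (- 1) ^ p * int (\<alpha> p + \<beta> p)"
  have "?a + ?b = ?c + (\<Sum>p<D. (- 1) ^ p * (int (\<delta>' (Suc p)) + int (\<delta>' p)))"
    by (simp add: sum.distrib[symmetric] algebra_simps)
  also have "\<dots> = ?c"
    unfolding alternating_sum_telescope using D[of D] by (simp add: \<delta>'_def)
  finally have c: "?c = ?a + ?b" by simp
  have eS: "has_euler (subtopology X S) {} ?a"
    unfolding has_euler_def using rS D by (intro exI[of _ "\<lambda>p. \<delta>' (Suc p) + \<alpha> p"] exI[of _ D]) auto
  have eR: "has_euler X S ?b"
    unfolding has_euler_def using rR D by (intro exI[of _ "\<lambda>p. \<beta> p + \<delta>' p"] exI[of _ D]) auto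
  have eX: "has_euler X {} ?c"
    unfolding has_euler_def using rX D by (intro exI[of _ "\<lambda>p. \<alpha> p + \<beta> p"] exI[of _ D]) auto
  show ?thesis
    by (rule that[OF eS eR eX[unfolded c]])
qed

lemma has_euler_pair_total:
  assumes "has_euler (subtopology X S) {} a" "has_euler X S b"
  shows "has_euler X {} (a + b)"
proof -
  have "ev_bounded_homology (subtopology X S) {}" "ev_bounded_homology X S"
    using assms by (auto intro: has_euler_imp_ev_bounded)
  then obtain a' b' where "has_euler (subtopology X S) {} a'" "has_euler X S b'" "has_euler X {} (a' + b')"
    using euler_long_exact_sequence[of X S] by blast
  moreover have "a' = a" "b' = b" using assms calculation has_euler_unique by blast+
  ultimately show ?thesis by simp
qed

lemma has_euler_pair_relative:
  assumes "has_euler X {} c" "has_euler (subtopology X S) {} a"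
  shows "has_euler X S (c - a)"
proof -
  have "ev_bounded_homology (subtopology X S) {}" "ev_bounded_homology X {}"
    using assms by (auto intro: has_euler_imp_ev_bounded)
  then obtain a' b' where "has_euler (subtopology X S) {} a'" "has_euler X S b'" "has_euler X {} (a' + b')"
    using euler_long_exact_sequence[of X S] by blast
  moreover have "a' = a" "a' + b' = c" using assms calculation has_euler_unique by blast+
  ultimately show ?thesis by auto
qed

lemma has_euler_pair_subspace:
  assumes "has_euler X {} c" "has_euler X S b"
  shows "has_euler (subtopology X S) {} (c - b)"
proof -
  have "ev_bounded_homology X {}" "ev_bounded_homology X S"
    using assms by (auto intro: has_euler_imp_ev_bounded)
  then obtain a' b' where "has_euler (subtopology X S) {} a'" "has_euler X S b'" "has_euler X {} (a' + b')"
    using euler_long_exact_sequence[of X S] by blast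
  moreover have "b' = b" "a' + b' = c" using assms calculation has_euler_unique by blast+
  ultimately show ?thesis by auto
qed

section \<open>Homotopy invariance, points and contractible spaces\<close>

lemma has_euler_homotopy_equivalent:
  assumes "has_euler X {} c" "X homotopy_equivalent_space Y"
  shows "has_euler Y {} c"
  using assms has_euler_iso homotopy_equivalent_space_imp_isomorphic_homology_groups by blast

lemma has_euler_homeomorphic:
  assumes "has_euler X {} c" "X homeomorphic_space Y"
  shows "has_euler Y {} c"
  using assms has_euler_iso homeomorphic_space_imp_isomorphic_homology_groups by blast

lemma has_euler_homeomorphic_map_pair:
  assumes "has_euler X S c" "homeomorphic_map X Y f" "S \<subseteq> topspace X" "f ` S = T"
  shows "has_euler Y T c"
  using has_euler_iso[OF assms(1)] is_isoI homeomorphic_map_relative_homology_iso[OF assms(2-4)] by blast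

lemma has_euler_empty:
  assumes "topspace X = {}"
  shows "has_euler X {} 0"
  unfolding has_euler_def
proof (intro exI[of _ "\<lambda>_. 0"] exI[of _ 0] conjI allI)
  fix p
  have "rank_le (homology_group (int p) X) (carrier (homology_group (int p) X)) 0"
    using trivial_homology_group_empty[OF assms] by (intro rank_le_trivial_group) auto
  then show "has_rank (homology_group (int p) X) (carrier (homology_group (int p) X)) 0"
    by (metis le_zero_eq rank_le_imp_has_rank)
qed auto

lemma has_euler_singleton:
  assumes "topspace X = {a}"
  shows "has_euler X {} 1"
  unfolding has_euler_def
proof (intro exI[of _ "\<lambda>p. if p = 0 then 1 else 0"] exI[of _ 1] conjI allI)
  fix p
  show "has_rank (homology_group (int p) X) (carrier (homology_group (int p) X)) (if p = 0 then 1 else 0)"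
  proof (cases "p = 0")
    case True
    have "path_connected_space X"
      using assms contractible_imp_path_connected_space contractible_space_singleton
      by (metis contractible_space_subset_singleton order_refl)
    then have "homology_group 0 X \<cong> integer_group"
      using isomorphic_integer_zeroth_homology_group assms by blast
    then have "integer_group \<cong> homology_group 0 X"
      by (simp add: group.iso_sym)
    then show ?thesis
      using has_rank_iso[OF abelian_integer_group abelian_relative_homology_group _ has_rank_integer_group]
        True by simp
  next
    case False
    have "rank_le (homology_group (int p) X) (carrier (homology_group (int p) X)) 0"
      using homology_dimension_axiom[OF assms, of "int p"] False by (intro rank_le_trivial_group) auto
    then show ?thesis
      using False by simp (metis le_zero_eq rank_le_imp_has_rank)
  qed
qed auto

lemma has_euler_contractible:
  assumes "contractible_space X" "topspace X \<noteq> {}"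
  shows "has_euler X {} 1"
proof -
  obtain a where a: "a \<in> topspace X" "X homotopy_equivalent_space (subtopology X {a})"
    using assms contractible_eq_homotopy_equivalent_singleton_subtopology
    by (metis topspace_discrete_topology)
  have "has_euler (subtopology X {a}) {} 1"
    using a(1) by (intro has_euler_singleton[of _ a]) auto
  then show ?thesis
    using a(2) has_euler_homotopy_equivalent homotopy_equivalent_space_sym by blast
qed

section \<open>Excision and additivity over open sets\<close>

lemma has_euler_excision:
  assumes "has_euler (subtopology X V) (V \<inter> W) c"
    and "X closure_of (topspace X - V) \<subseteq> X interior_of W" "W \<subseteq> topspace X"
  shows "has_euler X W c"
proof -
  have 1: "subtopology X (topspace X - (topspace X - V)) = subtopology X V"
    by (metis Diff_Diff_Int subtopology_restrict)
  have 2: "W - (topspace X - V) = V \<inter> W" using assms(3) by auto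
  show ?thesis
    using has_euler_iso[OF assms(1)] homology_excision_axiom[OF assms(2,3)]
    unfolding 1 2 subtopology_topspace by (meson is_isoI)
qed

lemma has_euler_excision_open:
  assumes "has_euler (subtopology X V) (V \<inter> W) c" "openin X V" "openin X W" "V \<union> W = topspace X"
  shows "has_euler X W c"
proof (rule has_euler_excision[OF assms(1)])
  have "X closure_of (topspace X - V) = topspace X - V"
    using assms(2) by (simp add: closure_of_closedin openin_closedin_eq)
  then show "X closure_of (topspace X - V) \<subseteq> X interior_of W"
    using assms by (auto simp: interior_of_openin)
  show "W \<subseteq> topspace X" using assms(4) by auto
qed

text \<open>Excision identifies the pair \<open>(X, W)\<close> with
  \<open>(V, V \<inter> W)\<close>, so inclusion-exclusion follows from the long exact sequences of
  these two pairs.\<close>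

lemma has_euler_open_Un:
  assumes "openin X V" "openin X W" "V \<union> W = topspace X"
    and "has_euler (subtopology X V) {} v" "has_euler (subtopology X W) {} w"
    and "has_euler (subtopology X (V \<inter> W)) {} i"
  shows "has_euler X {} (v + w - i)"
proof -
  have "subtopology (subtopology X V) (V \<inter> W) = subtopology X (V \<inter> W)"
    by (simp add: subtopology_subtopology Int_absorb1 flip: Int_assoc)
  then have "has_euler (subtopology X V) (V \<inter> W) (v - i)"
    using has_euler_pair_relative[OF assms(4), of "V \<inter> W" i] assms(6) by simp
  then have "has_euler X W (v - i)"
    using assms(1-3) has_euler_excision_open by blast
  from has_euler_pair_total[OF assms(5) this] show ?thesis by (simp add: algebra_simps)
qed

lemma has_euler_open_disjoint_Un:
  assumes "openin X V" "openin X W" "V \<union> W = topspace X" "V \<inter> W = {}"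
    and "has_euler (subtopology X V) {} v" "has_euler (subtopology X W) {} w"
  shows "has_euler X {} (v + w)"
  using has_euler_open_Un[OF assms(1-3,5,6), of 0] has_euler_empty[of "subtopology X (V \<inter> W)"] assms(4)
  by simp

lemma has_euler_disjoint_Union:
  assumes "finite \<U>" "pairwise disjnt \<U>" "\<And>U. U \<in> \<U> \<Longrightarrow> openin X U"
    and "\<And>U. U \<in> \<U> \<Longrightarrow> has_euler (subtopology X U) {} c"
  shows "has_euler (subtopology X (\<Union>\<U>)) {} (int (card \<U>) * c)"
  using assms
proof (induction \<U>)
  case empty
  then show ?case by (simp add: has_euler_empty)
next
  case (insert U \<U>)
  let ?Y = "subtopology X (\<Union>(insert U \<U>))"
  have eq: "subtopology ?Y U = subtopology X U" "subtopology ?Y (\<Union>\<U>) = subtopology X (\<Union>\<U>)"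
    by (simp_all add: subtopology_subtopology Int_absorb1)
  have disj: "U \<inter> \<Union>\<U> = {}"
    using insert.prems(1) insert.hyps by (fastforce simp: pairwise_insert disjnt_def)
  have op: "openin X U" "openin X (\<Union>\<U>)"
    using insert.prems by auto
  have "has_euler ?Y {} (c + int (card \<U>) * c)"
  proof (rule has_euler_open_disjoint_Un)
    show "openin ?Y U" "openin ?Y (\<Union>\<U>)"
      using op by (auto simp: openin_subtopology intro: exI[of _ U] exI[of _ "\<Union>\<U>"])
    show "U \<union> \<Union>\<U> = topspace ?Y"
      using op openin_subset by fastforce
    show "has_euler (subtopology ?Y U) {} c"
      unfolding eq using insert.prems by auto
    show "has_euler (subtopology ?Y (\<Union>\<U>)) {} (int (card \<U>) * c)"
      unfolding eq using insert.prems by (intro insert.IH) (auto simp: pairwise_insert)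
  qed (fact disj)
  then show ?case using insert.hyps by (simp add: algebra_simps)
qed

text \<open>Splitting off one member \<open>C\<close> leaves the union of the others and its
  intersection with \<open>C\<close>, which is the union of the convex sets
  \<open>C \<inter> D\<close>; both families have fewer members.\<close>

lemma has_euler_finite_Union_open_convex:
  fixes \<F> :: "'a::real_normed_vector set set"
  assumes "finite \<F>" "\<And>C. C \<in> \<F> \<Longrightarrow> open C \<and> convex C"
  obtains c where "has_euler (top_of_set (\<Union>\<F>)) {} c"
proof -
  \<comment> \<open>Induction on a bound \<open>n\<close> of the cardinality, over all families at
    once: intersecting with \<open>C\<close> changes the members and may merge some.\<close>
  have "\<exists>c. has_euler (top_of_set (\<Union>\<F>)) {} c"
    if "finite \<F>" "card \<F> \<le> n" "\<forall>C\<in>\<F>. open C \<and> convex C" for n and \<F> :: "'a set set"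
    using that
  proof (induction n arbitrary: \<F>)
    case 0
    then have "\<F> = {}" by simp
    then show ?case using has_euler_empty[of "top_of_set {}"] by auto
  next
    case (Suc n)
    show ?case
    proof (cases "\<F> = {}")
      case True
      then show ?thesis using has_euler_empty[of "top_of_set {}"] by auto
    next
      case False
      then obtain C where C: "C \<in> \<F>" by auto
      define \<G> where "\<G> = \<F> - {C}"
      have \<G>: "finite \<G>" "card \<G> \<le> n" "\<forall>D\<in>\<G>. open D \<and> convex D"
        using Suc.prems C by (auto simp: \<G>_def)
      have U: "\<Union>\<F> = C \<union> \<Union>\<G>" using C by (auto simp: \<G>_def)
      have CC: "open C" "convex C" using Suc.prems C by auto
      obtain b where b: "has_euler (top_of_set (\<Union>\<G>)) {} b"
        using Suc.IH[OF \<G>] by blast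
      have "\<exists>i. has_euler (top_of_set (\<Union>((\<inter>) C ` \<G>))) {} i"
        using \<G> CC by (intro Suc.IH) (auto intro: order_trans[OF card_image_le] convex_Int)
      then obtain i where i: "has_euler (top_of_set (C \<inter> \<Union>\<G>)) {} i"
        by (metis Int_Union)
      obtain a where a: "has_euler (top_of_set C) {} a"
        using has_euler_contractible[of "top_of_set C"] has_euler_empty[of "top_of_set C"]
          convex_imp_contractible[OF CC(2)] by force
      have "has_euler (top_of_set (C \<union> \<Union>\<G>)) {} (a + b - i)"
      proof (rule has_euler_open_Un[where V = C and W = "\<Union>\<G>"])
        show "openin (top_of_set (C \<union> \<Union>\<G>)) C" "openin (top_of_set (C \<union> \<Union>\<G>)) (\<Union>\<G>)"
          using CC \<G> by (auto intro!: open_subset)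
      qed (use a b i in \<open>auto simp: subtopology_subtopology Int_absorb1 Int_absorb2 le_infI1\<close>)
      then show ?thesis unfolding U by blast
    qed
  qed
  then show ?thesis using assms that by blast
qed


section \<open>Attaching cells\<close>

lemma deformation_retract_homotopy_equivalent:
  assumes H: "continuous_map (prod_topology (top_of_set {0..1::real}) X) X H"
    and H0: "\<And>x. x \<in> topspace X \<Longrightarrow> H (0, x) = x"
    and H1: "\<And>x. x \<in> topspace X \<Longrightarrow> H (1, x) \<in> A"
    and HA: "\<And>x. x \<in> A \<Longrightarrow> x \<in> topspace X \<Longrightarrow> H (1, x) = x"
  shows "X homotopy_equivalent_space (subtopology X A)"
proof -
  define r where "r = (\<lambda>x. H (1, x))"
  have "homotopic_with (\<lambda>x. True) X X id r"
    unfolding homotopic_with[of X "\<lambda>x. True", simplified]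
    using H H0 by (intro exI[of _ H]) (auto simp: r_def)
  then have 1: "homotopic_with (\<lambda>x. True) X X r id"
    by (rule homotopic_with_symD)
  then have "continuous_map X X r"
    using homotopic_with_imp_continuous_maps by blast
  then have "retraction_maps X (subtopology X A) r id"
    unfolding retraction_maps_def
    using H1 HA by (auto simp: continuous_map_in_subtopology continuous_map_from_subtopology r_def)
  with 1 show ?thesis
    by (rule deformation_retract_imp_homotopy_equivalent_space)
qed

text \<open>The unit interval is locally compact and Hausdorff, so its product with a quotient map
  is again a quotient map, and homotopies descend along it.\<close>

lemma homotopy_from_quotient:
  assumes q: "quotient_map Y X q"
    and K: "continuous_map (prod_topology (top_of_set {0..1::real}) Y) Z K"
    and eq: "\<And>t y y'. t \<in> {0..1} \<Longrightarrow> y \<in> topspace Y \<Longrightarrow> y' \<in> topspace Y \<Longrightarrow> q y = q y' \<Longrightarrow> K (t, y) = K (t, y')"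
  obtains G where "continuous_map (prod_topology (top_of_set {0..1}) X) Z G"
    "\<And>t y. t \<in> {0..1} \<Longrightarrow> y \<in> topspace Y \<Longrightarrow> G (t, q y) = K (t, y)"
proof -
  have "compact_space (top_of_set {0..1::real})"
    by (simp add: compact_space_subtopology)
  then have lc: "locally_compact_space (top_of_set {0..1::real})"
    by (rule compact_imp_locally_compact_space)
  have "Hausdorff_space (top_of_set {0..1::real})"
    by (simp add: Hausdorff_space_subtopology)
  then have "quotient_map (prod_topology (top_of_set {0..1::real}) Y)
      (prod_topology (top_of_set {0..1::real}) X) (\<lambda>(t, y). (t, q y))"
    using q lc by (intro quotient_map_prod_right) auto
  then obtain G where "continuous_map (prod_topology (top_of_set {0..1}) X) Z G"
    "\<And>z. z \<in> topspace (prod_topology (top_of_set {0..1::real}) Y) \<Longrightarrow> G ((\<lambda>(t, y). (t, q y)) z) = K z"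
  proof (rule quotient_map_lift_exists[OF _ K])
    fix z z' assume "z \<in> topspace (prod_topology (top_of_set {0..1::real}) Y)"
      "z' \<in> topspace (prod_topology (top_of_set {0..1::real}) Y)"
      "(\<lambda>(t, y). (t, q y)) z = (\<lambda>(t, y). (t, q y)) z'"
    then show "K z = K z'"
      by (cases z; cases z') (auto intro: eq)
  qed blast
  then show ?thesis
    by (intro that[of G]) auto
qed

text \<open>Removing the center \<open>x0\<close> of the cell leaves \<open>W\<close>, which
  retracts radially onto \<open>A\<close>; excising \<open>A\<close> identifies
  \<open>(X, W)\<close> with the ball relative to the punctured ball. The number \<open>e\<close>
  stays abstract so that edges (\<open>e = -1\<close>) and discs (\<open>e = 1\<close>) are treated
  alike. \<Phi> may identify points of the sphere, as it does for a loop.\<close>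

lemma has_euler_attach_cell:
  fixes \<Phi> :: "'n::euclidean_space \<Rightarrow> 'a" and X :: "'a topology"
  assumes A: "closedin X A"
    and cont: "continuous_map (top_of_set (cball 0 1)) X \<Phi>"
    and clos: "closed_map (top_of_set (cball 0 1)) X \<Phi>"
    and sph: "\<And>z. norm z = 1 \<Longrightarrow> \<Phi> z \<in> A" and inj: "inj_on \<Phi> (ball 0 1)"
    and disj: "\<And>z. norm z < 1 \<Longrightarrow> \<Phi> z \<notin> A" and top: "topspace X = A \<union> \<Phi> ` ball 0 1"
    and a: "has_euler (subtopology X A) {} a"
    and e: "has_euler (top_of_set (ball (0::'n) 1)) (ball 0 1 - {0}) e"
  shows "has_euler X {} (a + e)"
proof -
  define x0 where "x0 = \<Phi> 0"
  define B where "B = \<Phi> ` ball 0 1"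
  define W where "W = topspace X - {x0}"
  define E where "E = \<Phi> ` (cball 0 1 - {0})"
  have 0: "\<Phi> z = x0 \<longleftrightarrow> z = 0" if "norm z \<le> 1" for z
    using that inj sph[of z] disj[of 0] by (cases "norm z = 1") (auto simp: x0_def inj_on_def)
  have cl_image: "closedin X (\<Phi> ` T)" if "closed T" "T \<subseteq> cball 0 1" for T
    using clos that unfolding closed_map_def by (auto simp: closed_subset)
  have BX: "B = topspace X - A" using top disj by (auto simp: B_def)
  have "closedin X {x0}" using cl_image[of "{0}"] by (simp add: x0_def)
  then have Wop: "openin X W" by (simp add: W_def openin_diff)
  have Bop: "openin X B" using A by (simp add: BX openin_diff)
  have x0B: "x0 \<in> B" by (simp add: x0_def B_def)
  have AW: "A \<subseteq> W" using x0B BX closedin_subset[OF A] by (auto simp: W_def)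
  have "homeomorphic_map (top_of_set (ball 0 1)) (subtopology X B) \<Phi>"
  proof (rule bijective_open_imp_homeomorphic_map)
    show "continuous_map (top_of_set (ball 0 1)) (subtopology X B) \<Phi>"
      using continuous_map_from_subtopology_mono[OF cont ball_subset_cball]
      by (auto simp: continuous_map_in_subtopology B_def)
    show "\<Phi> ` topspace (top_of_set (ball 0 1)) = topspace (subtopology X B)"
      using BX by (auto simp: B_def)
    show "inj_on \<Phi> (topspace (top_of_set (ball 0 1)))" using inj by simp
    show "open_map (top_of_set (ball 0 1)) (subtopology X B) \<Phi>"
      unfolding open_map_def
    proof (intro allI impI)
      fix O' :: "'n set" assume "openin (top_of_set (ball 0 1)) O'"
      then have op: "open O'" "O' \<subseteq> ball 0 1"
        by (auto simp: openin_open_eq)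
      have "closedin X (A \<union> \<Phi> ` (cball 0 1 - O'))"
        using op A by (intro closedin_Un cl_image) (auto intro: closed_Diff)
      \<comment> \<open>An open part of the cell is open in \<open>X\<close> because its complement
        is \<open>A\<close> together with the closed image of the rest of the closed ball.\<close>
      moreover have "\<Phi> ` O' = topspace X - (A \<union> \<Phi> ` (cball 0 1 - O'))"
      proof
        show "\<Phi> ` O' \<subseteq> topspace X - (A \<union> \<Phi> ` (cball 0 1 - O'))"
        proof clarify
          fix z assume z: "z \<in> O'"
          then have nz: "norm z < 1" using op by auto
          have "\<Phi> z \<notin> \<Phi> ` (cball 0 1 - O')"
          proof
            assume "\<Phi> z \<in> \<Phi> ` (cball 0 1 - O')"
            then obtain w where w: "w \<in> cball 0 1" "w \<notin> O'" "\<Phi> z = \<Phi> w" by auto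
            then have "norm w < 1" using sph[of w] disj[OF nz] by (cases "norm w = 1") auto
            then have "z = w" using inj_onD[OF inj w(3)] nz by simp
            then show False using w z by simp
          qed
          then show "\<Phi> z \<in> topspace X - (A \<union> \<Phi> ` (cball 0 1 - O'))"
            using disj[OF nz] nz top by auto
        qed
        show "topspace X - (A \<union> \<Phi> ` (cball 0 1 - O')) \<subseteq> \<Phi> ` O'"
          using top by fastforce
      qed
      ultimately have "openin X (\<Phi> ` O')" by (simp add: openin_diff)
      moreover have "\<Phi> ` O' \<subseteq> B" using op by (auto simp: B_def)
      ultimately show "openin (subtopology X B) (\<Phi> ` O')"
        by (simp add: openin_open_subtopology[OF Bop])
    qed
  qed
  moreover have "\<Phi> ` (ball 0 1 - {0}) = B \<inter> W"
  proof -
    have "B \<inter> W = B - {x0}" using BX by (auto simp: W_def)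
    also have "\<dots> = \<Phi> ` (ball 0 1 - {0})"
      unfolding B_def using 0 by (auto simp: x0_def less_imp_le)
    finally show ?thesis by simp
  qed
  ultimately have "has_euler (subtopology X B) (B \<inter> W) e"
    using e by (intro has_euler_homeomorphic_map_pair[of "top_of_set (ball 0 1)" "ball 0 1 - {0}" e _ \<Phi>]) auto
  moreover have "B \<union> W = topspace X"
    using x0B BX by (auto simp: W_def)
  ultimately have eW: "has_euler X W e"
    using Bop Wop has_euler_excision_open by blast

  have EW: "E \<subseteq> W" "E = \<Phi> ` cball 0 1 - {x0}"
  proof -
    show "E = \<Phi> ` cball 0 1 - {x0}" unfolding E_def using 0 by (auto simp: x0_def)
    moreover have "\<Phi> ` cball 0 1 \<subseteq> topspace X"
      using cont by (auto simp: continuous_map_def)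
    ultimately show "E \<subseteq> W" by (auto simp: W_def)
  qed
  have "quotient_map (top_of_set (cball 0 1)) (subtopology X (\<Phi> ` cball 0 1)) \<Phi>"
  proof (rule continuous_closed_imp_quotient_map)
    show "continuous_map (top_of_set (cball 0 1)) (subtopology X (\<Phi> ` cball 0 1)) \<Phi>"
      using cont by (auto simp: continuous_map_in_subtopology)
    show "closed_map (top_of_set (cball 0 1)) (subtopology X (\<Phi> ` cball 0 1)) \<Phi>"
      using clos by (intro closed_map_into_subtopology) auto
    show "\<Phi> ` topspace (top_of_set (cball 0 1)) = topspace (subtopology X (\<Phi> ` cball 0 1))"
      using cont by (auto simp: continuous_map_def)
  qed
  \<comment> \<open>\<open>E\<close> is the trace of the open set \<open>W\<close> on the image of
    the closed ball, and a quotient map restricts to the preimage of an open set.\<close>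
  then have "quotient_map (subtopology (top_of_set (cball 0 1)) (cball 0 1 - {0}))
      (subtopology (subtopology X (\<Phi> ` cball 0 1)) E) \<Phi>"
  proof (rule quotient_map_restriction)
    show "{x \<in> topspace (top_of_set (cball 0 1)). \<Phi> x \<in> E} = cball 0 1 - {0}"
      unfolding EW(2) using 0 by (auto simp: x0_def)
    have "E = \<Phi> ` cball 0 1 \<inter> W"
      using EW by (auto simp: W_def)
    then show "openin (subtopology X (\<Phi> ` cball 0 1)) E \<or> closedin (subtopology X (\<Phi> ` cball 0 1)) E"
      using Wop openin_subtopology_Int2 by blast
  qed
  moreover have "\<Phi> ` cball 0 1 \<inter> E = E" using EW by auto
  moreover have "cball 0 1 \<inter> (cball 0 1 - {0}) = cball 0 1 - {0::'n}" by auto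
  ultimately have q: "quotient_map (top_of_set (cball 0 1 - {0})) (subtopology X E) \<Phi>"
    by (simp add: subtopology_subtopology)
  \<comment> \<open>Directions are kept; for \<open>t\<close> in the unit interval and nonzero
    \<open>z\<close> the norm becomes \<open>(1 - t) * norm z + t\<close>, so the sphere stays fixed
    and is reached at time 1.\<close>
  define push where "push = (\<lambda>(t::real, z::'n). (1 - t) *\<^sub>R z + t *\<^sub>R sgn z)"
  have push_eq: "push (t, z) = ((1 - t) + t / norm z) *\<^sub>R z" for t z
    by (simp add: push_def sgn_div_norm algebra_simps divide_inverse)
  have push_norm: "norm (push (t, z)) = (1 - t) * norm z + t" if "t \<in> {0..1}" "z \<noteq> 0" for t z
  proof -
    have "(1 - t) + t / norm z \<ge> 0" using that by (intro add_nonneg_nonneg) auto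
    then have "norm (push (t, z)) = ((1 - t) + t / norm z) * norm z"
      by (simp only: push_eq norm_scaleR abs_of_nonneg)
    also have "\<dots> = (1 - t) * norm z + t" using that by (simp add: distrib_right)
    finally show ?thesis .
  qed
  have push_range: "push (t, z) \<in> cball 0 1 - {0}" if "t \<in> {0..1}" "z \<in> cball 0 1 - {0}" for t z
  proof -
    have "norm (push (t, z)) \<le> 1"
      using that push_norm[of t z] mult_left_le[of "norm z" "1 - t"] by auto
    moreover have "norm (push (t, z)) > 0"
    proof (cases "t = 0")
      case False
      then show ?thesis using that push_norm[of t z] by (auto intro!: add_nonneg_pos)
    qed (use that push_norm[of t z] in auto)
    ultimately show ?thesis by auto
  qed
  have contK: "continuous_map (prod_topology (top_of_set {0..1::real}) (top_of_set (cball 0 1 - {0}))) X (\<Phi> \<circ> push)"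
  proof (rule continuous_map_compose[OF _ cont])
    have "continuous_on ({0..1} \<times> (cball 0 1 - {0})) push"
      unfolding push_def case_prod_unfold by (intro continuous_intros) auto
    then show "continuous_map (prod_topology (top_of_set {0..1}) (top_of_set (cball 0 1 - {0}))) (top_of_set (cball 0 1)) push"
      using push_range by (auto simp: continuous_map_in_subtopology Pi_iff)
  qed
  have sph_push: "push (t, z) = z" if "norm z = 1" for t z
    using that by (simp add: push_eq)
  obtain G where G: "continuous_map (prod_topology (top_of_set {0..1}) (subtopology X E)) X G"
    "\<And>t z. t \<in> {0..1} \<Longrightarrow> z \<in> cball 0 1 - {0} \<Longrightarrow> G (t, \<Phi> z) = \<Phi> (push (t, z))"
  proof (rule homotopy_from_quotient[OF q contK])
    fix t y y' assume *: "t \<in> {0..1::real}" "y \<in> topspace (top_of_set (cball 0 1 - {0}))"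
      "y' \<in> topspace (top_of_set (cball 0 1 - {0}))" "\<Phi> y = \<Phi> y'"
    \<comment> \<open>Two different points can be identified only on the sphere, where
      \<open>push\<close> is the identity at all times.\<close>
    have "y = y' \<or> norm y = 1 \<and> norm y' = 1"
    proof (cases "norm y = 1 \<or> norm y' = 1")
      case True
      then have "\<Phi> y \<in> A" "\<Phi> y' \<in> A" using sph *(4) by metis+
      then have "\<not> norm y < 1" "\<not> norm y' < 1" using disj by blast+
      then show ?thesis using *(2,3) by auto
    next
      case False
      then show ?thesis using *(2,3,4) inj by (auto simp: inj_on_def)
    qed
    then show "(\<Phi> \<circ> push) (t, y) = (\<Phi> \<circ> push) (t, y')"
      using sph_push *(4) by auto
  qed auto
  have GA: "G (t, x) = x" if x: "x \<in> A" "x \<in> E" and t: "t \<in> {0..1}" for t x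
  proof -
    obtain z where z: "z \<in> cball 0 1 - {0}" "x = \<Phi> z" using x(2) unfolding E_def by blast
    then have "norm z = 1" using x disj[of z] by fastforce
    then show ?thesis using G(2)[OF t z(1)] z sph_push by simp
  qed
  \<comment> \<open>The descended homotopy lives on \<open>E\<close>; the identity on
    \<open>A\<close> extends it to \<open>W\<close>. Both pieces are closed in \<open>W\<close>, and
    they agree on the overlap by \<open>GA\<close>.\<close>
  define H where "H = (\<lambda>(t::real, x). if x \<in> A then x else G (t, x))"
  have WAE: "W = A \<union> E"
    using AW EW top by (auto simp: W_def)
  have HW: "H (t, x) \<in> W" if t: "t \<in> {0..1}" and xW: "x \<in> W" for t x
  proof (cases "x \<in> A")
    case False
    then obtain z where z: "z \<in> cball 0 1 - {0}" "x = \<Phi> z" using xW WAE unfolding E_def by blast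
    then have "H (t, x) \<in> E"
      using False G(2)[OF t z(1)] push_range[OF t z(1)] by (auto simp: H_def E_def)
    then show ?thesis using EW by auto
  qed (use AW in \<open>auto simp: H_def\<close>)
  let ?I = "top_of_set {0..1::real}"
  let ?W = "subtopology X W"
  have tW: "topspace ?W = W" by (auto simp: W_def)
  have "continuous_map (prod_topology ?I ?W) X H"
  proof (rule pasting_lemma_closed[where I = "UNIV :: bool set"
        and T = "\<lambda>b. {0..1} \<times> (if b then A else E)" and f = "\<lambda>b. if b then snd else G"])
    fix b :: bool
    have "closedin ?W A"
      using A AW by (simp add: closedin_subset_topspace)
    moreover have "closedin ?W E"
    proof -
      have "E = \<Phi> ` cball 0 1 \<inter> W" using EW by (auto simp: W_def)
      then show ?thesis
        using cl_image[of "cball 0 1"] closedin_subtopology by fastforce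
    qed
    ultimately show "closedin (prod_topology ?I ?W) ({0..1} \<times> (if b then A else E))"
      by (auto simp: closedin_prod_Times_iff)
    have 1: "subtopology ?W E = subtopology X E" "subtopology ?W A = subtopology X A"
      using EW AW by (simp_all add: subtopology_subtopology Int_absorb1)
    have 2: "subtopology ?I {0..1} = ?I" by (simp add: subtopology_subtopology)
    show "continuous_map (subtopology (prod_topology ?I ?W) ({0..1} \<times> (if b then A else E))) X (if b then snd else G)"
      unfolding subtopology_Times 2 using G(1) continuous_map_snd[of ?I "subtopology X A"]
      by (auto simp: 1 continuous_map_in_subtopology)
  next
    fix i j :: bool and x
    assume "x \<in> topspace (prod_topology ?I ?W) \<inter> ({0..1} \<times> (if i then A else E)) \<inter> ({0..1} \<times> (if j then A else E))"
    then show "(if i then snd else G) x = (if j then snd else G) x"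
      using GA by (cases i; cases j) auto
  next
    fix x assume "x \<in> topspace (prod_topology ?I ?W)"
    then show "\<exists>j. j \<in> UNIV \<and> x \<in> {0..1} \<times> (if j then A else E) \<and> H x = (if j then snd else G) x"
      using WAE by (intro exI[of _ "snd x \<in> A"]) (auto simp: H_def)
  qed auto
  then have "continuous_map (prod_topology ?I ?W) ?W H"
    using HW by (auto simp: continuous_map_in_subtopology)
  then have "?W homotopy_equivalent_space (subtopology ?W A)"
  proof (rule deformation_retract_homotopy_equivalent)
    fix x assume "x \<in> topspace ?W"
    then have x: "x \<in> W" using tW by simp
    show "H (0, x) = x"
    proof (cases "x \<in> A")
      case False
      then obtain z where "z \<in> cball 0 1 - {0}" "x = \<Phi> z" using x WAE unfolding E_def by blast
      then show ?thesis using False G(2)[of 0 z] by (simp add: H_def push_def)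
    qed (simp add: H_def)
    show "H (1, x) \<in> A"
    proof (cases "x \<in> A")
      case False
      then obtain z where z: "z \<in> cball 0 1 - {0}" "x = \<Phi> z" using x WAE unfolding E_def by blast
      then have "norm (push (1, z)) = 1" using push_norm[of 1 z] by auto
      then show ?thesis using False G(2)[of 1 z] z sph by (simp add: H_def)
    qed (simp add: H_def)
    show "H (1, x) = x" if "x \<in> A" using that by (simp add: H_def)
  qed
  moreover have "subtopology ?W A = subtopology X A"
    using AW by (simp add: subtopology_subtopology Int_absorb1)
  ultimately have "has_euler ?W {} a"
    using a has_euler_homotopy_equivalent homotopy_equivalent_space_sym by metis
  from has_euler_pair_total[OF this eW] show ?thesis .
qed

section \<open>Model cells and the circle\<close>

lemma has_euler_convex:
  fixes S :: "'a::real_normed_vector set"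
  assumes "convex S" "S \<noteq> {}"
  shows "has_euler (top_of_set S) {} 1"
  using assms by (intro has_euler_contractible) (auto simp: convex_imp_contractible)

lemma has_euler_open_Un_sets:
  fixes S T :: "'a::topological_space set"
  assumes "open S" "open T" "has_euler (top_of_set S) {} a" "has_euler (top_of_set T) {} b"
    "has_euler (top_of_set (S \<inter> T)) {} i"
  shows "has_euler (top_of_set (S \<union> T)) {} (a + b - i)"
  using assms
  by (intro has_euler_open_Un[where V = S and W = T])
     (auto simp: subtopology_subtopology Int_absorb1 Int_absorb2 le_infI1 intro!: open_subset)

text \<open>An interval minus its midpoint is two intervals, so the pair has value
  \<open>1 - 2\<close>.\<close>

lemma has_euler_real_cell:
  "has_euler (top_of_set (ball (0::real) 1)) (ball 0 1 - {0}) (- 1)"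
proof -
  have "has_euler (top_of_set ({-1<..<0} \<union> {0<..<1::real})) {} (1 + 1 - 0)"
  proof (intro has_euler_open_Un_sets has_euler_convex)
    show "has_euler (top_of_set ({- 1<..<0} \<inter> {0<..<1::real})) {} 0"
      by (intro has_euler_empty) auto
  qed auto
  moreover have "ball 0 1 - {0} = {-1<..<0} \<union> {0<..<1::real}"
    by (auto simp: dist_real_def)
  moreover have "ball (0::real) 1 \<inter> (ball 0 1 - {0}) = ball 0 1 - {0}" by auto
  ultimately have "has_euler (subtopology (top_of_set (ball (0::real) 1)) (ball 0 1 - {0})) {} 2"
    by (simp only: subtopology_subtopology) simp
  moreover have "has_euler (top_of_set (ball (0::real) 1)) {} 1"
    by (intro has_euler_convex) auto
  ultimately show ?thesis
    using has_euler_pair_relative by fastforce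
qed

text \<open>Slit \<open>S\<close> along the nonnegative and along the nonpositive real axis. The
  slit sets \<open>U\<close> and \<open>V\<close> are starlike about \<open>- r\<close> and
  \<open>r\<close>, and they meet in the two convex halves above and below the axis:
  \<open>1 + 1 - 2 = 0\<close>.\<close>

lemma has_euler_punctured_plane:
  fixes S :: "complex set"
  assumes "open S" "convex S" "0 \<in> S"
  shows "has_euler (top_of_set (S - {0})) {} 0"
proof -
  obtain r where r: "r > 0" "cball 0 r \<subseteq> S"
    using assms open_contains_cball by blast
  then have rS: "complex_of_real r \<in> S" "- complex_of_real r \<in> S" "\<i> * complex_of_real r \<in> S" "- \<i> * complex_of_real r \<in> S"
    by (auto simp: subset_iff norm_mult)
  define U V where "U = S - {z. Im z = 0 \<and> Re z \<ge> 0}" and "V = S - {z. Im z = 0 \<and> Re z \<le> 0}"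
  have op: "open U" "open V"
    unfolding U_def V_def
    by (intro open_Diff assms closed_Collect_conj closed_Collect_eq closed_Collect_le continuous_intros)+
  have "closed_segment (- complex_of_real r) z \<subseteq> U" if "z \<in> U" for z
  proof
    fix w assume w: "w \<in> closed_segment (- complex_of_real r) z"
    have "w \<in> S" using w that rS(2) assms(2) convex_contains_segment unfolding U_def by blast
    moreover obtain u where u: "0 \<le> u" "u \<le> 1" "w = (1 - u) *\<^sub>R (- complex_of_real r) + u *\<^sub>R z"
      using w by (auto simp: closed_segment_def)
    have "\<not> (Im w = 0 \<and> Re w \<ge> 0)"
    proof
      assume *: "Im w = 0 \<and> Re w \<ge> 0"
      \<comment> \<open>Since \<open>Im w = u * Im z\<close>, either \<open>w\<close> is the center
        \<open>- r\<close> itself or \<open>z\<close> is real and hence negative; in both cases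
        \<open>Re w\<close> would be negative.\<close>
      then have 1: "u = 0 \<or> Im z = 0" "u * Re z \<ge> (1 - u) * r" using u by (auto simp: algebra_simps)
      then have "u \<noteq> 0" using r by auto
      with 1 that have "Re z < 0" "u > 0" using u by (auto simp: U_def)
      then have "u * Re z < 0" by (simp add: mult_pos_neg)
      moreover have "(1 - u) * r \<ge> 0" using u r by simp
      ultimately show False using 1 by simp
    qed
    ultimately show "w \<in> U" by (auto simp: U_def)
  qed
  moreover have "- complex_of_real r \<in> U" using rS r by (auto simp: U_def)
  ultimately have "starlike U" unfolding starlike_def by blast
  then have eU: "has_euler (top_of_set U) {} 1"
    using \<open>- complex_of_real r \<in> U\<close> by (intro has_euler_contractible) (auto simp: starlike_imp_contractible)
  have "closed_segment (complex_of_real r) z \<subseteq> V" if "z \<in> V" for z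
  proof
    fix w assume w: "w \<in> closed_segment (complex_of_real r) z"
    have "w \<in> S" using w that rS(1) assms(2) convex_contains_segment unfolding V_def by blast
    moreover obtain u where u: "0 \<le> u" "u \<le> 1" "w = (1 - u) *\<^sub>R (complex_of_real r) + u *\<^sub>R z"
      using w by (auto simp: closed_segment_def)
    have "\<not> (Im w = 0 \<and> Re w \<le> 0)"
    proof
      assume *: "Im w = 0 \<and> Re w \<le> 0"
      then have 1: "u = 0 \<or> Im z = 0" "u * Re z + (1 - u) * r \<le> 0" using u by (auto simp: algebra_simps)
      then have "u \<noteq> 0" using r by auto
      with 1 that have "Re z > 0" "u > 0" using u by (auto simp: V_def)
      then have "u * Re z > 0" by simp
      moreover have "(1 - u) * r \<ge> 0" using u r by simp
      ultimately show False using 1 by simp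
    qed
    ultimately show "w \<in> V" by (auto simp: V_def)
  qed
  moreover have "complex_of_real r \<in> V" using rS r by (auto simp: V_def)
  ultimately have "starlike V" unfolding starlike_def by blast
  then have eV: "has_euler (top_of_set V) {} 1"
    using \<open>complex_of_real r \<in> V\<close> by (intro has_euler_contractible) (auto simp: starlike_imp_contractible)
  let ?P = "S \<inter> {z. Im z > 0}" and ?Q = "S \<inter> {z. Im z < 0}"
  have "has_euler (top_of_set (?P \<union> ?Q)) {} (1 + 1 - 0)"
  proof (intro has_euler_open_Un_sets has_euler_convex)
    show "open ?P" "open ?Q"
      by (intro open_Int assms open_Collect_less continuous_intros)+
    show "convex ?P" "convex ?Q"
      by (intro convex_Int assms convex_halfspace_Im_gt convex_halfspace_Im_lt)+
    show "?P \<noteq> {}" "?Q \<noteq> {}" using rS(3,4) r by (auto simp: set_eq_iff intro: exI[of _ "\<i> * complex_of_real r"] exI[of _ "- \<i> * complex_of_real r"])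
    show "has_euler (top_of_set (?P \<inter> ?Q)) {} 0"
      by (intro has_euler_empty) auto
  qed
  moreover have "U \<inter> V = ?P \<union> ?Q" by (auto simp: U_def V_def)
  ultimately have "has_euler (top_of_set (U \<inter> V)) {} 2" by simp
  then have "has_euler (top_of_set (U \<union> V)) {} 0"
    using has_euler_open_Un_sets[OF op eU eV] by fastforce
  moreover have "U \<union> V = S - {0}" by (auto simp: U_def V_def complex_eq_iff)
  ultimately show ?thesis by simp
qed

lemma has_euler_complex_cell:
  "has_euler (top_of_set (ball (0::complex) 1)) (ball 0 1 - {0}) 1"
proof -
  have "has_euler (subtopology (top_of_set (ball (0::complex) 1)) (ball 0 1 - {0})) {} 0"
    using has_euler_punctured_plane[of "ball 0 1"] by (simp add: subtopology_subtopology Int_absorb1)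
  moreover have "has_euler (top_of_set (ball (0::complex) 1)) {} 1"
    by (intro has_euler_convex) auto
  ultimately show ?thesis
    using has_euler_pair_relative by fastforce
qed

lemma has_euler_circle: "has_euler (top_of_set (sphere (0::complex) 1)) {} 0"
proof -
  have "rel_frontier (cball (0::complex) 1) homotopy_eqv (UNIV - {0::complex})"
    by (intro homotopy_eqv_rel_frontier_punctured_convex) (auto simp: affine_hull_nonempty_interior rel_interior_nonempty_interior)
  then have "top_of_set (UNIV - {0::complex}) homotopy_equivalent_space top_of_set (sphere (0::complex) 1)"
    by (subst homotopy_equivalent_space_sym) (simp add: rel_frontier_nonempty_interior)
  moreover have "has_euler (top_of_set (UNIV - {0::complex})) {} 0"
    by (intro has_euler_punctured_plane) auto
  ultimately show ?thesis using has_euler_homotopy_equivalent by blast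
qed


section \<open>Finiteness of the homology of closed surfaces\<close>

abbreviation inclusion_hom ::
  "int \<Rightarrow> 'a topology \<Rightarrow> 'a set \<Rightarrow> 'a set \<Rightarrow> 'a set \<Rightarrow> 'a set \<Rightarrow> 'a chain set \<Rightarrow> 'a chain set" where
  "inclusion_hom p X P S Q T \<equiv> hom_induced p (subtopology X P) S (subtopology X Q) T id"

lemma inclusion_hom_compose:
  assumes "P \<subseteq> Q" "Q \<subseteq> R" "S \<subseteq> T" "T \<subseteq> U"
  shows "inclusion_hom p X Q T R U (inclusion_hom p X P S Q T x) = inclusion_hom p X P S R U x"
proof -
  have "inclusion_hom p X Q T R U (inclusion_hom p X P S Q T x) =
        hom_induced p (subtopology X P) S (subtopology X R) U (id \<circ> id) x"
    using assms
    by (intro hom_induced_compose')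
       (auto simp: continuous_map_in_subtopology continuous_map_from_subtopology Pi_iff)
  then show ?thesis by simp
qed

text \<open>Only the image in the homology of \<open>V\<close> is to have finite rank; that of
  \<open>U\<close> itself may be infinite.\<close>

definition ev_bounded_inclusion :: "'a topology \<Rightarrow> 'a set \<Rightarrow> 'a set \<Rightarrow> bool" where
  "ev_bounded_inclusion X U V \<longleftrightarrow>
     ev_bounded_rank (\<lambda>p. homology_group (int p) (subtopology X V))
       (\<lambda>p. inclusion_hom (int p) X U {} V {} ` carrier (homology_group (int p) (subtopology X U)))"

lemma ev_bounded_inclusion_subset:
  assumes "ev_bounded_inclusion X U V" "U' \<subseteq> U" "U \<subseteq> V"
  shows "ev_bounded_inclusion X U' V"
  using assms(1) unfolding ev_bounded_inclusion_def
proof (rule ev_bounded_rank_subset)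
  fix p
  show "inclusion_hom (int p) X U' {} V {} ` carrier (homology_group (int p) (subtopology X U'))
    \<subseteq> inclusion_hom (int p) X U {} V {} ` carrier (homology_group (int p) (subtopology X U))"
  proof clarify
    fix x assume "x \<in> carrier (homology_group (int p) (subtopology X U'))"
    have "inclusion_hom (int p) X U' {} V {} x = inclusion_hom (int p) X U {} V {} (inclusion_hom (int p) X U' {} U {} x)"
      using assms inclusion_hom_compose[of U' U V "{}" "{}" "{}"] by simp
    moreover have "inclusion_hom (int p) X U' {} U {} x \<in> carrier (homology_group (int p) (subtopology X U))"
      by (rule hom_induced_carrier)
    ultimately show "inclusion_hom (int p) X U' {} V {} x
      \<in> inclusion_hom (int p) X U {} V {} ` carrier (homology_group (int p) (subtopology X U))" by blast
  qed
qed

lemma has_euler_imp_ev_bounded_inclusion: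
  assumes "has_euler (subtopology X U) {} c"
  shows "ev_bounded_inclusion X U V"
  unfolding ev_bounded_inclusion_def
  using has_euler_imp_ev_bounded[OF assms]
  by (rule ev_bounded_rank_image) (auto simp: hom_induced_hom)

text \<open>The Mayer-Vietoris boundary map with slack: classes come from the cover
  \<open>UA\<close>, \<open>UB\<close>, but their boundary is tested only after enlargement to
  \<open>WA\<close>, \<open>WB\<close>, and the splitting is obtained there. The conclusions are
  shaped for \<open>rank_le_hom\<close>: a small image and a controlled kernel.\<close>

lemma mayer_vietoris_connecting_hom:
  fixes X :: "'a topology"
  assumes UA: "openin X UA" and UB: "openin X UB"
    and UWA: "UA \<subseteq> WA" and UWB: "UB \<subseteq> WB"
  obtains \<theta> where
    "\<theta> \<in> hom (homology_group p (subtopology X (UA \<union> UB))) (homology_group (p - 1) (subtopology X (WA \<inter> WB)))"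
    "\<theta> ` carrier (homology_group p (subtopology X (UA \<union> UB))) \<subseteq>
       inclusion_hom (p - 1) X (UA \<inter> UB) {} (WA \<inter> WB) {} ` carrier (homology_group (p - 1) (subtopology X (UA \<inter> UB)))"
    "\<And>x. x \<in> carrier (homology_group p (subtopology X (UA \<union> UB))) \<Longrightarrow>
       \<theta> x = \<one>\<^bsub>homology_group (p - 1) (subtopology X (WA \<inter> WB))\<^esub> \<Longrightarrow>
       \<exists>z w. z \<in> carrier (homology_group p (subtopology X WA)) \<and> w \<in> carrier (homology_group p (subtopology X WB)) \<and>
         inclusion_hom p X (UA \<union> UB) {} (WA \<union> WB) {} x =
         inclusion_hom p X WA {} (WA \<union> WB) {} z \<otimes>\<^bsub>homology_group p (subtopology X (WA \<union> WB))\<^esub>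
         inclusion_hom p X WB {} (WA \<union> WB) {} w"
proof -
  define U W UAB WAB where "U = UA \<union> UB" and "W = WA \<union> WB" and "UAB = UA \<inter> UB" and "WAB = WA \<inter> WB"
  have UW: "U \<subseteq> W" "UAB \<subseteq> WAB" using UWA UWB by (auto simp: U_def W_def UAB_def WAB_def)
  let ?HU = "homology_group p (subtopology X U)"
  let ?HW = "homology_group p (subtopology X W)"
  let ?RUB = "relative_homology_group p (subtopology X U) UB"
  let ?RUA = "relative_homology_group p (subtopology X UA) UAB"
  let ?RWB = "relative_homology_group p (subtopology X W) WB"
  let ?RWA = "relative_homology_group p (subtopology X WA) WAB"
  let ?HUAB = "homology_group (p - 1) (subtopology X UAB)"
  let ?HWAB = "homology_group (p - 1) (subtopology X WAB)"
  have subs: "subtopology (subtopology X UA) UAB = subtopology X UAB"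
    "subtopology (subtopology X WA) WAB = subtopology X WAB"
    "subtopology (subtopology X W) WB = subtopology X WB"
    "subtopology (subtopology X U) UA = subtopology X UA"
    "subtopology (subtopology X U) U = subtopology X U"
    by (auto simp: subtopology_subtopology UAB_def WAB_def W_def U_def Int_absorb1 simp flip: Int_assoc)
  \<comment> \<open>What is excised is \<open>U - UA\<close>, which is closed in \<open>U\<close>
    and lies in the open set \<open>UB\<close>.\<close>
  have exc: "inclusion_hom p X UA UAB U UB \<in> iso ?RUA ?RUB"
  proof -
    let ?X = "subtopology X U"
    have op: "openin ?X UA" "openin ?X UB"
      using UA UB by (auto simp: U_def openin_subtopology)
    have cl: "?X closure_of (U - UA) = U - UA"
    proof -
      have "U - UA = topspace ?X - UA"
        using UA UB openin_subset by (fastforce simp: U_def)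
      then show ?thesis
        using op(1) by (simp add: closure_of_closedin openin_closedin_eq)
    qed
    have "?X closure_of (U - UA) \<subseteq> ?X interior_of UB"
      unfolding cl interior_of_openin[OF op(2)] by (auto simp: U_def)
    from homology_excision_axiom[OF this, of U p]
    have "hom_induced p (subtopology ?X (U - (U - UA))) (UB - (U - UA)) (subtopology ?X U) UB id
      \<in> iso (relative_homology_group p (subtopology ?X (U - (U - UA))) (UB - (U - UA)))
             (relative_homology_group p (subtopology ?X U) UB)"
      by (auto simp: U_def)
    moreover have "U - (U - UA) = UA" "UB - (U - UA) = UAB" by (auto simp: U_def UAB_def)
    ultimately show ?thesis by (simp only: subs)
  qed
  then obtain e' where e': "group_isomorphisms ?RUA ?RUB (inclusion_hom p X UA UAB U UB) e'"
    using group.iso_iff_group_isomorphisms[OF group_relative_homology_group] by blast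
  define j where "j = inclusion_hom p X U {} U UB"
  define d where "d = hom_boundary p (subtopology X UA) UAB"
  define k where "k = inclusion_hom (p - 1) X UAB {} WAB {}"
  define \<theta> where "\<theta> = k \<circ> (d \<circ> (e' \<circ> j))"
  have hj: "j \<in> hom ?HU ?RUB" by (simp add: j_def hom_induced_hom)
  have he: "e' \<in> hom ?RUB ?RUA" using e' by (simp add: group_isomorphisms_def)
  have hd: "d \<in> hom ?RUA ?HUAB" using hom_boundary_hom[of p "subtopology X UA" UAB] by (simp add: d_def subs)
  have hk: "k \<in> hom ?HUAB ?HWAB" by (simp add: k_def hom_induced_hom)
  have hde: "d \<circ> (e' \<circ> j) \<in> hom ?HU ?HUAB"
    using hj he hd by (meson hom_compose)
  show ?thesis
  proof (rule that[of \<theta>])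
    show "\<theta> \<in> hom (homology_group p (subtopology X (UA \<union> UB))) (homology_group (p - 1) (subtopology X (WA \<inter> WB)))"
      unfolding \<theta>_def using hom_compose[OF hde hk] by (simp add: U_def WAB_def)
    show "\<theta> ` carrier (homology_group p (subtopology X (UA \<union> UB))) \<subseteq>
       inclusion_hom (p - 1) X (UA \<inter> UB) {} (WA \<inter> WB) {} ` carrier (homology_group (p - 1) (subtopology X (UA \<inter> UB)))"
      using hom_in_carrier[OF hde] by (auto simp: \<theta>_def k_def U_def UAB_def WAB_def)
    fix x assume x: "x \<in> carrier (homology_group p (subtopology X (UA \<union> UB)))"
      and \<theta>x: "\<theta> x = \<one>\<^bsub>homology_group (p - 1) (subtopology X (WA \<inter> WB))\<^esub>"
    have xU: "x \<in> carrier ?HU" using x by (simp add: U_def)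
    define y where "y = e' (j x)"
    have yc: "y \<in> carrier ?RUA"
      unfolding y_def by (intro hom_in_carrier[OF he] hom_in_carrier[OF hj] xU)
    have ey: "inclusion_hom p X UA UAB U UB y = j x"
      using e' hom_in_carrier[OF hj xU] by (simp add: group_isomorphisms_def y_def)
    \<comment> \<open>By naturality the boundary of \<open>y'\<close> is the value of \<theta> at
      \<open>x\<close>, which is trivial; so \<open>y'\<close> comes from a class \<open>z\<close>
      of \<open>WA\<close>.\<close>
    define y' where "y' = inclusion_hom p X UA UAB WA WAB y"
    have y'c: "y' \<in> carrier ?RWA" unfolding y'_def by (rule hom_induced_carrier)
    have "hom_boundary p (subtopology X WA) WAB y' = k (d y)"
    proof -
      have "hom_boundary p (subtopology X WA) WAB \<circ> inclusion_hom p X UA UAB WA WAB = k \<circ> d"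
        using naturality_hom_induced[of "subtopology X UA" "subtopology X WA" id UAB WAB p] UWA UW
        by (simp add: subs k_def d_def continuous_map_in_subtopology continuous_map_from_subtopology
              Pi_iff subset_iff)
      then show ?thesis by (simp add: y'_def fun_eq_iff)
    qed
    also have "\<dots> = \<one>\<^bsub>?HWAB\<^esub>"
      using \<theta>x by (simp add: \<theta>_def y_def WAB_def)
    finally have "y' \<in> kernel ?RWA ?HWAB (hom_boundary p (subtopology X WA) WAB)"
      using y'c by (simp add: kernel_def)
    then obtain z where z: "z \<in> carrier (homology_group p (subtopology X WA))" "inclusion_hom p X WA {} WA WAB z = y'"
      using homology_exactness_axiom_1[of p "subtopology X WA" WAB] by (auto simp: subs)
    define x' where "x' = inclusion_hom p X U {} W {} x"
    define z' where "z' = inclusion_hom p X WA {} W {} z"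
    let ?jW = "inclusion_hom p X W {} W WB"
    have x'c: "x' \<in> carrier ?HW" and z'c: "z' \<in> carrier ?HW"
      unfolding x'_def z'_def by (rule hom_induced_carrier)+
    \<comment> \<open>In the pair \<open>(W, WB)\<close> the classes \<open>x'\<close> and
      \<open>z'\<close> agree, so by exactness their difference comes from
      \<open>WB\<close>.\<close>
    have "?jW x' = inclusion_hom p X U {} W WB x"
      unfolding x'_def using UW by (intro inclusion_hom_compose) auto
    also have "\<dots> = inclusion_hom p X U UB W WB (j x)"
      unfolding j_def using UW UWB by (intro inclusion_hom_compose[symmetric]) auto
    also have "\<dots> = inclusion_hom p X UA UAB W WB y"
      unfolding ey[symmetric] using UW UWB by (intro inclusion_hom_compose) (auto simp: U_def UAB_def)
    also have "\<dots> = inclusion_hom p X WA WAB W WB y'"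
      unfolding y'_def using UW UWA by (intro inclusion_hom_compose[symmetric]) (auto simp: W_def WAB_def)
    also have "\<dots> = inclusion_hom p X WA {} W WB z"
      unfolding z(2)[symmetric] by (intro inclusion_hom_compose) (auto simp: W_def WAB_def)
    also have "\<dots> = ?jW z'"
      unfolding z'_def by (intro inclusion_hom_compose[symmetric]) (auto simp: W_def)
    finally have eq: "?jW x' = ?jW z'" .
    interpret HW: comm_group ?HW by simp
    interpret j: group_hom ?HW ?RWB ?jW
      by (intro group_hom.intro group_hom_axioms.intro) (auto simp: hom_induced_hom)
    let ?v = "inv\<^bsub>?HW\<^esub> z' \<otimes>\<^bsub>?HW\<^esub> x'"
    have "?v \<in> kernel ?HW ?RWB ?jW"
      using x'c z'c by (simp add: kernel_def eq)
    then obtain w where w: "w \<in> carrier (homology_group p (subtopology X WB))" "inclusion_hom p X WB {} W {} w = ?v"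
      using homology_exactness_axiom_3[of p "subtopology X W" WB] by (auto simp: subs)
    have "x' = z' \<otimes>\<^bsub>?HW\<^esub> inclusion_hom p X WB {} W {} w"
      unfolding w(2) using x'c z'c by (simp add: HW.m_assoc[symmetric])
    then show "\<exists>z w. z \<in> carrier (homology_group p (subtopology X WA)) \<and> w \<in> carrier (homology_group p (subtopology X WB)) \<and>
         inclusion_hom p X (UA \<union> UB) {} (WA \<union> WB) {} x =
         inclusion_hom p X WA {} (WA \<union> WB) {} z \<otimes>\<^bsub>homology_group p (subtopology X (WA \<union> WB))\<^esub>
         inclusion_hom p X WB {} (WA \<union> WB) {} w"
      using z(1) w(1) by (intro exI[of _ z] exI[of _ w]) (simp add: x'_def z'_def U_def W_def)
  qed
qed

text \<open>\<open>rank_le_hom\<close> with the connecting map as second map: its image is bounded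
  by the intersections one degree lower, and the classes that it kills become products of classes
  from \<open>WA\<close> and \<open>WB\<close>, whose images in \<open>V\<close> have finite
  rank.\<close>

lemma ev_bounded_inclusion_Un:
  assumes op: "openin X UA" "openin X UB" and sub: "UA \<subseteq> WA" "UB \<subseteq> WB" "WA \<subseteq> V" "WB \<subseteq> V"
    and A: "ev_bounded_inclusion X WA V" and B: "ev_bounded_inclusion X WB V"
    and AB: "ev_bounded_inclusion X (UA \<inter> UB) (WA \<inter> WB)"
  shows "ev_bounded_inclusion X (UA \<union> UB) V"
proof -
  let ?H = "\<lambda>p U. homology_group p (subtopology X U)"
  obtain a dA where a: "\<And>p. has_rank (?H (int p) V) (inclusion_hom (int p) X WA {} V {} ` carrier (?H (int p) WA)) (a p)"
    "\<And>p. p \<ge> dA \<Longrightarrow> a p = 0"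
    using A unfolding ev_bounded_inclusion_def by (rule ev_bounded_rankE) blast
  obtain b dB where b: "\<And>p. has_rank (?H (int p) V) (inclusion_hom (int p) X WB {} V {} ` carrier (?H (int p) WB)) (b p)"
    "\<And>p. p \<ge> dB \<Longrightarrow> b p = 0"
    using B unfolding ev_bounded_inclusion_def by (rule ev_bounded_rankE) blast
  obtain c dC where c: "\<And>p. has_rank (?H (int p) (WA \<inter> WB))
        (inclusion_hom (int p) X (UA \<inter> UB) {} (WA \<inter> WB) {} ` carrier (?H (int p) (UA \<inter> UB))) (c p)"
    "\<And>p. p \<ge> dC \<Longrightarrow> c p = 0"
    using AB unfolding ev_bounded_inclusion_def by (rule ev_bounded_rankE) blast
  \<comment> \<open>Degree \<open>p\<close> of the union meets degree \<open>p - 1\<close> of the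
    intersections; for \<open>p = 0\<close> this is the trivial group in degree -1.\<close>
  define c' where "c' = (\<lambda>p. case p of 0 \<Rightarrow> 0 | Suc q \<Rightarrow> c q)"
  have c': "rank_le (?H (int p - 1) (WA \<inter> WB))
      (inclusion_hom (int p - 1) X (UA \<inter> UB) {} (WA \<inter> WB) {} ` carrier (?H (int p - 1) (UA \<inter> UB))) (c' p)" for p
  proof (cases p)
    case 0
    have "rank_le (?H (- 1) (WA \<inter> WB)) (carrier (?H (- 1) (WA \<inter> WB))) 0"
      by (intro rank_le_trivial_group) (auto simp: trivial_homology_group)
    then have "rank_le (?H (- 1) (WA \<inter> WB))
      (inclusion_hom (- 1) X (UA \<inter> UB) {} (WA \<inter> WB) {} ` carrier (?H (- 1) (UA \<inter> UB))) 0"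
      by (rule rank_le_subset) (auto simp: hom_induced_carrier)
    then show ?thesis using 0 by (simp add: c'_def)
  next
    case (Suc q)
    then show ?thesis using has_rank_imp_rank_le[OF c(1)[of q]] by (simp add: c'_def)
  qed
  have rk: "rank_le (?H (int p) V) (inclusion_hom (int p) X (UA \<union> UB) {} V {} ` carrier (?H (int p) (UA \<union> UB)))
      ((b p + a p) + c' p)" for p
  proof -
    obtain \<theta> where \<theta>: "\<theta> \<in> hom (?H (int p) (UA \<union> UB)) (?H (int p - 1) (WA \<inter> WB))"
      "\<theta> ` carrier (?H (int p) (UA \<union> UB)) \<subseteq>
         inclusion_hom (int p - 1) X (UA \<inter> UB) {} (WA \<inter> WB) {} ` carrier (?H (int p - 1) (UA \<inter> UB))"
      "\<And>x. x \<in> carrier (?H (int p) (UA \<union> UB)) \<Longrightarrow> \<theta> x = \<one>\<^bsub>?H (int p - 1) (WA \<inter> WB)\<^esub> \<Longrightarrow>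
         \<exists>z w. z \<in> carrier (?H (int p) WA) \<and> w \<in> carrier (?H (int p) WB) \<and>
         inclusion_hom (int p) X (UA \<union> UB) {} (WA \<union> WB) {} x =
         inclusion_hom (int p) X WA {} (WA \<union> WB) {} z \<otimes>\<^bsub>?H (int p) (WA \<union> WB)\<^esub>
         inclusion_hom (int p) X WB {} (WA \<union> WB) {} w"
      using mayer_vietoris_connecting_hom[OF op sub(1,2), of "int p"] by blast
    let ?P = "{inclusion_hom (int p) X WA {} V {} z \<otimes>\<^bsub>?H (int p) V\<^esub> inclusion_hom (int p) X WB {} V {} w | z w.
           z \<in> carrier (?H (int p) WA) \<and> w \<in> carrier (?H (int p) WB)}"
    have P: "rank_le (?H (int p) V) ?P (b p + a p)"
      using has_rank_imp_rank_le[OF a(1)] has_rank_imp_rank_le[OF b(1)]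
      by (intro rank_le_group_prod) (auto simp: hom_induced_hom)
    have sP: "inclusion_hom (int p) X (UA \<union> UB) {} V {} x \<in> ?P"
      if x: "x \<in> carrier (?H (int p) (UA \<union> UB))" and \<theta>x: "\<theta> x = \<one>\<^bsub>?H (int p - 1) (WA \<inter> WB)\<^esub>" for x
    proof -
      let ?i = "inclusion_hom (int p) X (WA \<union> WB) {} V {}"
      obtain z w where zw: "z \<in> carrier (?H (int p) WA)" "w \<in> carrier (?H (int p) WB)"
        "inclusion_hom (int p) X (UA \<union> UB) {} (WA \<union> WB) {} x =
         inclusion_hom (int p) X WA {} (WA \<union> WB) {} z \<otimes>\<^bsub>?H (int p) (WA \<union> WB)\<^esub>
         inclusion_hom (int p) X WB {} (WA \<union> WB) {} w"
        using \<theta>(3)[OF x \<theta>x] by blast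
      have "inclusion_hom (int p) X (UA \<union> UB) {} V {} x = ?i (inclusion_hom (int p) X (UA \<union> UB) {} (WA \<union> WB) {} x)"
        using sub by (intro inclusion_hom_compose[symmetric]) auto
      also have "\<dots> = ?i (inclusion_hom (int p) X WA {} (WA \<union> WB) {} z) \<otimes>\<^bsub>?H (int p) V\<^esub>
            ?i (inclusion_hom (int p) X WB {} (WA \<union> WB) {} w)"
        unfolding zw(3) by (intro hom_mult[OF hom_induced_hom] hom_induced_carrier)
      also have "?i (inclusion_hom (int p) X WA {} (WA \<union> WB) {} z) = inclusion_hom (int p) X WA {} V {} z"
        using sub by (intro inclusion_hom_compose) auto
      also have "?i (inclusion_hom (int p) X WB {} (WA \<union> WB) {} w) = inclusion_hom (int p) X WB {} V {} w"
        using sub by (intro inclusion_hom_compose) auto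
      finally show ?thesis using zw(1,2) by blast
    qed
    show ?thesis
    proof (rule rank_le_hom[where C = "?H (int p - 1) (WA \<inter> WB)" and g = \<theta>])
      show "rank_le (?H (int p) V) (inclusion_hom (int p) X (UA \<union> UB) {} V {} `
        (carrier (?H (int p) (UA \<union> UB)) \<inter> kernel (?H (int p) (UA \<union> UB)) (?H (int p - 1) (WA \<inter> WB)) \<theta>)) (b p + a p)"
        by (rule rank_le_subset[OF P]) (use sP in \<open>auto simp: kernel_def\<close>)
      show "rank_le (?H (int p - 1) (WA \<inter> WB)) (\<theta> ` carrier (?H (int p) (UA \<union> UB))) (c' p)"
        by (rule rank_le_subset[OF c' \<theta>(2)])
    qed (use \<theta>(1) in \<open>auto simp: hom_induced_hom group.subgroup_self\<close>)
  qed
  have "rank_le (?H (int p) V) (inclusion_hom (int p) X (UA \<union> UB) {} V {} ` carrier (?H (int p) (UA \<union> UB))) 0"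
    if "p \<ge> max (max dA dB) (Suc dC)" for p
  proof -
    have "a p = 0" "b p = 0" "c' p = 0"
      using that a(2) b(2) c(2) by (auto simp: c'_def split: nat.splits)
    then show ?thesis using rk[of p] by simp
  qed
  with rk show ?thesis
    unfolding ev_bounded_inclusion_def ev_bounded_rank_def by blast
qed

text \<open>A homological form of local finiteness that, unlike finite generation itself,
  passes from compact sets to their unions by Mayer--Vietoris.\<close>

definition tame_in :: "'a topology \<Rightarrow> 'a set \<Rightarrow> bool" where
  "tame_in X A \<longleftrightarrow> (\<forall>V. openin X V \<and> A \<subseteq> V \<longrightarrow>
     (\<exists>U. openin X U \<and> A \<subseteq> U \<and> U \<subseteq> V \<and> ev_bounded_inclusion X U V))"

text \<open>The order of choices matters: neighborhoods \<open>WA\<close> and \<open>WB\<close> for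
  \<open>V\<close>, then \<open>C\<close> for their intersection, and finally smaller neighborhoods
  of \<open>A\<close> and \<open>B\<close> that meet only inside \<open>C\<close>.\<close>

lemma tame_in_Un:
  assumes norm: "normal_space X" and cl: "closedin X A" "closedin X B"
    and tame: "tame_in X A" "tame_in X B" "tame_in X (A \<inter> B)"
  shows "tame_in X (A \<union> B)"
  unfolding tame_in_def
proof (intro allI impI, elim conjE)
  fix V assume V: "openin X V" "A \<union> B \<subseteq> V"
  then obtain WA where WA: "openin X WA" "A \<subseteq> WA" "WA \<subseteq> V" "ev_bounded_inclusion X WA V"
    using tame(1) unfolding tame_in_def by (metis Un_subset_iff)
  obtain WB where WB: "openin X WB" "B \<subseteq> WB" "WB \<subseteq> V" "ev_bounded_inclusion X WB V"
    using V tame(2) unfolding tame_in_def by (metis Un_subset_iff)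
  have "openin X (WA \<inter> WB)" "A \<inter> B \<subseteq> WA \<inter> WB" using WA WB by auto
  then obtain C where C: "openin X C" "A \<inter> B \<subseteq> C" "C \<subseteq> WA \<inter> WB" "ev_bounded_inclusion X C (WA \<inter> WB)"
    using tame(3) unfolding tame_in_def by metis
  \<comment> \<open>Outside \<open>C\<close> the two sets are disjoint, so normality separates them
    by \<open>P\<close> and \<open>Q\<close>; adding \<open>C\<close> back makes the neighborhoods
    cover \<open>A\<close> and \<open>B\<close> again.\<close>
  have "closedin X (A - C)" "closedin X (B - C)" "disjnt (A - C) (B - C)"
    using cl C by (auto simp: disjnt_def closedin_diff)
  then obtain P Q where PQ: "openin X P" "openin X Q" "A - C \<subseteq> P" "B - C \<subseteq> Q" "disjnt P Q"
    using norm unfolding normal_space_def by meson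
  let ?UA = "WA \<inter> (P \<union> C)" and ?UB = "WB \<inter> (Q \<union> C)"
  have "?UA \<inter> ?UB \<subseteq> C" using PQ(5) by (auto simp: disjnt_def)
  then have "ev_bounded_inclusion X (?UA \<inter> ?UB) (WA \<inter> WB)"
    using C by (intro ev_bounded_inclusion_subset[OF C(4)])
  then have "ev_bounded_inclusion X (?UA \<union> ?UB) V"
    using WA WB PQ C by (intro ev_bounded_inclusion_Un[of X ?UA ?UB WA WB V]) auto
  moreover have "A \<union> B \<subseteq> ?UA \<union> ?UB" "?UA \<union> ?UB \<subseteq> V" "openin X (?UA \<union> ?UB)"
    using WA WB PQ C by auto
  ultimately show "\<exists>U. openin X U \<and> A \<union> B \<subseteq> U \<and> U \<subseteq> V \<and> ev_bounded_inclusion X U V" by blast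
qed

text \<open>In the chart, finitely many balls inside the image of \<open>V\<close> cover the compact
  set. Their union already has homology of finite total rank, so its inclusion into \<open>V\<close>
  is good.\<close>

lemma tame_in_chart:
  fixes \<phi> :: "'a \<Rightarrow> 'n::euclidean_space"
  assumes A: "compactin X A" and O': "openin X O'" "A \<subseteq> O'"
    and \<phi>: "homeomorphic_map (subtopology X O') euclidean \<phi>"
  shows "tame_in X A"
  unfolding tame_in_def
proof (intro allI impI, elim conjE)
  fix V assume V: "openin X V" "A \<subseteq> V"
  have OX: "topspace (subtopology X O') = O'" using O' openin_subset by fastforce
  have "open (\<phi> ` (O' \<inter> V))"
    using homeomorphic_map_openness[OF \<phi>, of "O' \<inter> V"] V OX openin_subset[OF V(1)]
    by (simp add: openin_subtopology_Int2 le_infI2)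
  moreover have cA: "compact (\<phi> ` A)"
    using homeomorphic_map_compactness[OF \<phi>, of A] A O' OX compactin_subset_topspace[OF A]
    by (simp add: compactin_subtopology)
  moreover have "\<phi> ` A \<subseteq> \<phi> ` (O' \<inter> V)" using O' V by auto
  ultimately have "\<forall>y\<in>\<phi> ` A. \<exists>e>0. ball y e \<subseteq> \<phi> ` (O' \<inter> V)"
    using open_contains_ball by blast
  then obtain e where e: "\<And>y. y \<in> \<phi> ` A \<Longrightarrow> e y > 0 \<and> ball y (e y) \<subseteq> \<phi> ` (O' \<inter> V)" by metis
  have "\<phi> ` A \<subseteq> (\<Union>y\<in>\<phi> ` A. ball y (e y))" using e by fastforce
  then obtain D where D: "D \<subseteq> \<phi> ` A" "finite D" "\<phi> ` A \<subseteq> (\<Union>y\<in>D. ball y (e y))"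
    using compactE_image[OF cA, of "\<phi> ` A" "\<lambda>y. ball y (e y)"] by auto
  define U' where "U' = (\<Union>y\<in>D. ball y (e y))"
  obtain c where c: "has_euler (top_of_set U') {} c"
    unfolding U'_def
    by (rule has_euler_finite_Union_open_convex[of "(\<lambda>y. ball y (e y)) ` D"]) (use D(2) in auto)
  define U where "U = {x \<in> O'. \<phi> x \<in> U'}"
  have inj: "inj_on \<phi> O'" and surj: "\<phi> ` O' = UNIV"
    using homeomorphic_imp_injective_map[OF \<phi>] homeomorphic_imp_surjective_map[OF \<phi>] OX by auto
  have \<phi>U: "\<phi> ` U = U'"
  proof
    show "U' \<subseteq> \<phi> ` U"
    proof
      fix y assume "y \<in> U'"
      moreover obtain x where "x \<in> O'" "y = \<phi> x" using surj by (metis UNIV_I imageE)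
      ultimately show "y \<in> \<phi> ` U" by (auto simp: U_def)
    qed
  qed (auto simp: U_def)
  have "open U'" by (auto simp: U'_def)
  then have Uop: "openin X U"
    using homeomorphic_map_openness[OF \<phi>, of U] \<phi>U OX O'(1) openin_open_subtopology[OF O'(1)]
    by (auto simp: U_def)
  have AU: "A \<subseteq> U" using D(3) O'(2) unfolding U_def U'_def by blast
  have UV: "U \<subseteq> V"
  proof
    fix x assume x: "x \<in> U"
    then have "\<phi> x \<in> \<phi> ` (O' \<inter> V)" using D(1) e unfolding U_def U'_def by blast
    then show "x \<in> V" using inj x unfolding U_def inj_on_def by auto
  qed
  have "homeomorphic_map (subtopology (subtopology X O') U) (subtopology euclidean U') \<phi>"
    using \<phi>U OX by (intro homeomorphic_map_subtopologies[OF \<phi>]) (auto simp: U_def)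
  moreover have "subtopology (subtopology X O') U = subtopology X U"
    by (simp add: subtopology_subtopology U_def Int_absorb1)
  ultimately have "subtopology X U homeomorphic_space top_of_set U'"
    by (metis homeomorphic_map_imp_homeomorphic_space)
  then have "has_euler (subtopology X U) {} c"
    using c has_euler_homeomorphic homeomorphic_space_sym by blast
  then have "ev_bounded_inclusion X U V" by (rule has_euler_imp_ev_bounded_inclusion)
  then show "\<exists>U. openin X U \<and> A \<subseteq> U \<and> U \<subseteq> V \<and> ev_bounded_inclusion X U V"
    using Uop AU UV by blast
qed

text \<open>Tameness is assumed for all closed subsets of the members because the induction, again
  over a bound of the cardinality, meets intersections of members, whose shape is arbitrary.\<close>

lemma tame_in_finite_Union:
  assumes norm: "normal_space X" and "finite \<A>"
    and cl: "\<And>A. A \<in> \<A> \<Longrightarrow> closedin X A"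
    and tame: "\<And>A B. A \<in> \<A> \<Longrightarrow> closedin X B \<Longrightarrow> B \<subseteq> A \<Longrightarrow> tame_in X B"
  shows "tame_in X (\<Union>\<A>)"
proof -
  have "tame_in X (\<Union>\<A>)"
    if "finite \<A>" "card \<A> \<le> n" "\<forall>A\<in>\<A>. closedin X A \<and> (\<forall>B. closedin X B \<longrightarrow> B \<subseteq> A \<longrightarrow> tame_in X B)" for n \<A>
    using that
  proof (induction n arbitrary: \<A>)
    case 0
    have "has_euler (subtopology X {}) {} 0" by (simp add: has_euler_empty)
    then have "ev_bounded_inclusion X {} V" for V
      by (rule has_euler_imp_ev_bounded_inclusion)
    then have "tame_in X {}"
      unfolding tame_in_def by (intro allI impI exI[of _ "{}"]) auto
    then show ?case using 0 by simp
  next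
    case (Suc n)
    show ?case
    proof (cases "\<A> = {}")
      case True
      then show ?thesis using Suc.IH[of "{}"] by simp
    next
      case False
      then obtain A where A: "A \<in> \<A>" by auto
      define \<B> where "\<B> = \<A> - {A}"
      have \<B>: "finite \<B>" "card \<B> \<le> n"
        using Suc.prems(1,2) A by (auto simp: \<B>_def)
      have \<B>': "\<forall>A\<in>\<B>. closedin X A \<and> (\<forall>B. closedin X B \<longrightarrow> B \<subseteq> A \<longrightarrow> tame_in X B)"
        using Suc.prems(3) unfolding \<B>_def by blast
      have "tame_in X (\<Union>((\<inter>) A ` \<B>))"
      proof (rule Suc.IH)
        show "card ((\<inter>) A ` \<B>) \<le> n" using order_trans[OF card_image_le[OF \<B>(1)] \<B>(2)] .
        show "\<forall>C\<in>(\<inter>) A ` \<B>. closedin X C \<and> (\<forall>B. closedin X B \<longrightarrow> B \<subseteq> C \<longrightarrow> tame_in X B)"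
          using \<B>' A Suc.prems(3) by (blast intro: closedin_Int)
      qed (use \<B> in auto)
      then have "tame_in X (A \<inter> \<Union>\<B>)" by (metis Int_Union)
      moreover have "tame_in X A" using Suc.prems A by blast
      moreover have "tame_in X (\<Union>\<B>)" using Suc.IH[OF \<B> \<B>'] .
      moreover have "closedin X (\<Union>\<B>)" using \<B>(1) \<B>' by (intro closedin_Union) auto
      moreover have "closedin X A" using Suc.prems A by blast
      ultimately have "tame_in X (A \<union> \<Union>\<B>)" by (metis norm tame_in_Un)
      moreover have "A \<union> \<Union>\<B> = \<Union>\<A>" using A by (auto simp: \<B>_def)
      ultimately show ?thesis by simp
    qed
  qed
  from this[OF assms(2) order_refl] show ?thesis using cl tame by blast
qed

text \<open>The only neighborhood of the whole space is the space itself, so tameness of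
  \<open>topspace X\<close> says that the identity on homology has finite total rank.\<close>

lemma closed_surface_has_euler:
  assumes "closed_surface X"
  obtains c where "has_euler X {} c"
proof -
  have comp: "compact_space X" and Hd: "Hausdorff_space X"
    and chart: "\<And>x. x \<in> topspace X \<Longrightarrow> \<exists>U. openin X U \<and> x \<in> U \<and>
        subtopology X U homeomorphic_space (euclidean :: complex topology)"
    using assms by (auto simp: closed_surface_def)
  have norm: "normal_space X" and reg: "regular_space X"
    using comp Hd compact_Hausdorff_or_regular_imp_normal_space compact_Hausdorff_imp_regular_space by blast+
  \<comment> \<open>The closures of these sets serve as the compact pieces of the cover; every
    closed subset of such a piece lies in the same chart.\<close>
  define good where "good = (\<lambda>U. openin X U \<and> (\<exists>O'. openin X O' \<and> X closure_of U \<subseteq> O' \<and>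
        subtopology X O' homeomorphic_space (euclidean :: complex topology)))"
  have "\<exists>U. good U \<and> x \<in> U" if x: "x \<in> topspace X" for x
  proof -
    obtain O' where O': "openin X O'" "x \<in> O'" "subtopology X O' homeomorphic_space (euclidean :: complex topology)"
      using chart[OF x] by blast
    have "neighbourhood_base_of (closedin X) X"
      using reg neighbourhood_base_of_closedin by blast
    then obtain U C where "openin X U" "closedin X C" "x \<in> U" "U \<subseteq> C" "C \<subseteq> O'"
      using O' unfolding neighbourhood_base_of by meson
    then show ?thesis
      using O' closure_of_minimal[of U C X] unfolding good_def by blast
  qed
  then have "topspace X \<subseteq> \<Union>(Collect good)" by blast
  moreover have "\<forall>U\<in>Collect good. openin X U" by (auto simp: good_def)
  ultimately obtain \<U> where \<U>: "finite \<U>" "\<U> \<subseteq> Collect good" "topspace X \<subseteq> \<Union>\<U>"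
    using comp unfolding compact_space_alt by meson
  have "tame_in X (\<Union>((closure_of) X ` \<U>))"
  proof (rule tame_in_finite_Union[OF norm])
    show "finite ((closure_of) X ` \<U>)" using \<U> by auto
    fix A assume A: "A \<in> (closure_of) X ` \<U>"
    then show "closedin X A" by auto
    fix B assume B: "closedin X B" "B \<subseteq> A"
    obtain U where U: "good U" "A = X closure_of U" using A \<U> by auto
    then obtain O' where O': "openin X O'" "A \<subseteq> O'" "subtopology X O' homeomorphic_space (euclidean :: complex topology)"
      unfolding good_def by blast
    then obtain \<phi> :: "'a \<Rightarrow> complex" where "homeomorphic_map (subtopology X O') euclidean \<phi>"
      using homeomorphic_space by blast
    moreover have "compactin X B" using B comp closedin_compact_space by blast
    ultimately show "tame_in X B" using O' B by (intro tame_in_chart[of X B O' \<phi>]) auto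
  qed
  moreover have "\<Union>((closure_of) X ` \<U>) = topspace X"
  proof
    show "\<Union>((closure_of) X ` \<U>) \<subseteq> topspace X" using closure_of_subset_topspace by fastforce
    show "topspace X \<subseteq> \<Union>((closure_of) X ` \<U>)"
    proof
      fix x assume x: "x \<in> topspace X"
      then obtain U where U: "U \<in> \<U>" "x \<in> U" using \<U> by blast
      then have "U \<subseteq> topspace X" using \<U> openin_subset unfolding good_def by blast
      then show "x \<in> \<Union>((closure_of) X ` \<U>)" using U closure_of_subset by fastforce
    qed
  qed
  ultimately have "tame_in X (topspace X)" by simp
  then obtain U where U: "topspace X \<subseteq> U" "U \<subseteq> topspace X" "ev_bounded_inclusion X U (topspace X)"
    unfolding tame_in_def by blast
  then have "ev_bounded_inclusion X (topspace X) (topspace X)" by (metis subset_antisym)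
  then have "ev_bounded_homology X {}"
    unfolding ev_bounded_inclusion_def subtopology_topspace by (simp add: hom_induced_id cong: image_cong)
  then show ?thesis using that ev_bounded_imp_has_euler by blast
qed


section \<open>Subsurfaces and gluing of discs\<close>

text \<open>The closed half-plane is the closure of its interior, and charts carry this over to
  \<open>N\<close>. It rules out lower-dimensional parts of \<open>N\<close>, which would vanish
  from the frontier of the closed complement.\<close>

lemma subsurface_frontier_subset:
  assumes "subsurface X N"
  shows "X frontier_of N \<subseteq> X closure_of (X interior_of N)"
proof
  fix x assume x: "x \<in> X frontier_of N"
  then obtain U \<phi> where U: "openin X U" "x \<in> U"
    and \<phi>: "homeomorphic_map (subtopology X U) (euclidean :: complex topology) \<phi>"
    and im: "\<phi> ` (U \<inter> N) = {z. 0 \<le> Im z}"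
    using assms unfolding subsurface_def by blast
  let ?U = "subtopology X U"
  have N: "closedin X N" using assms by (simp add: subsurface_def)
  have tU: "topspace ?U = U" using U openin_subset by fastforce
  have "interior {z. 0 \<le> Im z} = {z. 0 < Im z}" "closure {z. 0 < Im z} = {z. 0 \<le> Im z}"
    using interior_halfspace_ge[of \<i> 0] closure_halfspace_gt[of \<i> 0] by simp_all
  then have "\<phi> ` (U \<inter> N) = closure (interior (\<phi> ` (U \<inter> N)))" using im by simp
  also have "\<dots> = \<phi> ` (?U closure_of (?U interior_of (U \<inter> N)))"
    using homeomorphic_map_interior_of[OF \<phi>, of "U \<inter> N"]
      homeomorphic_map_closure_of[OF \<phi>, of "?U interior_of (U \<inter> N)"] tU
      interior_of_subset_topspace[of ?U "U \<inter> N"] by (simp del: topspace_subtopology)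
  finally have "\<phi> ` (U \<inter> N) \<subseteq> \<phi> ` (?U closure_of (?U interior_of (U \<inter> N)))" by simp
  moreover have "inj_on \<phi> U" using homeomorphic_imp_injective_map[OF \<phi>] tU by simp
  moreover have "?U closure_of (?U interior_of (U \<inter> N)) \<subseteq> U"
    using closure_of_subset_topspace[of ?U] tU by auto
  ultimately have "U \<inter> N \<subseteq> ?U closure_of (?U interior_of (U \<inter> N))"
    by (simp add: inj_on_image_subset_iff)
  moreover have "x \<in> N" using x frontier_of_subset_closedin[OF N] by auto
  ultimately have "x \<in> ?U closure_of (?U interior_of (U \<inter> N))" using U by auto
  also have "\<dots> \<subseteq> X closure_of (X interior_of N)"
  proof -
    have "?U interior_of (U \<inter> N) \<subseteq> X interior_of N"
      using U(1) interior_of_mono[of "U \<inter> N" N X] by (auto simp: interior_of_subtopology_open)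
    then show ?thesis
      using closure_of_mono U(1) by (fastforce simp: closure_of_subtopology_open)
  qed
  finally show "x \<in> X closure_of (X interior_of N)" .
qed

text \<open>The closed complement of \<open>N\<close> is the complement of its interior, and the
  interior has the same frontier as \<open>N\<close>. Hence the same circles are capped off on both
  sides.\<close>

lemma frontier_of_closed_complement:
  assumes "subsurface X N"
  shows "X frontier_of closed_complement X N = X frontier_of N"
proof -
  have N: "closedin X N" using assms by (simp add: subsurface_def)
  have "X frontier_of closed_complement X N = X frontier_of (X interior_of N)"
    by (simp add: closed_complement_def closure_of_complement frontier_of_complement)
  also have "\<dots> = X closure_of (X interior_of N) - X interior_of N"
    by (simp add: frontier_of_openin)
  also have "\<dots> = X frontier_of N"
  proof -
    have "X closure_of (X interior_of N) \<subseteq> N"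
      by (intro closure_of_minimal interior_of_subset N)
    then show ?thesis
      using subsurface_frontier_subset[OF assms] closure_of_closedin[OF N]
      by (auto simp: frontier_of_def)
  qed
  finally show ?thesis .
qed

text \<open>In a chart the frontier is the real line, which is connected and so lies in a single
  component. Compactness then leaves only finitely many components.\<close>

lemma openin_boundary_components:
  assumes "subsurface X N" "C \<in> boundary_components X N"
  shows "openin (subtopology X (X frontier_of N)) C"
proof (subst openin_subopen, intro ballI)
  let ?F = "subtopology X (X frontier_of N)"
  fix x assume x: "x \<in> C"
  have C: "C \<in> connected_components_of ?F" using assms by (simp add: boundary_components_def)
  then have "x \<in> X frontier_of N" using connected_components_of_subset x by fastforce
  then obtain U \<phi> where U: "openin X U" "x \<in> U"
    and \<phi>: "homeomorphic_map (subtopology X U) (euclidean :: complex topology) \<phi>"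
    and im: "\<phi> ` (U \<inter> N) = {z. 0 \<le> Im z}"
    using assms unfolding subsurface_def by blast
  let ?U = "subtopology X U"
  have tU: "topspace ?U = U" using U openin_subset by fastforce
  have fr: "?U frontier_of (U \<inter> N) = U \<inter> X frontier_of N"
  proof -
    have "?U frontier_of (U \<inter> N) = ?U frontier_of N"
      using frontier_of_restrict[of ?U N] tU by simp
    then show ?thesis using frontier_of_subtopology_open[OF U(1)] by simp
  qed
  have "\<phi> ` (U \<inter> X frontier_of N) = frontier {z. 0 \<le> Im z}"
    using homeomorphic_map_frontier_of[OF \<phi>, of "U \<inter> N"] tU im
    by (simp add: fr del: topspace_subtopology)
  also have "\<dots> = {z. Im z = 0}" using frontier_halfspace_ge[of \<i> 0] by simp
  finally have "\<phi> ` (U \<inter> X frontier_of N) = {z. Im z = 0}" .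
  moreover have "convex {z. Im z = 0}" using convex_hyperplane[of \<i> 0] by simp
  ultimately have "connected (\<phi> ` (U \<inter> X frontier_of N))" by (simp add: convex_connected)
  then have "connectedin ?U (U \<inter> X frontier_of N)"
    using homeomorphic_map_connectedness[OF \<phi>, of "U \<inter> X frontier_of N"] tU
    by (simp del: topspace_subtopology)
  then have "connectedin ?F (U \<inter> X frontier_of N)"
    by (simp add: connectedin_subtopology)
  moreover have "\<not> disjnt C (U \<inter> X frontier_of N)"
    using x U \<open>x \<in> X frontier_of N\<close> by (auto simp: disjnt_def)
  ultimately have "U \<inter> X frontier_of N \<subseteq> C" using C connected_components_of_maximal by blast
  moreover have "openin ?F (U \<inter> X frontier_of N)" using U by (simp add: openin_subtopology_Int)
  ultimately show "\<exists>T. openin ?F T \<and> x \<in> T \<and> T \<subseteq> C"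
    using U \<open>x \<in> X frontier_of N\<close> by blast
qed

lemma finite_boundary_components:
  assumes "compact_space X" "subsurface X N"
  shows "finite (boundary_components X N)"
proof -
  let ?F = "subtopology X (X frontier_of N)"
  have "compact_space ?F"
    using assms closedin_frontier_of closedin_compact_space compact_space_subtopology by blast
  moreover have "topspace ?F \<subseteq> \<Union>(boundary_components X N)"
    by (simp add: boundary_components_def Union_connected_components_of)
  ultimately obtain \<D> where D: "finite \<D>" "\<D> \<subseteq> boundary_components X N" "topspace ?F \<subseteq> \<Union>\<D>"
    using openin_boundary_components[OF assms(2)] unfolding compact_space_alt by meson
  have "boundary_components X N \<subseteq> \<D>"
  proof
    fix C assume C: "C \<in> boundary_components X N"
    then obtain x where x: "x \<in> C" "x \<in> topspace ?F"
      unfolding boundary_components_def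
      using nonempty_connected_components_of connected_components_of_subset by blast
    then obtain D where "D \<in> \<D>" "x \<in> D" using D by blast
    moreover have "C = D"
      using C calculation x D(2) connected_components_of_overlap[of C ?F D]
      unfolding boundary_components_def by blast
    ultimately show "C \<in> \<D>" by simp
  qed
  then show ?thesis using D(1) finite_subset by blast
qed

text \<open>That the components are circles is read off from the attaching maps \<open>f\<close>;
  finitely many disjoint open circles contribute 0 each.\<close>

lemma has_euler_boundary:
  assumes "compact_space X" "subsurface X N" "attaching_maps X N f"
  shows "has_euler (subtopology X (X frontier_of N)) {} 0"
proof -
  let ?F = "subtopology X (X frontier_of N)"
  have "has_euler (subtopology ?F (\<Union>(boundary_components X N))) {} (int (card (boundary_components X N)) * 0)"
  proof (rule has_euler_disjoint_Union)
    fix C assume C: "C \<in> boundary_components X N"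
    then show "openin ?F C" using openin_boundary_components[OF assms(2)] by blast
    have "C \<subseteq> X frontier_of N"
      using C connected_components_of_subset unfolding boundary_components_def by fastforce
    then have eq: "subtopology ?F C = subtopology X C"
      by (simp add: subtopology_subtopology Int_absorb1)
    have "top_of_set (sphere (0::complex) 1) homeomorphic_space (subtopology X C)"
      by (rule homeomorphic_map_imp_homeomorphic_space[of _ _ "f C"])
         (use assms(3) C in \<open>auto simp: attaching_maps_def\<close>)
    then show "has_euler (subtopology ?F C) {} 0"
      unfolding eq by (rule has_euler_homeomorphic[OF has_euler_circle])
  qed (use finite_boundary_components[OF assms(1,2)] in
      \<open>auto simp: boundary_components_def pairwise_disjoint_connected_components_of\<close>)
  moreover have "\<Union>(boundary_components X N) = topspace ?F"
    by (simp add: boundary_components_def Union_connected_components_of)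
  ultimately show ?thesis by (simp add: subtopology_topspace del: topspace_subtopology)
qed

section \<open>Topology of the space with discs glued in\<close>

context
  fixes X :: "'a topology" and N :: "'a set" and f :: "'a set \<Rightarrow> complex \<Rightarrow> 'a"
  assumes N: "closedin X N" and f: "attaching_maps X N f"
begin

lemma boundary_component_subset:
  assumes "C \<in> boundary_components X N"
  shows "C \<subseteq> N" "C \<subseteq> topspace X" "closedin X C"
proof -
  let ?F = "subtopology X (X frontier_of N)"
  have "closedin ?F C"
    using assms closedin_connected_components_of unfolding boundary_components_def by blast
  then show cl: "closedin X C"
    using closedin_trans_full closedin_frontier_of by blast
  then show "C \<subseteq> topspace X" by (rule closedin_subset)
  have "C \<subseteq> X frontier_of N"
    using assms connected_components_of_subset unfolding boundary_components_def by fastforce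
  then show "C \<subseteq> N" using frontier_of_subset_closedin[OF N] by auto
qed

lemma attaching_map_props:
  assumes "C \<in> boundary_components X N"
  shows "homeomorphic_map (top_of_set (sphere 0 1)) (subtopology X C) (f C)"
    "\<And>z. norm z = 1 \<Longrightarrow> f C z \<in> C" "inj_on (f C) (sphere 0 1)"
proof -
  show hm: "homeomorphic_map (top_of_set (sphere 0 1)) (subtopology X C) (f C)"
    using f assms by (auto simp: attaching_maps_def)
  show "inj_on (f C) (sphere 0 1)" using homeomorphic_imp_injective_map[OF hm] by simp
  show "f C z \<in> C" if "norm z = 1" for z
    using homeomorphic_imp_surjective_map[OF hm] that by auto
qed

lemma attaching_map_in:
  assumes "C \<in> boundary_components X N" "norm z = 1"
  shows "f C z \<in> topspace X \<inter> N"
  using attaching_map_props(2)[OF assms] boundary_component_subset[OF assms(1)] by blast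

lemma disc_map_image_subset:
  assumes "C \<in> boundary_components X N" "C \<in> \<C>"
  shows "disc_map f C ` cball 0 1 \<subseteq> Inl ` (topspace X \<inter> N) \<union> Inr ` (\<C> \<times> ball 0 1)"
proof clarify
  fix z :: complex assume z: "z \<in> cball 0 1" "disc_map f C z \<notin> Inr ` (\<C> \<times> ball 0 1)"
  then have "norm z = 1" using assms(2) by (cases "norm z = 1") (auto simp: disc_map_def)
  then show "disc_map f C z \<in> Inl ` (topspace X \<inter> N)"
    using attaching_map_in[OF assms(1)] by (simp add: disc_map_def)
qed

lemma topspace_glue_discs:
  "topspace (glue_discs X N f) = Inl ` (topspace X \<inter> N) \<union> Inr ` (boundary_components X N \<times> ball 0 1)"
proof (rule antisym)
  show "topspace (glue_discs X N f) \<subseteq> Inl ` (topspace X \<inter> N) \<union> Inr ` (boundary_components X N \<times> ball 0 1)"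
    using openin_topspace[of "glue_discs X N f"] unfolding openin_glue_discs by blast
  let ?T = "Inl ` (topspace X \<inter> N) \<union> Inr ` (boundary_components X N \<times> ball 0 1)"
  have disc: "{z \<in> cball 0 1. disc_map f C z \<in> ?T} = cball 0 1" if "C \<in> boundary_components X N" for C
    using disc_map_image_subset[OF that that] by auto
  have surf: "{x \<in> topspace X \<inter> N. Inl x \<in> ?T} = topspace (subtopology X N)" by auto
  have "openin (glue_discs X N f) ?T"
    unfolding openin_glue_discs surf
  proof (intro conjI ballI)
    fix C assume "C \<in> boundary_components X N"
    from disc[OF this] show "openin (top_of_set (cball 0 1)) {z \<in> cball 0 1. disc_map f C z \<in> ?T}"
      by (simp only: openin_subtopology_self)
  qed (simp_all del: topspace_subtopology)
  then show "?T \<subseteq> topspace (glue_discs X N f)" by (rule openin_subset)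
qed

lemma closedin_glue_discs:
  "closedin (glue_discs X N f) T \<longleftrightarrow>
     T \<subseteq> Inl ` (topspace X \<inter> N) \<union> Inr ` (boundary_components X N \<times> ball 0 1) \<and>
     closedin (subtopology X N) {x \<in> topspace X \<inter> N. Inl x \<in> T} \<and>
     (\<forall>C\<in>boundary_components X N. closed {z \<in> cball 0 1. disc_map f C z \<in> T})"
proof -
  let ?Y = "Inl ` (topspace X \<inter> N) \<union> Inr ` (boundary_components X N \<times> ball 0 1)"
  have 1: "{x \<in> topspace X \<inter> N. Inl x \<in> ?Y - T} = topspace (subtopology X N) - {x \<in> topspace X \<inter> N. Inl x \<in> T}"
    by auto
  have 2: "{z \<in> cball 0 1. disc_map f C z \<in> ?Y - T} =
      topspace (top_of_set (cball 0 1)) - {z \<in> cball 0 1. disc_map f C z \<in> T}"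
    if "C \<in> boundary_components X N" for C
    using disc_map_image_subset[OF that that] by auto
  have 3: "closed {z \<in> cball 0 1. disc_map f C z \<in> T} \<longleftrightarrow>
      openin (top_of_set (cball 0 1)) {z \<in> cball 0 1. disc_map f C z \<in> ?Y - T}"
    if "C \<in> boundary_components X N" for C
  proof -
    have "closed {z \<in> cball 0 1. disc_map f C z \<in> T} \<longleftrightarrow> closedin (top_of_set (cball 0 1)) {z \<in> cball 0 1. disc_map f C z \<in> T}"
      by (auto simp: closedin_closed_eq)
    then show ?thesis unfolding 2[OF that] by (auto simp: closedin_def)
  qed
  have 4: "closedin (subtopology X N) {x \<in> topspace X \<inter> N. Inl x \<in> T} \<longleftrightarrow>
     openin (subtopology X N) {x \<in> topspace X \<inter> N. Inl x \<in> ?Y - T}"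
    unfolding 1 by (auto simp: closedin_def)
  show ?thesis
    unfolding closedin_def[of "glue_discs X N f"] topspace_glue_discs openin_glue_discs 4
    using 3 by (auto simp del: Diff_iff)
qed

lemma closedin_glue_discs_Inl:
  assumes "closedin X T" "T \<subseteq> N"
  shows "closedin (glue_discs X N f) (Inl ` T)"
  unfolding closedin_glue_discs
proof (intro conjI ballI)
  have TX: "T \<subseteq> topspace X" using assms closedin_subset by blast
  then show "Inl ` T \<subseteq> Inl ` (topspace X \<inter> N) \<union> Inr ` (boundary_components X N \<times> ball 0 1)"
    using assms by auto
  have eq: "{x \<in> topspace X \<inter> N. Inl x \<in> Inl ` T} = T" using TX assms by auto
  show "closedin (subtopology X N) {x \<in> topspace X \<inter> N. Inl x \<in> Inl ` T}"
    unfolding eq using assms by (simp add: closedin_subset_topspace)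
  fix C assume C: "C \<in> boundary_components X N"
  have "continuous_map (top_of_set (sphere 0 1)) X (f C)"
    using homeomorphic_imp_continuous_map[OF attaching_map_props(1)[OF C]]
    by (simp add: continuous_map_in_subtopology)
  then have "closedin (top_of_set (sphere 0 1)) {z \<in> topspace (top_of_set (sphere 0 1)). f C z \<in> T}"
    using assms(1) by (rule closedin_continuous_map_preimage)
  then have "closed {z \<in> sphere 0 1. f C z \<in> T}"
    by (simp add: closedin_closed_eq)
  moreover have "{z \<in> cball 0 1. disc_map f C z \<in> Inl ` T} = {z \<in> sphere 0 1. f C z \<in> T}"
    by (auto simp: disc_map_def split: if_splits)
  ultimately show "closed {z \<in> cball 0 1. disc_map f C z \<in> Inl ` T}" by simp
qed

lemma inj_on_disc_map:
  assumes "C \<in> boundary_components X N"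
  shows "inj_on (disc_map f C) (cball 0 1)"
  using attaching_map_props(3)[OF assms] by (auto simp: inj_on_def disc_map_def split: if_splits)

lemma continuous_map_disc_map:
  assumes "C \<in> boundary_components X N"
  shows "continuous_map (top_of_set (cball 0 1)) (glue_discs X N f) (disc_map f C)"
  unfolding continuous_map_def
proof (intro conjI allI impI)
  show "disc_map f C \<in> topspace (top_of_set (cball 0 1)) \<rightarrow> topspace (glue_discs X N f)"
    unfolding topspace_glue_discs using disc_map_image_subset[OF assms assms] by auto
  fix U assume "openin (glue_discs X N f) U"
  then show "openin (top_of_set (cball 0 1)) {x \<in> topspace (top_of_set (cball 0 1)). disc_map f C x \<in> U}"
    using assms by (simp add: openin_glue_discs)
qed

text \<open>Tested against the quotient topology piece by piece: the trace of the image on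
  \<open>N\<close> is the image under \<open>f C\<close> of the part of \<open>T\<close> on the
  circle, the preimage in the disc of \<open>C\<close> is \<open>T\<close>, and in any other disc it
  is empty because distinct boundary components are disjoint. This is the closedness that
  \<open>has_euler_attach_cell\<close> demands.\<close>

lemma closed_map_disc_map:
  assumes C: "C \<in> boundary_components X N"
  shows "closed_map (top_of_set (cball 0 1)) (glue_discs X N f) (disc_map f C)"
  unfolding closed_map_def
proof (intro allI impI)
  fix T :: "complex set" assume "closedin (top_of_set (cball 0 1)) T"
  then have T: "closed T" "T \<subseteq> cball 0 1" by (auto simp: closedin_closed_eq)
  note fC = attaching_map_props[OF C]
  show "closedin (glue_discs X N f) (disc_map f C ` T)"
    unfolding closedin_glue_discs
  proof (intro conjI ballI)
    show "disc_map f C ` T \<subseteq> Inl ` (topspace X \<inter> N) \<union> Inr ` (boundary_components X N \<times> ball 0 1)"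
      using T(2) continuous_map_image_subset_topspace[OF continuous_map_disc_map[OF C]]
      unfolding topspace_glue_discs by auto
    have "Inl x \<in> disc_map f C ` T \<longleftrightarrow> x \<in> f C ` (T \<inter> sphere 0 1)" for x
    proof
      assume "Inl x \<in> disc_map f C ` T"
      then obtain z where z: "z \<in> T" "Inl x = disc_map f C z" by blast
      then have "norm z = 1" using T(2) by (auto simp: disc_map_def split: if_splits)
      with z show "x \<in> f C ` (T \<inter> sphere 0 1)" by (simp add: disc_map_def)
    next
      assume "x \<in> f C ` (T \<inter> sphere 0 1)"
      then obtain z where "z \<in> T" "norm z = 1" "x = f C z" by auto
      then show "Inl x \<in> disc_map f C ` T" by (intro image_eqI[of _ _ z]) (auto simp: disc_map_def)
    qed
    then have "{x \<in> topspace X \<inter> N. Inl x \<in> disc_map f C ` T} = f C ` (T \<inter> sphere 0 1)"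
      using attaching_map_in[OF C] by auto
    moreover have "closedin (subtopology X C) (f C ` (T \<inter> sphere 0 1))"
      using homeomorphic_imp_closed_map[OF fC(1)] T unfolding closed_map_def
      by (simp add: closedin_closed_eq closed_Int)
    ultimately show "closedin (subtopology X N) {x \<in> topspace X \<inter> N. Inl x \<in> disc_map f C ` T}"
      using boundary_component_subset[OF C]
      by (metis closedin_closed_subtopology closedin_subset_topspace subset_trans)
    fix C' assume C': "C' \<in> boundary_components X N"
    show "closed {z \<in> cball 0 1. disc_map f C' z \<in> disc_map f C ` T}"
    proof (cases "C' = C")
      case True
      then have "{z \<in> cball 0 1. disc_map f C' z \<in> disc_map f C ` T} = T"
        using T(2) inj_on_image_mem_iff[OF inj_on_disc_map[OF C] _ T(2)] by auto
      then show ?thesis using T by simp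
    next
      case False
      then have "C \<inter> C' = {}"
        using pairwiseD[OF pairwise_disjoint_connected_components_of] C C'
        unfolding boundary_components_def disjnt_def by metis
      then have "disc_map f C' z \<noteq> disc_map f C w" if "norm z \<le> 1" "norm w \<le> 1" for z w
        using False that fC(2)[of w] attaching_map_props(2)[OF C', of z]
        by (auto simp: disc_map_def)
      moreover have "norm w \<le> 1" if "w \<in> T" for w using that T(2) by auto
      ultimately have "{z \<in> cball 0 1. disc_map f C' z \<in> disc_map f C ` T} = {}"
        by (auto simp: image_iff)
      then show ?thesis by (simp only: closed_empty)
    qed
  qed
qed

text \<open>The discs are attached one at a time, each as a 2-cell that contributes 1.\<close>

lemma has_euler_glue_discs:
  assumes fin: "finite (boundary_components X N)" and c: "has_euler (subtopology X N) {} c"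
  shows "has_euler (glue_discs X N f) {} (c + int (card (boundary_components X N)))"
proof -
  let ?Y = "glue_discs X N f"
  \<comment> \<open>The partial gluings are realized as subspaces of the full one instead of as new
    adjunction spaces; \<C> lists the components capped so far.\<close>
  define S where "S = (\<lambda>\<C> :: 'a set set. Inl ` (topspace X \<inter> N) \<union> Inr ` (\<C> \<times> ball (0::complex) 1))"
  have cl_S: "closedin ?Y (S \<C>)" if "\<C> \<subseteq> boundary_components X N" for \<C>
    unfolding closedin_glue_discs
  proof (intro conjI ballI)
    show "S \<C> \<subseteq> Inl ` (topspace X \<inter> N) \<union> Inr ` (boundary_components X N \<times> ball 0 1)"
      using that by (auto simp: S_def)
    have "{x \<in> topspace X \<inter> N. Inl x \<in> S \<C>} = topspace (subtopology X N)" by (auto simp: S_def)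
    then show "closedin (subtopology X N) {x \<in> topspace X \<inter> N. Inl x \<in> S \<C>}"
      by (simp del: topspace_subtopology)
    fix C assume C: "C \<in> boundary_components X N"
    \<comment> \<open>The disc of a component outside \<C> meets the partial gluing in its boundary
      circle only.\<close>
    have "{z \<in> cball 0 1. disc_map f C z \<in> S \<C>} = (if C \<in> \<C> then cball 0 1 else sphere 0 1)"
      using attaching_map_in[OF C] by (auto simp: disc_map_def S_def split: if_splits)
    then show "closed {z \<in> cball 0 1. disc_map f C z \<in> S \<C>}" by simp
  qed
  have "has_euler (subtopology ?Y (S \<C>)) {} (c + int (card \<C>))"
    if "finite \<C>" "\<C> \<subseteq> boundary_components X N" for \<C>
    using that
  proof (induction \<C>)
    case empty
    have "homeomorphic_map (subtopology X N) (subtopology ?Y (S {})) Inl"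
    proof (rule bijective_closed_imp_homeomorphic_map)
      show "continuous_map (subtopology X N) (subtopology ?Y (S {})) Inl"
        unfolding continuous_map_in_subtopology
      proof
        show "continuous_map (subtopology X N) ?Y Inl"
          unfolding continuous_map_def
          by (auto simp: topspace_glue_discs openin_glue_discs)
        show "Inl \<in> topspace (subtopology X N) \<rightarrow> S {}" by (auto simp: S_def)
      qed
      show "closed_map (subtopology X N) (subtopology ?Y (S {})) Inl"
      proof (rule closed_map_into_subtopology)
        show "closed_map (subtopology X N) ?Y Inl"
          unfolding closed_map_def using N closedin_glue_discs_Inl by (simp add: closedin_closed_subtopology)
      qed (auto simp: S_def)
      show "Inl ` topspace (subtopology X N) = topspace (subtopology ?Y (S {}))"
        by (auto simp: topspace_glue_discs S_def)
    qed auto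
    then show ?case
      using has_euler_homeomorphic[OF c] homeomorphic_map_imp_homeomorphic_space by fastforce
  next
    case (insert C \<C>)
    let ?Z = "subtopology ?Y (S (insert C \<C>))"
    have C: "C \<in> boundary_components X N" and \<C>: "\<C> \<subseteq> boundary_components X N"
      using insert.prems by auto
    have sub: "S \<C> \<subseteq> S (insert C \<C>)" by (auto simp: S_def)
    have tZ: "topspace ?Z = S (insert C \<C>)"
      using closedin_subset[OF cl_S[OF insert.prems]] by auto
    have im: "disc_map f C ` cball 0 1 \<subseteq> S (insert C \<C>)"
      using disc_map_image_subset[OF C insertI1] by (simp add: S_def)
    have "has_euler ?Z {} ((c + int (card \<C>)) + 1)"
    proof (rule has_euler_attach_cell[where \<Phi> = "disc_map f C" and A = "S \<C>"])
      show "closedin ?Z (S \<C>)" using cl_S[OF \<C>] sub by (simp add: closedin_subset_topspace)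
      show "continuous_map (top_of_set (cball 0 1)) ?Z (disc_map f C)"
        using continuous_map_disc_map[OF C] im by (auto simp: continuous_map_in_subtopology)
      show "closed_map (top_of_set (cball 0 1)) ?Z (disc_map f C)"
        using im by (intro closed_map_into_subtopology closed_map_disc_map[OF C]) auto
      show "disc_map f C z \<in> S \<C>" if "norm z = 1" for z
        using attaching_map_in[OF C that] that by (simp add: disc_map_def S_def)
      show "inj_on (disc_map f C) (ball 0 1)"
        using inj_on_disc_map[OF C] ball_subset_cball inj_on_subset by blast
      show "disc_map f C z \<notin> S \<C>" if "norm z < 1" for z
        using that insert.hyps by (auto simp: disc_map_def S_def)
      have "S (insert C \<C>) = S \<C> \<union> Inr ` ({C} \<times> ball 0 1)" by (auto simp: S_def)
      moreover have "disc_map f C ` ball 0 1 = Inr ` ({C} \<times> ball 0 1)"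
        by (auto simp: disc_map_def image_iff)
      ultimately show "topspace ?Z = S \<C> \<union> disc_map f C ` ball 0 1" using tZ by simp
      show "has_euler (subtopology ?Z (S \<C>)) {} (c + int (card \<C>))"
        using insert.IH[OF \<C>] sub by (simp add: subtopology_subtopology Int_absorb1)
    qed (fact has_euler_complex_cell)
    then show ?case using insert.hyps by (simp add: algebra_simps)
  qed
  from this[OF fin subset_refl] show ?thesis
    by (simp add: S_def flip: topspace_glue_discs)
qed

end


section \<open>Regular neighborhoods and embedded graphs\<close>

text \<open>Motion along the collar coordinate. It is used with \<open>max s t\<close>, which moves
  towards \<open>K\<close>, and with \<open>(1 - s) * t\<close>, which moves towards the
  boundary.\<close>

lemma continuous_map_slide:
  fixes Y :: "'a topology" and J :: "real set"
  assumes g: "continuous_map (prod_topology (top_of_set {0..1::real}) (prod_topology Y (top_of_set J)))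
      euclideanreal (\<lambda>u. g (fst u) (snd (snd u)))"
    and J: "\<And>s t. s \<in> {0..1} \<Longrightarrow> t \<in> J \<Longrightarrow> g s t \<in> J"
  shows "continuous_map (prod_topology (top_of_set {0..1::real}) (prod_topology Y (top_of_set J)))
      (prod_topology Y (top_of_set J)) (\<lambda>u. (fst (snd u), g (fst u) (snd (snd u))))"
proof (rule continuous_map_pairedI)
  let ?P = "prod_topology (top_of_set {0..1::real}) (prod_topology Y (top_of_set J))"
  show "continuous_map ?P Y (\<lambda>u. fst (snd u))"
    using continuous_map_compose[OF continuous_map_snd continuous_map_fst] by (simp add: o_def)
  show "continuous_map ?P (top_of_set J) (\<lambda>u. g (fst u) (snd (snd u)))"
    using g J by (auto simp: continuous_map_in_subtopology)
qed

lemma continuous_map_slide_coordinates: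
  fixes Y :: "'a topology" and J :: "real set"
  shows "continuous_map (prod_topology (top_of_set {0..1::real}) (prod_topology Y (top_of_set J))) euclideanreal fst"
    "continuous_map (prod_topology (top_of_set {0..1::real}) (prod_topology Y (top_of_set J))) euclideanreal
       (\<lambda>u. snd (snd u))"
proof -
  let ?P = "prod_topology (top_of_set {0..1::real}) (prod_topology Y (top_of_set J))"
  show "continuous_map ?P euclideanreal fst"
    by (rule continuous_map_into_fulltopology[OF continuous_map_fst])
  have "continuous_map ?P (top_of_set J) (\<lambda>u. snd (snd u))"
    using continuous_map_compose[OF continuous_map_snd continuous_map_snd] by (simp add: o_def)
  then show "continuous_map ?P euclideanreal (\<lambda>u. snd (snd u))"
    by (rule continuous_map_into_fulltopology)
qed

section \<open>Homotopy types around a mapping cylinder neighborhood\<close>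

locale mapping_cylinder_nbhd =
  fixes X :: "'a topology" and K N :: "'a set" and h :: "'a \<times> real \<Rightarrow> 'a"
  assumes comp: "compact_space X" and Hd: "Hausdorff_space X"
    and N: "closedin X N" and KN: "K \<subseteq> X interior_of N"
    and cont: "continuous_map (prod_topology (subtopology X (X frontier_of N)) (top_of_set {0..1}))
          (subtopology X N) h"
    and h0: "\<And>x. x \<in> X frontier_of N \<Longrightarrow> h (x, 0) = x"
    and hom: "homeomorphic_map (prod_topology (subtopology X (X frontier_of N)) (top_of_set {0..<1}))
          (subtopology X (N - K)) h"
    and h1: "h ` ((X frontier_of N) \<times> {1}) = K"
begin

abbreviation "Fr \<equiv> X frontier_of N"
abbreviation "M \<equiv> closed_complement X N"

lemma topspace_frontier: "topspace (subtopology X Fr) = Fr"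
  using frontier_of_subset_topspace[of X N] by auto

lemma nbhd_subset_topspace: "N \<subseteq> topspace X" using N by (rule closedin_subset)

lemma K_subset: "K \<subseteq> N" "K \<inter> Fr = {}"
  using KN interior_of_subset[of X N] by (auto simp: frontier_of_def)

lemma complement_eq: "M = topspace X - X interior_of N"
  by (simp add: closed_complement_def closure_of_complement)

lemma M_closed: "closedin X M"
  by (simp add: closed_complement_def)

lemma complement_nbhd: "M \<inter> N = Fr" "M \<union> N = topspace X" "M \<inter> K = {}"
  using KN nbhd_subset_topspace interior_of_subset[of X N] closure_of_closedin[OF N] by (auto simp: complement_eq frontier_of_def)

lemma h_image: "h ` (Fr \<times> {0..<1}) = N - K"
  using homeomorphic_imp_surjective_map[OF hom] topspace_frontier nbhd_subset_topspace by (simp add: Int_absorb1 Int_absorb2 le_infI2) blast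

lemma h_inj: "inj_on h (Fr \<times> {0..<1})"
  using homeomorphic_imp_injective_map[OF hom] topspace_frontier by simp

lemma h_surj: "h ` (Fr \<times> {0..1}) = N"
proof -
  have "Fr \<times> {0..1::real} = Fr \<times> {0..<1} \<union> Fr \<times> {1}" by auto
  then have "h ` (Fr \<times> {0..1}) = (N - K) \<union> K" by (simp only: image_Un h_image h1)
  then show ?thesis using K_subset by auto
qed

text \<open>Identifications happen at time 1 only, where \<open>h\<close> lands in \<open>K\<close>;
  at earlier times \<open>h\<close> avoids \<open>K\<close> and is injective.\<close>

lemma h_eqD:
  assumes "h (x, t) = h (x', t')" "x \<in> Fr" "x' \<in> Fr" "t \<in> {0..1}" "t' \<in> {0..1}"
  shows "x = x' \<and> t = t' \<or> t = 1 \<and> t' = 1"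
proof -
  have "h (y, s) \<in> K \<longleftrightarrow> s = 1" if "y \<in> Fr" "s \<in> {0..1}" for y s
  proof (cases "s = 1")
    case True
    then show ?thesis using h1 that by auto
  next
    case False
    then have "h (y, s) \<in> N - K" using h_image that by auto
    then show ?thesis using False by simp
  qed
  then have "t = 1 \<longleftrightarrow> t' = 1" using assms by metis
  moreover have "x = x' \<and> t = t'" if "t \<noteq> 1" "t' \<noteq> 1"
    using that assms inj_onD[OF h_inj assms(1)] by auto
  ultimately show ?thesis by blast
qed

lemma K_closed: "closedin X K"
proof -
  have "compactin (subtopology X Fr) Fr"
    using closedin_compact_space[OF comp closedin_frontier_of] by (simp add: compactin_subtopology)
  then have "compactin (prod_topology (subtopology X Fr) (top_of_set {0..1::real})) (Fr \<times> {1})"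
    by (auto simp: compactin_Times compactin_subtopology)
  from image_compactin[OF this cont] have "compactin X K"
    by (simp add: h1 compactin_subtopology)
  then show ?thesis using Hd compactin_imp_closedin by blast
qed

text \<open>Push to time 1 with \<open>max s t\<close>. Points at time 1 stay put, so the motion
  respects the identifications made by \<open>h\<close> and descends to \<open>N\<close>;
  \<open>h\<close> is a quotient map because it is a continuous surjection from a compact space onto
  a Hausdorff space.\<close>

lemma homotopy_equivalent_K: "subtopology X N homotopy_equivalent_space subtopology X K"
proof -
  let ?I = "top_of_set {0..1::real}"
  let ?Y = "prod_topology (subtopology X Fr) ?I"
  have "compact_space (subtopology X Fr)"
    using closedin_compact_space[OF comp closedin_frontier_of] by (simp add: compact_space_subtopology)
  then have "compact_space ?Y"
    by (simp add: compact_space_prod_topology compact_space_subtopology)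
  moreover have "Hausdorff_space (subtopology X N)" using Hd by (rule Hausdorff_space_subtopology)
  ultimately have "closed_map ?Y (subtopology X N) h"
    using cont continuous_imp_closed_map_gen Hausdorff_imp_kc_space by blast
  then have q: "quotient_map ?Y (subtopology X N) h"
    using cont h_surj topspace_frontier nbhd_subset_topspace by (intro continuous_closed_imp_quotient_map) auto
  have slide: "continuous_map (prod_topology ?I ?Y) ?Y (\<lambda>u. (fst (snd u), max (fst u) (snd (snd u))))"
    by (intro continuous_map_slide continuous_map_real_max continuous_map_slide_coordinates) auto
  obtain G where G: "continuous_map (prod_topology ?I (subtopology X N)) (subtopology X N) G"
    "\<And>s u. s \<in> {0..1} \<Longrightarrow> u \<in> topspace ?Y \<Longrightarrow> G (s, h u) = (h \<circ> (\<lambda>u. (fst (snd u), max (fst u) (snd (snd u))))) (s, u)"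
  proof (rule homotopy_from_quotient[OF q continuous_map_compose[OF slide cont]])
    fix s u u' assume "s \<in> {0..1::real}" "u \<in> topspace ?Y" "u' \<in> topspace ?Y" and eq: "h u = h u'"
    moreover obtain x t x' t' where u: "u = (x, t)" "u' = (x', t')" by (cases u; cases u') auto
    ultimately have mem: "x \<in> Fr" "x' \<in> Fr" "t \<in> {0..1}" "t' \<in> {0..1}" and s: "s \<le> 1" using topspace_frontier by auto
    from h_eqD[OF eq[unfolded u] mem] s eq
    show "(h \<circ> (\<lambda>u. (fst (snd u), max (fst u) (snd (snd u))))) (s, u) = (h \<circ> (\<lambda>u. (fst (snd u), max (fst u) (snd (snd u))))) (s, u')"
      unfolding u by (auto simp: max_def)
  qed blast
  have G': "G (s, h (x, t)) = h (x, max s t)" if "s \<in> {0..1}" "x \<in> Fr" "t \<in> {0..1}" for s x t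
    using G(2)[of s "(x, t)"] that topspace_frontier by (simp del: topspace_subtopology)
  have repr: "\<exists>x t. x \<in> Fr \<and> t \<in> {0..1} \<and> y = h (x, t)" if "y \<in> N" for y
    using that h_surj by (force simp: image_iff)
  have "subtopology X N homotopy_equivalent_space subtopology (subtopology X N) K"
  proof (rule deformation_retract_homotopy_equivalent[OF G(1)])
    fix y assume "y \<in> topspace (subtopology X N)"
    then obtain x t where x: "x \<in> Fr" "t \<in> {0..1}" "y = h (x, t)" using repr[of y] by auto
    show "G (0, y) = y" using G'[of 0 x t] x by (simp add: max_def)
    show "G (1, y) \<in> K" using G'[of 1 x t] x h1 by (auto simp: max_def)
  next
    fix y assume "y \<in> K"
    then obtain x where x: "x \<in> Fr" "y = h (x, 1)" using h1 by auto
    then show "G (1, y) = y" using G'[of 1 x 1] by simp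
  qed
  moreover have "subtopology (subtopology X N) K = subtopology X K"
    using K_subset by (simp add: subtopology_subtopology Int_absorb1)
  ultimately show ?thesis by simp
qed

text \<open>\<open>h\<close> identifies \<open>N - K\<close> with the half-open collar, which
  shrinks to time 0.\<close>

lemma homotopy_equivalent_Fr: "subtopology X (N - K) homotopy_equivalent_space subtopology X Fr"
proof -
  let ?I = "top_of_set {0..1::real}"
  let ?Y = "prod_topology (subtopology X Fr) (top_of_set {0..<1::real})"
  have sub1: "(1 - s) * t < 1" if "0 \<le> s" "s \<le> 1" "0 \<le> t" "t < 1" for s t :: real
    using that mult_left_le_one_le[of t "1 - s"] by linarith
  have "continuous_map (prod_topology ?I ?Y) ?Y (\<lambda>u. (fst (snd u), (1 - fst u) * snd (snd u)))"
    using sub1 by (intro continuous_map_slide continuous_map_real_mult continuous_map_diff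
        continuous_map_slide_coordinates) auto
  then have "homotopic_with (\<lambda>x. True) ?Y ?Y id ((\<lambda>x. (x, 0)) \<circ> fst)"
    unfolding homotopic_with[of ?Y "\<lambda>x. True", simplified]
    by (intro exI[of _ "\<lambda>u. (fst (snd u), (1 - fst u) * snd (snd u))"]) auto
  moreover have "retraction_maps ?Y (subtopology X Fr) fst (\<lambda>x. (x, 0))"
    unfolding retraction_maps_def
    by (auto intro!: continuous_map_pairedI simp: continuous_map_fst)
  ultimately have "?Y homotopy_equivalent_space subtopology X Fr"
    using deformation_retraction_imp_homotopy_equivalent_space homotopic_with_symD by blast
  moreover have "subtopology X (N - K) homotopy_equivalent_space ?Y"
    using homeomorphic_imp_homotopy_equivalent_space
      homeomorphic_space_sym homeomorphic_map_imp_homeomorphic_space[OF hom] by blast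
  ultimately show ?thesis using homotopy_eqv_trans by blast
qed

text \<open>Slide the half-open collar back to time 0 and leave \<open>M\<close> fixed. The two
  pieces are closed in the complement of \<open>K\<close> and overlap in the frontier, where the
  slide is the identity.\<close>

lemma homotopy_equivalent_M: "subtopology X (topspace X - K) homotopy_equivalent_space subtopology X M"
proof -
  let ?I = "top_of_set {0..1::real}"
  let ?Y = "prod_topology (subtopology X Fr) (top_of_set {0..<1::real})"
  let ?Z = "subtopology X (topspace X - K)"
  have sub1: "(1 - s) * t < 1" if "0 \<le> s" "s \<le> 1" "0 \<le> t" "t < 1" for s t :: real
    using that mult_left_le_one_le[of t "1 - s"] by linarith
  have slide: "continuous_map (prod_topology ?I ?Y) ?Y (\<lambda>u. (fst (snd u), (1 - fst u) * snd (snd u)))"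
    using sub1 by (intro continuous_map_slide continuous_map_real_mult continuous_map_diff
        continuous_map_slide_coordinates) auto
  have q: "quotient_map ?Y (subtopology X (N - K)) h"
    using hom by (simp add: homeomorphic_map_def)
  have inj: "u = u'" if "u \<in> topspace ?Y" "u' \<in> topspace ?Y" "h u = h u'" for u u'
    using inj_onD[OF h_inj that(3)] that topspace_frontier by auto
  obtain G where G: "continuous_map (prod_topology ?I (subtopology X (N - K))) (subtopology X (N - K)) G"
    "\<And>s u. s \<in> {0..1} \<Longrightarrow> u \<in> topspace ?Y \<Longrightarrow> G (s, h u) = (h \<circ> (\<lambda>u. (fst (snd u), (1 - fst u) * snd (snd u)))) (s, u)"
  proof (rule homotopy_from_quotient[OF q continuous_map_compose[OF slide quotient_imp_continuous_map[OF q]]])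
    fix s u u' assume "s \<in> {0..1::real}" "u \<in> topspace ?Y" "u' \<in> topspace ?Y" "h u = h u'"
    then show "(h \<circ> (\<lambda>u. (fst (snd u), (1 - fst u) * snd (snd u)))) (s, u) = (h \<circ> (\<lambda>u. (fst (snd u), (1 - fst u) * snd (snd u)))) (s, u')"
      using inj by blast
  qed blast
  have G': "G (s, h (x, t)) = h (x, (1 - s) * t)" if "s \<in> {0..1}" "x \<in> Fr" "t \<in> {0..<1}" for s x t
    using G(2)[of s "(x, t)"] that topspace_frontier by (simp del: topspace_subtopology)
  have repr: "\<exists>x t. x \<in> Fr \<and> t \<in> {0..<1} \<and> y = h (x, t)" if "y \<in> N - K" for y
    using that h_image by (force simp: image_iff)
  have GFr: "G (s, x) = x" if "s \<in> {0..1}" "x \<in> Fr" for s x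
    using G'[of s x 0] that h0[of x] by simp
  define H where "H = (\<lambda>(s::real, x). if x \<in> M then x else G (s, x))"
  have tZ: "topspace ?Z = M \<union> (N - K)" using complement_nbhd by auto
  have HZ: "H (s, x) \<in> topspace X - K" if "s \<in> {0..1}" "x \<in> M \<union> (N - K)" for s x
  proof (cases "x \<in> M")
    case True
    then show ?thesis using complement_nbhd by (auto simp: H_def)
  next
    case False
    then have "G (s, x) \<in> N - K"
    proof -
      have "(s, x) \<in> topspace (prod_topology ?I (subtopology X (N - K)))" using False that nbhd_subset_topspace by auto
      then have "G (s, x) \<in> topspace (subtopology X (N - K))"
        using continuous_map_image_subset_topspace[OF G(1)] by (metis image_subset_iff)
      then show ?thesis by simp
    qed
    then show ?thesis using False nbhd_subset_topspace by (auto simp: H_def)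
  qed
  have "continuous_map (prod_topology ?I ?Z) X H"
  proof (rule pasting_lemma_closed[where I = "UNIV :: bool set"
        and T = "\<lambda>b. {0..1} \<times> (if b then M else N - K)" and f = "\<lambda>b. if b then snd else G"])
    fix b :: bool
    have "closedin ?Z M"
      using M_closed complement_nbhd by (intro closedin_subset_topspace) auto
    moreover have "closedin ?Z (N - K)"
      using N nbhd_subset_topspace closedin_subtopology_Int_closed[of X N "topspace X - K"]
      by (metis Int_Diff Int_absorb1 Int_commute)
    ultimately show "closedin (prod_topology ?I ?Z) ({0..1} \<times> (if b then M else N - K))"
      by (auto simp: closedin_prod_Times_iff)
    have 1: "subtopology ?Z M = subtopology X M" "subtopology ?Z (N - K) = subtopology X (N - K)"
      using tZ complement_nbhd by (auto simp: subtopology_subtopology intro!: arg_cong[of _ _ "subtopology X"])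
    have 2: "subtopology ?I {0..1} = ?I" by (simp add: subtopology_subtopology)
    show "continuous_map (subtopology (prod_topology ?I ?Z) ({0..1} \<times> (if b then M else N - K))) X (if b then snd else G)"
      unfolding subtopology_Times 2
      using continuous_map_into_fulltopology[OF G(1)]
        continuous_map_into_fulltopology[OF continuous_map_snd[of ?I "subtopology X M"]]
      by (simp add: 1)
  next
    fix i j :: bool and x
    assume "x \<in> topspace (prod_topology ?I ?Z) \<inter> ({0..1} \<times> (if i then M else N - K)) \<inter> ({0..1} \<times> (if j then M else N - K))"
    moreover have "M \<inter> (N - K) \<subseteq> Fr" using complement_nbhd by auto
    ultimately show "(if i then snd else G) x = (if j then snd else G) x"
      using GFr by (cases i; cases j; cases x) auto
  next
    fix x assume "x \<in> topspace (prod_topology ?I ?Z)"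
    then show "\<exists>j. j \<in> UNIV \<and> x \<in> {0..1} \<times> (if j then M else N - K) \<and> H x = (if j then snd else G) x"
      using tZ by (intro exI[of _ "snd x \<in> M"]) (cases x; auto simp: H_def)
  qed auto
  then have "continuous_map (prod_topology ?I ?Z) ?Z H"
    using HZ tZ by (auto simp: continuous_map_in_subtopology simp del: topspace_subtopology)
  then have "?Z homotopy_equivalent_space subtopology ?Z M"
  proof (rule deformation_retract_homotopy_equivalent)
    fix y assume "y \<in> topspace ?Z"
    then have y: "y \<in> M \<or> y \<in> N - K" using tZ by auto
    show "H (0, y) = y"
    proof (cases "y \<in> M")
      case False
      then obtain x t where x: "x \<in> Fr" "t \<in> {0..<1}" "y = h (x, t)" using y repr by blast
      then show ?thesis using False G'[of 0 x t] by (simp add: H_def)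
    qed (simp add: H_def)
    show "H (1, y) \<in> M"
    proof (cases "y \<in> M")
      case False
      then obtain x t where x: "x \<in> Fr" "t \<in> {0..<1}" "y = h (x, t)" using y repr by blast
      then show ?thesis using False G'[of 1 x t] h0[of x] complement_nbhd by (auto simp: H_def)
    qed (simp add: H_def)
    show "H (1, y) = y" if "y \<in> M" using that by (simp add: H_def)
  qed
  moreover have "subtopology ?Z M = subtopology X M"
    using tZ complement_nbhd by (auto simp: subtopology_subtopology intro!: arg_cong[of _ _ "subtopology X"])
  ultimately show ?thesis by simp
qed

text \<open>The pair \<open>(N, N - K)\<close> has value \<open>k - 0\<close>. Excision transfers it
  to the surface relative to the complement of \<open>K\<close>, and the long exact sequence then
  yields \<open>c - k\<close> for that complement and so for \<open>M\<close>. Finiteness for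
  \<open>M\<close> is a result of this chain.\<close>

lemma has_euler_closed_complement:
  assumes K: "has_euler (subtopology X K) {} k" and X: "has_euler X {} c"
    and Fr: "has_euler (subtopology X Fr) {} 0"
  shows "has_euler (subtopology X N) {} k" "has_euler (subtopology X M) {} (c - k)"
proof -
  show eN: "has_euler (subtopology X N) {} k"
    using K homotopy_equivalent_K has_euler_homotopy_equivalent homotopy_equivalent_space_sym by blast
  have "has_euler (subtopology X (N - K)) {} 0"
    using Fr homotopy_equivalent_Fr has_euler_homotopy_equivalent homotopy_equivalent_space_sym by blast
  moreover have "N \<inter> (topspace X - K) = N - K" using nbhd_subset_topspace by auto
  ultimately have "has_euler (subtopology X N) (N \<inter> (topspace X - K)) (k - 0)"
    by (intro has_euler_pair_relative[OF eN]) (simp add: subtopology_subtopology Int_absorb1)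
  then have "has_euler X (topspace X - K) k"
  \<comment> \<open>What is excised is the complement of \<open>N\<close>; its closure is
    \<open>M\<close>, which misses \<open>K\<close>.\<close>
  proof (intro has_euler_excision[of X N])
    have "openin X (topspace X - K)" using K_closed by (simp add: openin_diff)
    then show "X closure_of (topspace X - N) \<subseteq> X interior_of (topspace X - K)"
      using complement_nbhd by (auto simp: interior_of_openin simp flip: closed_complement_def)
  qed auto
  then have "has_euler (subtopology X (topspace X - K)) {} (c - k)"
    by (rule has_euler_pair_subspace[OF X])
  then show "has_euler (subtopology X M) {} (c - k)"
    using homotopy_equivalent_M has_euler_homotopy_equivalent by blast
qed

end

text \<open>With \<open>b\<close> boundary circles and \<open>c\<close> the Euler characteristic of
  the surface, the two sides are \<open>(c - k) + b\<close> and
  \<open>(k + b) + c - 2 * k\<close>.\<close>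

lemma euler_char_regular_neighborhood:
  assumes X: "closed_surface X" and rn: "regular_neighborhood X K N"
    and f: "attaching_maps X N f" and g: "attaching_maps X (closed_complement X N) g"
    and K: "has_euler (subtopology X K) {} k"
  shows "euler_char (glue_discs X (closed_complement X N) g) =
         euler_char (glue_discs X N f) + euler_char X - 2 * k"
proof -
  have comp: "compact_space X" and Hd: "Hausdorff_space X"
    using X by (auto simp: closed_surface_def)
  have sub: "subsurface X N" using rn by (simp add: regular_neighborhood_def)
  then have N: "closedin X N" by (simp add: subsurface_def)
  obtain h where "mapping_cylinder_nbhd X K N h"
    using rn comp Hd N unfolding regular_neighborhood_def mapping_cylinder_nbhd_def by blast
  then interpret mapping_cylinder_nbhd X K N h .
  obtain c where c: "has_euler X {} c" using X by (rule closed_surface_has_euler)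
  note euler = has_euler_closed_complement[OF K c has_euler_boundary[OF comp sub f]]
  have fin: "finite (boundary_components X N)" using comp sub by (rule finite_boundary_components)
  have eq: "boundary_components X (closed_complement X N) = boundary_components X N"
    by (simp add: boundary_components_def frontier_of_closed_complement[OF sub])
  have "has_euler (glue_discs X N f) {} (k + int (card (boundary_components X N)))"
    by (intro has_euler_glue_discs N f fin euler)
  moreover have "has_euler (glue_discs X M g) {} ((c - k) + int (card (boundary_components X M)))"
    using fin by (intro has_euler_glue_discs M_closed g euler) (simp add: eq)
  ultimately show ?thesis
    using c by (simp add: has_euler_euler_char eq)
qed

section \<open>Euler characteristic of an embedded graph\<close>

lemma has_euler_finite_discrete:
  assumes "Hausdorff_space X" "finite V" "V \<subseteq> topspace X"
  shows "has_euler (subtopology X V) {} (int (card V))"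
proof -
  let ?Y = "subtopology X V"
  have "has_euler (subtopology ?Y (\<Union>((\<lambda>x. {x}) ` V))) {} (int (card ((\<lambda>x. {x}) ` V)) * 1)"
  proof (rule has_euler_disjoint_Union)
    fix U assume "U \<in> (\<lambda>x. {x}) ` V"
    then obtain x where x: "x \<in> V" "U = {x}" by auto
    have "closedin X (V - {x})" using assms by (intro closedin_Hausdorff_finite) auto
    then have "closedin ?Y (V - {x})" by (simp add: closedin_subset_topspace)
    then have "openin ?Y (topspace ?Y - (V - {x}))" by (rule openin_diff[OF openin_topspace])
    moreover have "topspace ?Y - (V - {x}) = U" using x assms(3) by auto
    ultimately show "openin ?Y U" by simp
    show "has_euler (subtopology ?Y U) {} 1"
      using x assms(3) by (intro has_euler_singleton[of _ x]) auto
  qed (use assms in \<open>auto simp: pairwise_def\<close>)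
  then show ?thesis
    by (simp add: subtopology_subtopology card_image)
qed

text \<open>Start with the finite discrete set of vertices and attach the edges as 1-cells, each
  contributing -1. The partial graphs are subspaces of a Hausdorff space, so the cell maps, whose
  domain is compact, are closed.\<close>

lemma has_euler_graph_image:
  assumes Hd: "Hausdorff_space X" and fin: "finite_graph G" and emb: "graph_embedding G X p \<gamma>"
    and F: "F \<in> spanning_subgraphs G"
  shows "has_euler (subtopology X (graph_image p \<gamma> F)) {} (int (card (verts F)) - int (card (edges F)))"
proof -
  have VF: "verts F = verts G" "edges F \<subseteq> edges G"
    using F by (auto simp: spanning_subgraphs_def)
  have finV: "finite (verts G)" and finE: "finite (edges F)"
    and ends: "\<And>e. e \<in> edges G \<Longrightarrow> ends G e \<subseteq> verts G"
    using fin VF finite_subset by (auto simp: finite_graph_def)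
  have injp: "inj_on p (verts G)" and pX: "p ` verts G \<subseteq> topspace X"
    and path: "\<And>e. e \<in> edges G \<Longrightarrow> pathin X (\<gamma> e)"
    and ends_\<gamma>: "\<And>e. e \<in> edges G \<Longrightarrow> {\<gamma> e 0, \<gamma> e 1} = p ` ends G e"
    and inj: "\<And>e. e \<in> edges G \<Longrightarrow> inj_on (\<gamma> e) {0<..<1}"
    and off: "\<And>e. e \<in> edges G \<Longrightarrow> \<gamma> e ` {0<..<1} \<inter> p ` verts G = {}"
    and disj: "\<And>e e'. e \<in> edges G \<Longrightarrow> e' \<in> edges G \<Longrightarrow> e \<noteq> e' \<Longrightarrow> \<gamma> e ` {0<..<1} \<inter> \<gamma> e' ` {0<..<1} = {}"
    using emb by (auto simp: graph_embedding_def)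
  have endV: "\<gamma> e 0 \<in> p ` verts G" "\<gamma> e 1 \<in> p ` verts G" if "e \<in> edges G" for e
    using ends_\<gamma>[OF that] ends[OF that] by auto
  define K where "K = (\<lambda>E. p ` verts G \<union> (\<Union>e\<in>E. \<gamma> e ` {0..1}))"
  \<comment> \<open>Endpoints are already present as vertices, so only the open edges count; these
    are disjoint from each other and from the vertices.\<close>
  have K_edge: "K E = p ` verts G \<union> (\<Union>e\<in>E. \<gamma> e ` {0<..<1})" if "E \<subseteq> edges G" for E
  proof -
    have *: "\<gamma> e ` {0..1} \<union> p ` verts G = \<gamma> e ` {0<..<1} \<union> p ` verts G" if "e \<in> edges G" for e
    proof -
      have "{0..1} = {0<..<1} \<union> {0, 1::real}" by auto
      then show ?thesis using endV[OF that] by auto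
    qed
    have "(\<Union>e\<in>E. \<gamma> e ` {0..1} \<union> p ` verts G) = (\<Union>e\<in>E. \<gamma> e ` {0<..<1} \<union> p ` verts G)"
      by (rule SUP_cong[OF refl], rule *) (use that in blast)
    then show ?thesis unfolding K_def by (cases "E = {}") (simp_all add: UN_simps Un_commute)
  qed
  have compE: "compactin X (\<gamma> e ` {0..1})" if "e \<in> edges G" for e
    using path[OF that] unfolding pathin_def
    by (intro image_compactin) (auto simp: compactin_subtopology)
  have K_closed: "closedin X (K E)" if "finite E" "E \<subseteq> edges G" for E
  proof -
    have "closedin X (p ` verts G)" using Hd finV pX by (intro closedin_Hausdorff_finite) auto
    moreover have "closedin X (\<Union>e\<in>E. \<gamma> e ` {0..1})"
      using that compE compactin_imp_closedin[OF Hd] by (intro closedin_Union) auto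
    ultimately show ?thesis unfolding K_def by (rule closedin_Un)
  qed
  have "has_euler (subtopology X (K E)) {} (int (card (verts G)) - int (card E))"
    if "finite E" "E \<subseteq> edges G" for E
    using that
  proof (induction E)
    case empty
    then show ?case
      using has_euler_finite_discrete[OF Hd _ pX] finV injp by (simp add: K_def card_image)
  next
    case (insert e E)
    have e: "e \<in> edges G" and E: "E \<subseteq> edges G" using insert.prems by auto
    let ?Y = "subtopology X (K (insert e E))"
    \<comment> \<open>The model 1-cell is the unit ball of the reals, hence the reparametrization
      from [-1, 1] to [0, 1].\<close>
    let ?\<Phi> = "\<lambda>s::real. \<gamma> e ((s + 1) / 2)"
    have tY: "topspace ?Y = K (insert e E)"
      using closedin_subset[OF K_closed[OF _ insert.prems]] insert.hyps by auto
    have sub: "K E \<subseteq> K (insert e E)" by (auto simp: K_def)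
    have ball: "(\<lambda>s::real. (s + 1) / 2) ` ball 0 1 = {0<..<1}"
    proof -
      have "x \<in> (\<lambda>s. (s + 1) / 2) ` ball 0 1" if "x \<in> {0<..<1}" for x :: real
        using that by (intro image_eqI[of _ _ "2 * x - 1"]) (auto simp: dist_real_def)
      then show ?thesis by (auto simp: dist_real_def)
    qed
    have \<Phi>_ball: "?\<Phi> ` ball 0 1 = \<gamma> e ` {0<..<1}"
      unfolding ball[symmetric] by (simp add: image_image)
    have cball: "(s + 1) / 2 \<in> {0..1}" if "s \<in> cball 0 1" for s :: real
      using that by (auto simp: dist_real_def)
    have cont: "continuous_map (top_of_set (cball 0 1)) ?Y ?\<Phi>"
    proof -
      have "continuous_map (top_of_set (cball 0 1)) (top_of_set {0..1}) (\<lambda>s::real. (s + 1) / 2)"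
        using cball by (auto simp: continuous_map_in_subtopology intro!: continuous_intros)
      from continuous_map_compose[OF this path[OF e, unfolded pathin_def]]
      have "continuous_map (top_of_set (cball 0 1)) X ?\<Phi>" by (simp add: o_def)
      moreover have "?\<Phi> s \<in> K (insert e E)" if "s \<in> cball 0 1" for s
        using cball[OF that] unfolding K_def by blast
      ultimately show ?thesis by (simp add: continuous_map_in_subtopology)
    qed
    have "has_euler ?Y {} ((int (card (verts G)) - int (card E)) + - 1)"
    proof (rule has_euler_attach_cell[where \<Phi> = ?\<Phi> and A = "K E"])
      show "closedin ?Y (K E)"
        using K_closed[OF insert.hyps(1) E] sub by (rule closedin_subset_topspace)
      show "closed_map (top_of_set (cball 0 1)) ?Y ?\<Phi>"
        using cont Hd by (intro continuous_imp_closed_map_gen Hausdorff_imp_kc_space Hausdorff_space_subtopology)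
          (auto simp: compact_space_subtopology)
      show "?\<Phi> z \<in> K E" if "norm z = 1" for z
      proof -
        have "z = 1 \<or> z = - 1" using that by auto
        then show ?thesis using endV[OF e] by (auto simp: K_def)
      qed
      show "inj_on ?\<Phi> (ball 0 1)"
      proof (rule inj_onI)
        fix x y :: real assume xy: "x \<in> ball 0 1" "y \<in> ball 0 1" "?\<Phi> x = ?\<Phi> y"
        then have "(x + 1) / 2 \<in> {0<..<1}" "(y + 1) / 2 \<in> {0<..<1}" using ball by blast+
        then have "(x + 1) / 2 = (y + 1) / 2" using inj_onD[OF inj[OF e] xy(3)] by blast
        then show "x = y" by simp
      qed
      show "?\<Phi> z \<notin> K E" if "norm z < 1" for z
      proof -
        have "?\<Phi> z \<in> \<gamma> e ` {0<..<1}" using that \<Phi>_ball by auto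
        moreover have "\<gamma> e ` {0<..<1} \<inter> K E = {}"
          using off[OF e] disj[OF e] insert.hyps(2) E unfolding K_edge[OF E] by blast
        ultimately show ?thesis by blast
      qed
      have "K (insert e E) = K E \<union> ?\<Phi> ` ball 0 1"
        unfolding \<Phi>_ball K_edge[OF E] K_edge[OF insert.prems] by auto
      then show "topspace ?Y = K E \<union> ?\<Phi> ` ball 0 1" using tY by simp
      show "has_euler (subtopology ?Y (K E)) {} (int (card (verts G)) - int (card E))"
        using insert.IH[OF E] sub by (simp add: subtopology_subtopology Int_absorb1)
    qed (fact cont has_euler_real_cell)+
    then show ?case using insert.hyps by (simp add: algebra_simps)
  qed
  from this[OF finE VF(2)] show ?thesis
    by (simp add: K_def graph_image_def VF(1))
qed


section \<open>Substitution of monomials\<close>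

definition subst_exponent :: "(var \<Rightarrow> monomial) \<Rightarrow> monomial \<Rightarrow> monomial" where
  "subst_exponent \<sigma> m =
     (\<Sum>v\<in>Poly_Mapping.keys m. Poly_Mapping.map ((*) (Poly_Mapping.lookup m v)) (\<sigma> v))"

text \<open>A common finite index set makes additivity visible even where coefficients of a sum
  cancel and keys disappear.\<close>

lemma subst_monomials_superset:
  assumes "finite S" "Poly_Mapping.keys P \<subseteq> S"
  shows "subst_monomials \<sigma> P =
    (\<Sum>m\<in>S. Poly_Mapping.single (subst_exponent \<sigma> m) (Poly_Mapping.lookup P m))"
  unfolding subst_monomials_def subst_exponent_def
  using assms by (intro sum.mono_neutral_left) (auto simp: in_keys_iff)

lemma subst_monomials_add: "subst_monomials \<sigma> (P + Q) = subst_monomials \<sigma> P + subst_monomials \<sigma> Q"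
proof -
  let ?S = "Poly_Mapping.keys P \<union> Poly_Mapping.keys Q"
  have "subst_monomials \<sigma> R =
      (\<Sum>m\<in>?S. Poly_Mapping.single (subst_exponent \<sigma> m) (Poly_Mapping.lookup R m))"
    if "Poly_Mapping.keys R \<subseteq> ?S" for R
    using that by (intro subst_monomials_superset) auto
  from this[of P] this[of Q] this[of "P + Q"] show ?thesis
    using Poly_Mapping.keys_add[of P Q] by (simp add: lookup_add single_add sum.distrib)
qed

lemma subst_monomials_sum: "subst_monomials \<sigma> (\<Sum>i\<in>I. P i) = (\<Sum>i\<in>I. subst_monomials \<sigma> (P i))"
proof (induction I rule: infinite_finite_induct)
  case (insert i I)
  then show ?case by (simp add: subst_monomials_add)
qed (simp_all add: subst_monomials_def)

lemma subst_monomials_single: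
  "subst_monomials \<sigma> (Poly_Mapping.single m c) = Poly_Mapping.single (subst_exponent \<sigma> m) c"
  using subst_monomials_superset[of "{m}" "Poly_Mapping.single m c" \<sigma>] by simp

lemma map_times_single:
  "Poly_Mapping.map ((*) (q :: rat)) (Poly_Mapping.single v r) = Poly_Mapping.single v (q * r)"
  by (rule poly_mapping_eqI) (auto simp: map.rep_eq lookup_single when_def)

lemma UNIV_var: "(UNIV :: var set) = {VX, VY, VA, VB}"
  using var.exhaust by auto

text \<open>\<open>A\<close> turns into \<open>Y\<close> and \<open>B\<close> into its inverse, so
  their exponents join that of \<open>Y\<close> with signs plus and minus.\<close>

lemma subst_tutte_term:
  "subst_monomials tutte_substitution (var_power VX a * var_power VY b * var_power VA c * var_power VB d) =
   var_power VX a * var_power VY (b + c - d)"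
proof -
  define m :: monomial where "m = Poly_Mapping.single VX a + Poly_Mapping.single VY b +
    Poly_Mapping.single VA c + Poly_Mapping.single VB d"
  have m: "var_power VX a * var_power VY b * var_power VA c * var_power VB d = Poly_Mapping.single m 1"
    by (simp add: m_def var_power_def mult_single)
  have lk: "Poly_Mapping.lookup m VX = a" "Poly_Mapping.lookup m VY = b"
    "Poly_Mapping.lookup m VA = c" "Poly_Mapping.lookup m VB = d"
    by (simp_all add: m_def lookup_add lookup_single)
  have "finite (UNIV :: var set)" by (simp add: UNIV_var)
  moreover have "Poly_Mapping.map ((*) (0 :: rat)) \<mu> = 0" for \<mu> :: monomial
    by (rule poly_mapping_eqI) (simp add: map.rep_eq)
  \<comment> \<open>The sum can run over all four variables, since a variable with exponent 0
    contributes the zero vector.\<close>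
  ultimately have "subst_exponent tutte_substitution m =
    (\<Sum>v\<in>UNIV. Poly_Mapping.map ((*) (Poly_Mapping.lookup m v)) (tutte_substitution v))"
    unfolding subst_exponent_def by (intro sum.mono_neutral_left) (auto simp: in_keys_iff)
  also have "\<dots> = Poly_Mapping.single VX a + Poly_Mapping.single VY (b + c - d)"
    by (simp add: UNIV_var lk map_times_single single_add[symmetric] algebra_simps flip: single_diff)
  finally show ?thesis
    unfolding m subst_monomials_single by (simp add: var_power_def mult_single)
qed

theorem theorem2p4:
  fixes G :: "('v, 'e) graph" and \<Sigma> :: "'a topology"
    and p :: "'v \<Rightarrow> 'a" and \<gamma> :: "'e \<Rightarrow> real \<Rightarrow> 'a"
    and N :: "('v, 'e) graph \<Rightarrow> 'a set"
    and f g :: "('v, 'e) graph \<Rightarrow> 'a set \<Rightarrow> complex \<Rightarrow> 'a"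
  assumes "closed_surface \<Sigma>"
    and "finite_graph G"
    and "graph_embedding G \<Sigma> p \<gamma>"
    and "\<And>F. F \<in> spanning_subgraphs G \<Longrightarrow> regular_neighborhood \<Sigma> (graph_image p \<gamma> F) (N F)"
    and "\<And>F. F \<in> spanning_subgraphs G \<Longrightarrow> attaching_maps \<Sigma> (N F) (f F)"
    and "\<And>F. F \<in> spanning_subgraphs G \<Longrightarrow> attaching_maps \<Sigma> (closed_complement \<Sigma> (N F)) (g F)"
  shows "tutte_poly G =
    var_power VY (of_int (surface_delta \<Sigma>) / 2) *
    subst_monomials tutte_substitution (krushkal_poly G \<Sigma> p \<gamma> N f g)"
proof -
  have Hd: "Hausdorff_space \<Sigma>" using assms(1) by (simp add: closed_surface_def)
  \<comment> \<open>The polynomials are compared term by term: the powers of \<open>X\<close>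
    already agree, and this is the equality of the exponents of \<open>Y\<close>.\<close>
  have exponent: "of_int (nullity F) = of_int (surface_delta \<Sigma>) / 2 +
      ((of_nat (complement_components \<Sigma> p \<gamma> F) - of_nat (num_components \<Sigma>)) +
       of_int (s_number \<Sigma> F (N F) (f F)) / 2 - of_int (s_perp_number \<Sigma> p \<gamma> F (N F) (g F)) / (2 :: rat))"
    if F: "F \<in> spanning_subgraphs G" for F
  proof -
    have "euler_char (glue_discs \<Sigma> (closed_complement \<Sigma> (N F)) (g F)) =
      euler_char (glue_discs \<Sigma> (N F) (f F)) + euler_char \<Sigma> - 2 * (int (card (verts F)) - int (card (edges F)))"
      using assms(4-6)[OF F] has_euler_graph_image[OF Hd assms(2,3) F]
      by (intro euler_char_regular_neighborhood assms(1))
    \<comment> \<open>Doubled in order to stay in the integers; the component numbers of the surface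
      and of the complement cancel.\<close>
    then have "2 * nullity F = surface_delta \<Sigma> +
       2 * (int (complement_components \<Sigma> p \<gamma> F) - int (num_components \<Sigma>)) +
       s_number \<Sigma> F (N F) (f F) - s_perp_number \<Sigma> p \<gamma> F (N F) (g F)"
      by (simp add: nullity_def surface_delta_def s_number_def s_perp_number_def)
    then have "of_int (2 * nullity F) = (of_int (surface_delta \<Sigma> +
       2 * (int (complement_components \<Sigma> p \<gamma> F) - int (num_components \<Sigma>)) +
       s_number \<Sigma> F (N F) (f F) - s_perp_number \<Sigma> p \<gamma> F (N F) (g F)) :: rat)"
      by (simp only:)
    then show ?thesis by (simp add: field_simps)
  qed
  have "var_power VX a * var_power VY (d + q) = var_power VY d * (var_power VX a * var_power VY q)" for a d q
    by (simp add: var_power_def mult_single single_add ac_simps)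
  then show ?thesis
    unfolding tutte_poly_def krushkal_poly_def subst_monomials_sum subst_tutte_term sum_distrib_left
    by (intro sum.cong) (simp_all add: exponent)
qed

end
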